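(* Let $d\ge 1$, $a>0$, $b\in\mathbb{R}^d$, and let $D\subset\mathbb{R}^d$ be an open set. A function $u:D\to\mathbb{R}$ has the mean value property in $D$ (with respect to $a,b$) if and only if it is harmonic in $D$ (with respect to $a,b$).
   Context: Notation: $\|\cdot\|$ is the Euclidean norm, $d(x,G)=\inf\{\|x-y\|:y\in G\}$, $B_r(x)$ is the open ball of radius $r$ centered at $x$, and $\partial B_r(x)=\{z:\|x-z\|=r\}$. Mean value property: a function $u:D\to\mathbb{R}$ has the mean value property in $D$ if $u$ is locally integrable and for all $x\in D$ and all $0<r<d(x,\partial D)$, $$u(x)=\kappa\left(\frac{r\|b\|}{2a}\right)\int_{\partial B_r(x)}u(y)\exp\left\{\frac{1}{2a}\,b\cdot(y-x)\right\}\mu_r(dy)$$ (the integral being well defined), where $\mu_r$ is the surface measure on $\partial B_r(x)$ normalized to have total mass $1$, and $$\kappa(z)=\left(\frac z2\right)^{\frac d2-1}\frac{1}{\Gamma(d/2)\,I_{\frac d2-1}(z)},\quad z>0,\qquad \kappa(0)=1.$$ Here $I_v(z)=\sum_{k\ge0}\frac{(z/2)^{2k+v}}{k!\,\Gamma(k+v+1)}$ is the modified Bessel function of the first kind; for $v>-\tfrac12$ it equals $\frac{(z/2)^v}{\pi^{1/2}\Gamma(v+1/2)}\int_{-1}^1(1-t^2)^{v-1/2}e^{zt}\,dt$. Harmonic: a function $u:D\to\mathbb{R}$ is harmonic in $D$ if $u$ is of class $C^2$ and $Au=0$ in $D$, where $Au(x)=a\Delta u(x)+b\cdot\nabla u(x)$.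 *)

theory Defs
  imports "HOL-Analysis.Analysis"
begin

text \<open>
  \<open>\<real>\<^sup>d\<close> is rendered as an arbitrary type of class \<^class>\<open>euclidean_space\<close> with \<open>d = DIM('a)\<close>, so
  \<open>d \<ge> 1\<close> holds automatically. A function on \<open>D\<close> is a total function whose values outside \<open>D\<close> play
  no role.
\<close>

subsection \<open>Functions of class \<open>C\<^sup>k\<close> and the operator \<open>a \<Delta> + b \<bullet> \<nabla>\<close>\<close>

definition partial_deriv :: "'a::euclidean_space \<Rightarrow> ('a \<Rightarrow> real) \<Rightarrow> 'a \<Rightarrow> real" where
  "partial_deriv i f x = deriv (\<lambda>t. f (x + t *\<^sub>R i)) 0"

primrec Ck_on :: "nat \<Rightarrow> 'a::euclidean_space set \<Rightarrow> ('a \<Rightarrow> real) \<Rightarrow> bool" where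
  "Ck_on 0 S f \<longleftrightarrow> continuous_on S f"
| "Ck_on (Suc k) S f \<longleftrightarrow> continuous_on S f \<and>
     (\<forall>i\<in>Basis. (\<forall>x\<in>S. (\<lambda>t. f (x + t *\<^sub>R i)) differentiable (at 0)) \<and>
                Ck_on k S (partial_deriv i f))"

definition gradient :: "('a::euclidean_space \<Rightarrow> real) \<Rightarrow> 'a \<Rightarrow> 'a" where
  "gradient f x = (\<Sum>i\<in>Basis. partial_deriv i f x *\<^sub>R i)"

definition laplacian :: "('a::euclidean_space \<Rightarrow> real) \<Rightarrow> 'a \<Rightarrow> real" where
  "laplacian f x = (\<Sum>i\<in>Basis. partial_deriv i (partial_deriv i f) x)"

definition drift_laplacian :: "real \<Rightarrow> 'a::euclidean_space \<Rightarrow> ('a \<Rightarrow> real) \<Rightarrow> 'a \<Rightarrow> real" where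
  "drift_laplacian a b u x = a * laplacian u x + b \<bullet> gradient u x"

definition harmonic :: "real \<Rightarrow> 'a::euclidean_space \<Rightarrow> 'a set \<Rightarrow> ('a \<Rightarrow> real) \<Rightarrow> bool" where
  "harmonic a b D u \<longleftrightarrow> Ck_on 2 D u \<and> (\<forall>x\<in>D. drift_laplacian a b u x = 0)"


subsection \<open>Surface measure on spheres\<close>

text \<open>
  The surface measure of a Borel subset \<open>E\<close> of the sphere is \<open>d / r\<close> times the volume of the cone
  over \<open>E\<close> with apex the centre, as in the usual polar coordinate construction; see
  \<open>emeasure_surface_measure\<close> below. The map is the radial projection of the punctured ball onto
  the sphere. For \<open>d = 1\<close> this is counting measure on the two endpoints.
\<close>

definition surface_measure :: "'a::euclidean_space \<Rightarrow> real \<Rightarrow> 'a measure" where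
  "surface_measure x r =
     scale_measure (ennreal (real DIM('a) / r))
       (distr (restrict_space lborel (cball x r - {x})) (restrict_space borel (sphere x r))
         (\<lambda>y. x + (r / norm (y - x)) *\<^sub>R (y - x)))"

text \<open>
  Completed, because an integrand that is merely Lebesgue measurable on the ambient space need not
  be Borel measurable on spheres.
\<close>

definition normalized_surface_measure :: "'a::euclidean_space \<Rightarrow> real \<Rightarrow> 'a measure" where
  "normalized_surface_measure x r =
     completion (uniform_measure (surface_measure x r) (sphere x r))"

lemma space_surface_measure [simp]: "space (surface_measure x r) = sphere x r"
  by (simp add: surface_measure_def space_scale_measure space_restrict_space)

lemma sets_surface_measure [simp]:
  "sets (surface_measure x r) = sets (restrict_space borel (sphere x r))"
  by (simp add: surface_measure_def)

lemma emeasure_surface_measure: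
  fixes x :: "'a::euclidean_space"
  assumes r: "r > 0" and E: "E \<in> sets borel" "E \<subseteq> sphere x r"
  shows "emeasure (surface_measure x r) E =
           ennreal (real DIM('a) / r) *
           emeasure lborel {x + t *\<^sub>R (y - x) | t y. 0 < t \<and> t \<le> 1 \<and> y \<in> E}"
proof -
  let ?p = "\<lambda>y. x + (r / norm (y - x)) *\<^sub>R (y - x)"
  let ?B = "restrict_space lborel (cball x r - {x})"
  have maps: "?p y \<in> sphere x r" if "y \<in> cball x r - {x}" for y
    using that r by (auto simp: dist_norm)
  have [measurable]: "?p \<in> measurable ?B borel"
    by (intro measurable_restrict_space1) measurable
  have meas: "?p \<in> measurable ?B (restrict_space borel (sphere x r))"
    by (rule measurable_restrict_space2) (use maps in \<open>auto simp: space_restrict_space\<close>)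
  have Es: "E \<in> sets (restrict_space borel (sphere x r))"
    using E by (auto simp: sets_restrict_space_iff)
  have eq: "?p -` E \<inter> space ?B = {x + t *\<^sub>R (y - x) | t y. 0 < t \<and> t \<le> 1 \<and> y \<in> E}"
  proof (intro equalityI subsetI)
    fix z assume z: "z \<in> ?p -` E \<inter> space ?B"
    then have zb: "z \<in> cball x r" "z \<noteq> x" and pz: "?p z \<in> E"
      by (auto simp: space_restrict_space)
    have "z = x + (norm (z - x) / r) *\<^sub>R (?p z - x)"
      using r zb by simp
    moreover have "0 < norm (z - x) / r" "norm (z - x) / r \<le> 1"
      using r zb by (auto simp: dist_norm norm_minus_commute)
    ultimately show "z \<in> {x + t *\<^sub>R (y - x) | t y. 0 < t \<and> t \<le> 1 \<and> y \<in> E}"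
      using pz by blast
  next
    fix z assume "z \<in> {x + t *\<^sub>R (y - x) | t y. 0 < t \<and> t \<le> 1 \<and> y \<in> E}"
    then obtain t y where z: "z = x + t *\<^sub>R (y - x)" and t: "0 < t" "t \<le> 1" and y: "y \<in> E"
      by blast
    have n: "norm (y - x) = r"
      using y E(2) by (auto simp: dist_norm norm_minus_commute)
    have "?p z = y"
      using t r n by (simp add: z)
    moreover have "z \<in> cball x r - {x}"
      using t r n by (auto simp: z dist_norm mult_le_cancel_right1)
    ultimately show "z \<in> ?p -` E \<inter> space ?B"
      using y by (simp add: space_restrict_space)
  qed
  have "?p -` E \<inter> space ?B \<in> sets ?B"
    using meas Es by (rule measurable_sets)
  then have B: "emeasure ?B (?p -` E \<inter> space ?B) = emeasure lborel (?p -` E \<inter> space ?B)"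
    by (subst emeasure_restrict_space) (auto simp: space_restrict_space)
  show ?thesis
    unfolding surface_measure_def using meas Es B
    by (simp only: emeasure_scale_measure emeasure_distr eq)
qed

lemma emeasure_normalized_surface_measure:
  fixes x :: "'a::euclidean_space"
  assumes r: "r > 0"
  shows "emeasure (normalized_surface_measure x r) (sphere x r) = 1"
proof -
  let ?C = "{x + t *\<^sub>R (y - x) | t y. 0 < t \<and> t \<le> 1 \<and> y \<in> sphere x r}"
  have C: "?C = cball x r - {x}"
  proof (intro equalityI subsetI)
    fix z assume z: "z \<in> cball x r - {x}"
    let ?y = "x + (r / norm (z - x)) *\<^sub>R (z - x)"
    have "z = x + (norm (z - x) / r) *\<^sub>R (?y - x)" "?y \<in> sphere x r"
         "0 < norm (z - x) / r" "norm (z - x) / r \<le> 1"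
      using z r by (auto simp: dist_norm norm_minus_commute)
    then show "z \<in> ?C" by blast
  next
    fix z assume "z \<in> ?C"
    then obtain t y where "z = x + t *\<^sub>R (y - x)" "0 < t" "t \<le> 1" "norm (y - x) = r"
      by (auto simp: dist_norm norm_minus_commute)
    then show "z \<in> cball x r - {x}"
      using r by (auto simp: dist_norm mult_le_cancel_right1)
  qed
  have "emeasure lborel ?C = emeasure lborel (cball x r)"
    unfolding C by (intro emeasure_Diff_null_set) auto
  also have "\<dots> = ennreal (unit_ball_vol (real DIM('a)) * r ^ DIM('a))"
    using r by (subst emeasure_cball) auto
  finally have "emeasure (surface_measure x r) (sphere x r) =
      ennreal (real DIM('a) / r * (unit_ball_vol (real DIM('a)) * r ^ DIM('a)))"
    using emeasure_surface_measure[OF r, of "sphere x r" x] r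
    by (simp only: ennreal_mult'[of "real DIM('a) / r"] divide_nonneg_pos of_nat_0_le_iff) simp
  moreover have "real DIM('a) / r * (unit_ball_vol (real DIM('a)) * r ^ DIM('a)) > 0"
    using r by (intro mult_pos_pos divide_pos_pos zero_less_power unit_ball_vol_pos) auto
  ultimately have m: "emeasure (surface_measure x r) (sphere x r) \<noteq> 0"
    "emeasure (surface_measure x r) (sphere x r) \<noteq> \<infinity>"
    by (simp_all only: ennreal_eq_0_iff) auto
  have S: "sphere x r \<in> sets (surface_measure x r)"
    by (metis sets.top space_surface_measure)
  show ?thesis
    unfolding normalized_surface_measure_def using m S by (simp add: divide_eq_1_ennreal)
qed


subsection \<open>The mean value property\<close>

definition bessel_I :: "real \<Rightarrow> real \<Rightarrow> real" where
  "bessel_I v z = (\<Sum>k. (z / 2) powr (2 * real k + v) / (fact k * Gamma (real k + v + 1)))"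

definition kappa :: "nat \<Rightarrow> real \<Rightarrow> real" where
  "kappa d z = (if z = 0 then 1
     else (z / 2) powr (real d / 2 - 1) * (1 / (Gamma (real d / 2) * bessel_I (real d / 2 - 1) z)))"

text \<open>
  Extended real valued so that the distance to the empty set is \<open>\<infinity>\<close> (the library's
  \<^const>\<open>infdist\<close> gives \<open>0\<close>), which matters when \<open>D\<close> is the whole space.
\<close>

definition dist_to :: "'a::euclidean_space \<Rightarrow> 'a set \<Rightarrow> ereal" where
  "dist_to x G = (INF y\<in>G. ereal (norm (x - y)))"

definition locally_integrable_on :: "'a::euclidean_space set \<Rightarrow> ('a \<Rightarrow> real) \<Rightarrow> bool" where
  "locally_integrable_on D u \<longleftrightarrow> (\<forall>K. compact K \<and> K \<subseteq> D \<longrightarrow> u absolutely_integrable_on K)"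

definition mean_value_property ::
    "real \<Rightarrow> 'a::euclidean_space \<Rightarrow> 'a set \<Rightarrow> ('a \<Rightarrow> real) \<Rightarrow> bool" where
  "mean_value_property a b D u \<longleftrightarrow>
     locally_integrable_on D u \<and>
     (\<forall>x\<in>D. \<forall>r>0. ereal r < dist_to x (frontier D) \<longrightarrow>
        integrable (normalized_surface_measure x r) (\<lambda>y. u y * exp (1 / (2 * a) * (b \<bullet> (y - x)))) \<and>
        u x = kappa DIM('a) (r * norm b / (2 * a)) *
          (LINT y|normalized_surface_measure x r. u y * exp (1 / (2 * a) * (b \<bullet> (y - x)))))"

end

theory Submission
  imports Defs
begin

text \<open>
  With \<open>c = b / 2a\<close> and \<open>v(y) = u(y) exp(c \<bullet> y)\<close>, the equation \<open>Au = 0\<close> becomes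
  \<open>\<Delta>v = |c|\<^sup>2 v\<close> and the mean value property says that the mean of \<open>v\<close> over
  \<open>\<partial>B\<^sub>r(x)\<close> is \<open>\<phi>(r) v(x)\<close>, where \<open>\<phi>(r) = 1 / \<kappa>(r|c|)\<close> and
  \<open>\<Phi>(y) = \<phi>(|y|)\<close> solves \<open>\<Delta>\<Phi> = |c|\<^sup>2 \<Phi>\<close>. Let \<open>f(s)\<close> be the mean of \<open>v\<close>
  over \<open>\<partial>B\<^sub>s(x)\<close>. Integrating \<open>div(\<eta> (\<Phi> \<nabla>v - v \<nabla>\<Phi>))\<close> for radial
  compactly supported \<open>\<eta>\<close> relates the integral of \<open>\<nabla>\<eta>\<close> against the Wronskian
  \<open>\<phi> f' - f \<phi>'\<close> to that of \<open>\<eta> \<Phi> (\<Delta>v - |c|\<^sup>2 v)\<close>; this replaces the divergence theorem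
  on balls. If the equation holds, all these integrals vanish, so \<open>f / \<phi>\<close> is constant. If
  \<open>f = \<phi> v(x)\<close>, the Wronskian vanishes and testing with \<open>\<eta>\<close> concentrated at \<open>x\<close> gives the
  equation; the required \<open>C\<^sup>2\<close> regularity comes from mollifying with a radial kernel, which
  reproduces \<open>v\<close> up to a constant factor.
\<close>

text \<open>Multiplying by \<open>exp (c \<bullet> y)\<close> is forced: the Laplacian of the
  product contains the cross term \<open>2 * (c \<bullet> gradient u)\<close>, which is the drift
  divided by \<open>a\<close> exactly when \<open>2 c = b / a\<close>. Radial functions are written
  in the variable \<open>t = |y|^2\<close>: since \<open>y \<bullet> y\<close> is a polynomial, a
  smooth profile on the line gives a function smooth at the origin, and the radial Helmholtz
  equation becomes the confluent hypergeometric limit equation with parameter \<open>d / 2\<close>,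
  whose solution with value 1 at 0 gives the reciprocal of \<open>kappa\<close>. A spherical mean is
  an expectation over one fixed probability space, the unit ball with directions
  \<open>dir z\<close>; the radius occurs only in the integrand and can be differentiated there,
  also for \<open>d = 1\<close>. The obstacle on the way from means to the equation is that
  \<open>u\<close> is at first only Lebesgue measurable. A Borel representative agrees with it on
  almost every sphere around a given centre, but perhaps not on every one. After averaging over
  radii this is enough, so regularity has to be settled before any derivative is taken.\<close>

subsection \<open>Parameter integrals and partial derivatives\<close>

text \<open>Dominated convergence for the difference quotients \<open>q h\<close>: the mean value
  inequality on the convex set \<open>U\<close> turns the bound \<open>B\<close> on the derivative
  into a bound on the quotients.\<close>

lemma has_real_derivative_integral:
  fixes G :: "real \<Rightarrow> 'b \<Rightarrow> real"
  assumes U: "open U" "convex U" "t0 \<in> U"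
    and int: "\<And>t. t \<in> U \<Longrightarrow> integrable M (G t)"
    and der: "\<And>t y. t \<in> U \<Longrightarrow> y \<in> space M \<Longrightarrow> ((\<lambda>t. G t y) has_real_derivative G' t y) (at t)"
    and bd: "\<And>t y. t \<in> U \<Longrightarrow> y \<in> space M \<Longrightarrow> \<bar>G' t y\<bar> \<le> B y"
    and B: "integrable M B"
  shows "integrable M (G' t0)"
    and "((\<lambda>t. integral\<^sup>L M (G t)) has_real_derivative integral\<^sup>L M (G' t0)) (at t0)"
proof -
  define S where "S = {h. t0 + h \<in> U}"
  have S: "open S" "0 \<in> S"
  proof -
    have "S = (\<lambda>h. t0 + h) -` U"
      by (auto simp: S_def)
    then show "open S"
      using U by (auto intro!: open_vimage continuous_intros)
    show "0 \<in> S"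
      using U by (simp add: S_def)
  qed
  define q where "q h y = (G (t0 + h) y - G t0 y) / h" for h y
  have qint: "integrable M (q h)" if "h \<in> S" for h
    unfolding q_def using that int U by (auto simp: S_def)
  have qbd: "norm (q h y) \<le> B y" if "h \<in> S - {0}" "y \<in> space M" for h y
  proof -
    have "norm (G (t0 + h) y - G t0 y) \<le> B y * norm (t0 + h - t0)"
    proof (rule field_differentiable_bound[OF U(2), where f' = "\<lambda>t. G' t y"])
      fix t assume "t \<in> U"
      then show "((\<lambda>t. G t y) has_real_derivative G' t y) (at t within U)"
        using der that(2) by (blast intro: has_field_derivative_at_within)
      show "norm (G' t y) \<le> B y"
        using bd \<open>t \<in> U\<close> that(2) by simp
    qed (use that(1) U in \<open>auto simp: S_def\<close>)
    then show ?thesis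
      using that by (simp add: q_def pos_divide_le_eq)
  qed
  have qlim: "((\<lambda>h. q h y) \<longlongrightarrow> G' t0 y) (at 0)" if "y \<in> space M" for y
    using der[OF U(3) that] by (simp add: q_def DERIV_def)
  have seq: "integrable M (G' t0) \<and> (\<lambda>n. integral\<^sup>L M (q (X n))) \<longlonglongrightarrow> integral\<^sup>L M (G' t0)"
    if X: "\<And>n. X n \<in> S - {0}" "X \<longlonglongrightarrow> 0" for X
  proof -
    have lim: "(\<lambda>n. q (X n) y) \<longlonglongrightarrow> G' t0 y" if "y \<in> space M" for y
      using qlim[OF that] X by (auto simp: tendsto_at_iff_sequentially comp_def)
    have meas: "q (X n) \<in> borel_measurable M" for n
      using qint[of "X n"] X by auto
    have m: "G' t0 \<in> borel_measurable M"
      using borel_measurable_LIMSEQ_real[OF lim meas] .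
    have "AE y in M. (\<lambda>n. q (X n) y) \<longlonglongrightarrow> G' t0 y"
      using lim by (intro AE_I2)
    moreover have "AE y in M. norm (q (X n) y) \<le> B y" for n
      using qbd X by (intro AE_I2) auto
    ultimately show ?thesis
      using integrable_dominated_convergence[of "G' t0" M "\<lambda>n. q (X n)", OF m meas B]
        integral_dominated_convergence[of "G' t0" M "\<lambda>n. q (X n)", OF m meas B]
      by blast
  qed
  obtain e where e: "e > 0" "ball 0 e \<subseteq> S"
    using S openE by blast
  \<comment> \<open>\<open>seq\<close> also delivers integrability of the limit, but only for a
    given null sequence in \<open>S - {0}\<close>; one concrete sequence supplies it.\<close>
  have "(\<lambda>n. e / 2 * inverse (real (Suc n))) \<longlonglongrightarrow> e / 2 * 0"
    by (intro tendsto_intros LIMSEQ_inverse_real_of_nat)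
  moreover have "e / 2 * inverse (real (Suc n)) \<in> S - {0}" for n
  proof -
    have "e / 2 * inverse (real (Suc n)) \<le> e / 2 * 1"
      using e by (intro mult_left_mono) (auto simp: divide_simps)
    then have "e / 2 * inverse (real (Suc n)) \<in> ball 0 e"
      using e by (simp add: dist_real_def abs_of_pos del: of_nat_Suc)
    then show ?thesis using e by (auto simp del: of_nat_Suc)
  qed
  ultimately show i: "integrable M (G' t0)"
    using seq[of "\<lambda>n. e / 2 * inverse (real (Suc n))"] by simp
  have "((\<lambda>h. integral\<^sup>L M (q h)) \<longlongrightarrow> integral\<^sup>L M (G' t0)) (at 0 within S)"
    unfolding tendsto_at_iff_sequentially comp_def
  proof (intro allI impI)
    fix X assume "\<forall>i. X i \<in> S - {0}" "X \<longlonglongrightarrow> 0"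
    then show "(\<lambda>n. integral\<^sup>L M (q (X n))) \<longlonglongrightarrow> integral\<^sup>L M (G' t0)"
      using seq[of X] by blast
  qed
  then have "((\<lambda>h. integral\<^sup>L M (q h)) \<longlongrightarrow> integral\<^sup>L M (G' t0)) (at 0)"
    by (simp only: at_within_open[OF S(2,1)])
  moreover have "\<forall>\<^sub>F h in at 0. integral\<^sup>L M (q h) = (integral\<^sup>L M (G (t0 + h)) - integral\<^sup>L M (G t0)) / h"
  proof -
    have "\<forall>\<^sub>F h in at 0. h \<in> S"
      by (rule eventually_at_in_open'[OF S])
    then show ?thesis
      by eventually_elim (use int U in \<open>simp add: q_def[abs_def] S_def\<close>)
  qed
  ultimately show "((\<lambda>t. integral\<^sup>L M (G t)) has_real_derivative integral\<^sup>L M (G' t0)) (at t0)"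
    unfolding DERIV_def by (rule Lim_transform_eventually)
qed

lemma continuous_on_integral_param:
  fixes g :: "'c::metric_space \<Rightarrow> 'b \<Rightarrow> real"
  assumes meas: "\<And>t. t \<in> S \<Longrightarrow> g t \<in> borel_measurable M"
    and cont: "\<And>y. y \<in> space M \<Longrightarrow> continuous_on S (\<lambda>t. g t y)"
    and bd: "\<And>t y. t \<in> S \<Longrightarrow> y \<in> space M \<Longrightarrow> \<bar>g t y\<bar> \<le> B y"
    and B: "integrable M B"
  shows "continuous_on S (\<lambda>t. integral\<^sup>L M (g t))"
  unfolding continuous_on_sequentially comp_def
proof (intro allI ballI impI, elim conjE)
  fix X t assume t: "t \<in> S" and X: "\<forall>n. X n \<in> S" "X \<longlonglongrightarrow> t"
  show "(\<lambda>n. integral\<^sup>L M (g (X n))) \<longlonglongrightarrow> integral\<^sup>L M (g t)"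
  proof (rule integral_dominated_convergence[OF meas[OF t] meas B])
    show "AE y in M. (\<lambda>n. g (X n) y) \<longlonglongrightarrow> g t y"
      using cont t X by (intro AE_I2) (auto simp: continuous_on_sequentially comp_def)
  qed (use X bd in auto)
qed

text \<open>On some ball \<open>f\<close> exceeds \<open>f p / 2\<close>, and balls have positive
  volume. This is how vanishing integrals are turned into pointwise statements later.\<close>

lemma integral_pos_if_isCont:
  fixes f :: "'a::euclidean_space \<Rightarrow> real"
  assumes int: "integrable lborel f" and nn: "\<And>x. f x \<ge> 0" and c: "isCont f p" and p: "f p > 0"
  shows "integral\<^sup>L lborel f > 0"
proof -
  have "\<forall>\<^sub>F x in at p. f x > f p / 2"
    using c p by (intro order_tendstoD) (auto simp: isCont_def)
  then obtain e where e: "e > 0" "\<And>x. dist x p < e \<Longrightarrow> x \<noteq> p \<Longrightarrow> f x > f p / 2"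
    unfolding eventually_at by auto
  have ge: "f x \<ge> f p / 2 * indicator (ball p e) x" for x
    using e(2)[of x] nn[of x] p by (cases "x = p") (auto simp: indicator_def dist_commute)
  have "0 < f p / 2 * measure lborel (ball p e)"
    using p e by (simp add: content_ball_pos)
  also have "\<dots> = (LINT x|lborel. f p / 2 * indicator (ball p e) x)"
    by simp
  also have "\<dots> \<le> integral\<^sup>L lborel f"
    using int ge
    by (intro integral_mono integrable_mult_right integrable_real_indicator[OF _ emeasure_lborel_ball_finite]) auto
  finally show ?thesis .
qed

lemma has_real_derivative_line_shift:
  fixes f :: "'a::real_vector \<Rightarrow> real"
  assumes "((\<lambda>t. f ((p + s *\<^sub>R i) + t *\<^sub>R i)) has_real_derivative D) (at 0)"
  shows "((\<lambda>t. f (p + t *\<^sub>R i)) has_real_derivative D) (at s)"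
proof -
  have "((\<lambda>t. f (p + (t + s) *\<^sub>R i)) has_real_derivative D) (at 0)"
  proof -
    have "p + (t + s) *\<^sub>R i = (p + s *\<^sub>R i) + t *\<^sub>R i" for t
      by (simp add: algebra_simps)
    then show ?thesis
      using assms by (simp only:)
  qed
  then show ?thesis
    using DERIV_shift[of "\<lambda>t. f (p + t *\<^sub>R i)" D 0 s] by simp
qed

text \<open>\<open>Ck_on\<close> speaks only of derivatives along coordinate lines, while
  differentiating along a ray needs the chain rule. The increment is split into steps along one
  coordinate at a time.\<close>

lemma has_derivative_if_continuous_partials:
  fixes f :: "'a::euclidean_space \<Rightarrow> real"
  assumes S: "open S" "x \<in> S"
    and der: "\<And>i y. i \<in> Basis \<Longrightarrow> y \<in> S \<Longrightarrow> ((\<lambda>t. f (y + t *\<^sub>R i)) has_real_derivative f' i y) (at 0)"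
    and cont: "\<And>i. i \<in> Basis \<Longrightarrow> continuous_on S (f' i)"
  shows "(f has_derivative (\<lambda>h. \<Sum>i\<in>Basis. (h \<bullet> i) * f' i x)) (at x)"
  unfolding has_derivative_at_alt
proof (intro conjI allI impI)
  show "bounded_linear (\<lambda>h. \<Sum>i\<in>Basis. (h \<bullet> i) * f' i x)"
    by (intro bounded_linear_sum bounded_linear_mult_const bounded_linear_inner_left)
next
  fix e :: real assume e: "e > 0"
  \<comment> \<open>There are \<open>DIM('a)\<close> coordinate steps, each with error at most
    \<open>c * norm h\<close>.\<close>
  define c where "c = e / real DIM('a)"
  have c: "c > 0" using e by (simp add: c_def)
  have "\<exists>d>0. ball x d \<subseteq> S \<and> (\<forall>i\<in>Basis. \<forall>y\<in>ball x d. \<bar>f' i y - f' i x\<bar> < c)"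
  proof -
    have "\<forall>\<^sub>F y in nhds x. \<bar>f' i y - f' i x\<bar> < c" if "i \<in> Basis" for i
    proof -
      have "isCont (f' i) x"
        using cont[OF that] S continuous_on_eq_continuous_at by blast
      then have "(f' i \<longlongrightarrow> f' i x) (nhds x)"
        by (simp add: continuous_at isCont_def tendsto_nhds_iff)
      then show ?thesis
        using tendstoD[OF _ c] by (fastforce simp: dist_real_def)
    qed
    then have "\<forall>\<^sub>F y in nhds x. \<forall>i\<in>Basis. \<bar>f' i y - f' i x\<bar> < c"
      by (simp add: eventually_ball_finite)
    moreover have "\<forall>\<^sub>F y in nhds x. y \<in> S"
      using S by (simp add: eventually_nhds_in_open)
    ultimately have "\<forall>\<^sub>F y in nhds x. y \<in> S \<and> (\<forall>i\<in>Basis. \<bar>f' i y - f' i x\<bar> < c)"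
      by eventually_elim auto
    then show ?thesis
      unfolding eventually_nhds_metric by (fastforce simp: dist_commute)
  qed
  then obtain d where d: "d > 0" "ball x d \<subseteq> S"
    "\<And>i y. i \<in> Basis \<Longrightarrow> y \<in> ball x d \<Longrightarrow> \<bar>f' i y - f' i x\<bar> < c"
    by blast
  show "\<exists>d>0. \<forall>y. norm (y - x) < d \<longrightarrow>
      norm (f y - f x - (\<Sum>i\<in>Basis. ((y - x) \<bullet> i) * f' i x)) \<le> e * norm (y - x)"
  proof (intro exI[of _ d] conjI allI impI d)
    fix y assume y: "norm (y - x) < d"
    define h where "h = y - x"
    define s where "s A = (\<Sum>i\<in>A. (h \<bullet> i) *\<^sub>R i)" for A :: "'a set"
    have "\<bar>f (x + s A) - f x - (\<Sum>i\<in>A. (h \<bullet> i) * f' i x)\<bar> \<le> real (card A) * c * norm h"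
      if "A \<subseteq> Basis" for A
    proof -
      have "finite A" using that finite_subset finite_Basis by blast
      then show ?thesis using that
      proof (induction A rule: finite_induct)
        case empty
        then show ?case by (simp add: s_def)
      next
        case (insert j A)
        let ?p = "x + s A"
        \<comment> \<open>Each coordinate of the displacement from \<open>x\<close> is bounded by
          that of \<open>h\<close>, so the axis-parallel path stays in the ball.\<close>
        have inb: "?p + t *\<^sub>R j \<in> ball x d" if t: "t \<in> closed_segment 0 (h \<bullet> j)" for t
        proof -
          have abst: "\<bar>t\<bar> \<le> \<bar>h \<bullet> j\<bar>"
            using t by (auto simp: closed_segment_eq_real_ivl split: if_splits)
          have "norm (s A + t *\<^sub>R j) \<le> norm h"
          proof (rule norm_le_componentwise)
            fix i :: 'a assume i: "i \<in> Basis"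
            have "s A \<bullet> i = (\<Sum>k\<in>A. if k = i then h \<bullet> i else 0)"
              unfolding s_def inner_sum_left
              using i insert.prems by (intro sum.cong) (auto simp: inner_Basis)
            also have "\<dots> = (if i \<in> A then h \<bullet> i else 0)"
              using insert.hyps by (simp add: sum.delta)
            finally show "\<bar>(s A + t *\<^sub>R j) \<bullet> i\<bar> \<le> \<bar>h \<bullet> i\<bar>"
              using i insert abst by (auto simp: inner_add_left inner_Basis)
          qed
          then have "norm (s A + t *\<^sub>R j) < d"
            using y by (simp add: h_def)
          moreover have "dist x (?p + t *\<^sub>R j) = norm (s A + t *\<^sub>R j)"
            unfolding dist_norm by (subst norm_minus_commute) (simp add: add.assoc)
          ultimately show ?thesis
            by simp
        qed
        \<comment> \<open>Mean value inequality for \<open>f\<close> minus its linear part at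
          \<open>x\<close>; along the segment the derivative is a difference of values of
          \<open>f' j\<close>, hence at most \<open>c\<close>.\<close>
        have "norm ((f (?p + (h \<bullet> j) *\<^sub>R j) - (h \<bullet> j) * f' j x) - (f (?p + 0 *\<^sub>R j) - 0 * f' j x))
            \<le> c * norm (h \<bullet> j - 0)"
        proof (rule field_differentiable_bound[where S = "closed_segment 0 (h \<bullet> j)"
              and f' = "\<lambda>t. f' j (?p + t *\<^sub>R j) - f' j x"])
          fix t assume t: "t \<in> closed_segment 0 (h \<bullet> j)"
          have "((\<lambda>t. f (?p + t *\<^sub>R j)) has_real_derivative f' j (?p + t *\<^sub>R j)) (at t)"
            by (rule has_real_derivative_line_shift, rule der) (use inb[OF t] d insert in auto)
          then show "((\<lambda>t. f (?p + t *\<^sub>R j) - t * f' j x) has_real_derivative f' j (?p + t *\<^sub>R j) - f' j x)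
              (at t within closed_segment 0 (h \<bullet> j))"
            by (auto intro!: derivative_eq_intros intro: has_field_derivative_at_within)
          show "norm (f' j (?p + t *\<^sub>R j) - f' j x) \<le> c"
            using d(3)[OF _ inb[OF t]] insert by fastforce
        qed auto
        also have "\<dots> \<le> c * norm h"
          using c insert by (simp add: Basis_le_norm)
        finally have "\<bar>f (?p + (h \<bullet> j) *\<^sub>R j) - f ?p - (h \<bullet> j) * f' j x\<bar> \<le> c * norm h"
          by (simp add: algebra_simps)
        then have "\<bar>f (x + s (insert j A)) - f ?p - (h \<bullet> j) * f' j x\<bar> \<le> c * norm h"
          using insert by (simp add: s_def add_ac)
        moreover have "\<bar>f ?p - f x - (\<Sum>i\<in>A. (h \<bullet> i) * f' i x)\<bar> \<le> real (card A) * c * norm h"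
          using insert by simp
        moreover have "real (card (insert j A)) * c * norm h = c * norm h + real (card A) * c * norm h"
          using insert by (simp add: algebra_simps)
        moreover have "(\<Sum>i\<in>insert j A. (h \<bullet> i) * f' i x) = (h \<bullet> j) * f' j x + (\<Sum>i\<in>A. (h \<bullet> i) * f' i x)"
          using insert by simp
        ultimately show ?case
by linarith
      qed
    qed
    from this[of Basis] show "norm (f y - f x - (\<Sum>i\<in>Basis. ((y - x) \<bullet> i) * f' i x)) \<le> e * norm (y - x)"
      using e by (simp add: s_def h_def c_def euclidean_representation)
  qed
qed

section \<open>Functions of bounded support and integration by parts\<close>

lemma continuous_on_bounded_support:
  fixes h A :: "'a::euclidean_space \<Rightarrow> real"
  assumes r: "r < R" and A: "continuous_on (ball 0 R) A" and h: "continuous_on UNIV h"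
    and z: "\<And>y. norm y \<ge> r \<Longrightarrow> h y = 0"
  shows "continuous_on UNIV (\<lambda>y. h y * A y)"
proof -
  \<comment> \<open>\<open>A\<close> is arbitrary outside the ball, but there the product is 0. The
    two open sets overlap and cover the space.\<close>
  have "continuous_on (ball 0 R \<union> - cball 0 r) (\<lambda>y. h y * A y)"
  proof (rule continuous_on_open_Un)
    show "continuous_on (ball 0 R) (\<lambda>y. h y * A y)"
      using A h by (intro continuous_on_mult) (auto intro: continuous_on_subset)
    have "continuous_on (- cball 0 r) (\<lambda>y. 0 :: real)"
      by simp
    then show "continuous_on (- cball 0 r) (\<lambda>y. h y * A y)"
      by (rule continuous_on_eq) (use z in auto)
  qed auto
  moreover have "ball 0 R \<union> - cball 0 r = (UNIV :: 'a set)"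
    using r by auto
  ultimately show ?thesis by simp
qed

lemma integrable_bounded_support:
  fixes g :: "'a::euclidean_space \<Rightarrow> real"
  assumes g: "continuous_on UNIV g" and z: "\<And>y. norm y \<ge> r \<Longrightarrow> g y = 0"
  shows "integrable lborel g"
proof -
  have "integrable lborel (\<lambda>y. indicator (cball 0 r) y *\<^sub>R g y)"
    by (rule borel_integrable_compact) (use g in \<open>auto intro: continuous_on_subset\<close>)
  also have "(\<lambda>y. indicator (cball 0 r) y *\<^sub>R g y) = g"
    using z by (auto simp: indicator_def fun_eq_iff)
  finally show ?thesis .
qed

text \<open>By translation invariance the integral of \<open>g (y + t *\<^sub>R i)\<close> is
  constant in \<open>t\<close>; differentiating under the integral at \<open>t = 0\<close> gives the
  integral of \<open>g'\<close>.\<close>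

lemma integral_partial_derivative_eq_0:
  fixes g g' :: "'a::euclidean_space \<Rightarrow> real"
  assumes der: "\<And>y. ((\<lambda>t. g (y + t *\<^sub>R i)) has_real_derivative g' y) (at 0)" and i: "i \<in> Basis"
    and g: "continuous_on UNIV g" "\<And>y. norm y \<ge> r \<Longrightarrow> g y = 0"
    and g': "continuous_on UNIV g'" "\<And>y. norm y \<ge> r \<Longrightarrow> g' y = 0"
  shows "integral\<^sup>L lborel g' = 0"
proof -
  have "compact (g' ` cball 0 r)"
    using g' by (intro compact_continuous_image) (auto intro: continuous_on_subset)
  then obtain C0 where C0: "\<And>y. y \<in> cball 0 r \<Longrightarrow> \<bar>g' y\<bar> \<le> C0"
    using compact_imp_bounded[of "g' ` cball 0 r"] unfolding bounded_iff by (metis imageI real_norm_def)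
  define C where "C = max C0 0"
  have C: "\<bar>g' y\<bar> \<le> C" for y
    using C0[of y] g'(2)[of y] by (cases "norm y \<ge> r") (auto simp: C_def)
  have shift: "integrable lborel (\<lambda>y. g (y + t *\<^sub>R i))" "(LINT y|lborel. g (y + t *\<^sub>R i)) = integral\<^sup>L lborel g" for t
  proof -
    have l: "lborel = distr lborel borel ((+) (t *\<^sub>R i))"
      by (simp add: lborel_distr_plus)
    have gi: "integrable lborel g"
      using integrable_bounded_support g by blast
    then have [measurable]: "g \<in> borel_measurable borel" by auto
    show "integrable lborel (\<lambda>y. g (y + t *\<^sub>R i))"
      using gi by (subst (asm) l) (simp add: integrable_distr_eq add.commute)
    show "(LINT y|lborel. g (y + t *\<^sub>R i)) = integral\<^sup>L lborel g"
      by (subst (2) l) (simp add: integral_distr add.commute)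
  qed
  \<comment> \<open>For \<open>\<bar>t\<bar> < 1\<close> all translates of \<open>g'\<close> live in
    \<open>cball 0 (r + 1)\<close>, so one integrable bound serves them all.\<close>
  have "((\<lambda>t. LINT y|lborel. g (y + t *\<^sub>R i)) has_real_derivative (LINT y|lborel. g' (y + 0 *\<^sub>R i))) (at 0)"
  proof (rule has_real_derivative_integral(2)[where U = "{-1<..<1}" and B = "\<lambda>y. C * indicator (cball 0 (r + 1)) y"
        and G' = "\<lambda>t y. g' (y + t *\<^sub>R i)"])
    show "integrable lborel (\<lambda>y. C * indicator (cball 0 (r + 1)) y)"
      by (intro integrable_mult_right integrable_real_indicator[OF _ emeasure_lborel_cball_finite]) auto
    show "((\<lambda>t. g (y + t *\<^sub>R i)) has_real_derivative g' (y + t *\<^sub>R i)) (at t)" for t y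
      by (rule has_real_derivative_line_shift, rule der)
    show "\<bar>g' (y + t *\<^sub>R i)\<bar> \<le> C * indicator (cball 0 (r + 1)) y" if "t \<in> {-1<..<1}" for t y
    proof (cases "norm y \<le> r + 1")
      case True
      then show ?thesis using C by simp
    next
      case False
      have "norm y \<le> norm (y + t *\<^sub>R i) + norm (t *\<^sub>R i)"
        by (metis add_diff_cancel norm_triangle_ineq4)
      then have "norm (y + t *\<^sub>R i) \<ge> r"
        using False that i by (simp add: abs_if split: if_splits)
      then show ?thesis using g' False by simp
    qed
  qed (auto simp: shift)
  then have "((\<lambda>t. integral\<^sup>L lborel g) has_real_derivative integral\<^sup>L lborel g') (at 0)"
    by (simp add: shift)
  then show ?thesis
    using DERIV_const DERIV_unique by blast
qed

subsection \<open>Spherical means and polar coordinates\<close>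

text \<open>The value at \<open>0\<close> is a unit vector so that \<open>x + r dir z\<close> always lies on the sphere.\<close>

definition dir :: "'a::euclidean_space \<Rightarrow> 'a" where
  "dir z = (if z = 0 then SOME i. i \<in> Basis else sgn z)"

lemma norm_dir [simp]: "norm (dir z) = 1"
proof -
  have "(SOME i::'a. i \<in> Basis) \<in> Basis"
    by (rule someI_ex) (use nonempty_Basis in blast)
  then show ?thesis
    by (simp add: dir_def norm_sgn)
qed

lemma borel_measurable_dir [measurable]: "dir \<in> borel_measurable borel"
proof -
  have "dir = (\<lambda>z::'a. if z \<in> {0} then SOME i. i \<in> Basis else sgn z)"
    by (auto simp: dir_def)
  also have "\<dots> \<in> borel_measurable borel"
    by measurable
  finally show ?thesis .
qed

lemma dir_scaleR: "t > 0 \<Longrightarrow> dir (t *\<^sub>R z) = dir z"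
  by (simp add: dir_def sgn_scaleR)

lemma norm_scaleR_dir: "z \<noteq> 0 \<Longrightarrow> norm z *\<^sub>R dir z = z"
  by (simp add: dir_def sgn_div_norm)

text \<open>Its image under \<open>dir\<close> is the uniform law on the unit sphere. Keeping the
  solid ball as sample space fits the definition of surface measure by cones and gives one measure
  for all centres and radii.\<close>

definition unit_ball_measure :: "'a::euclidean_space measure" where
  "unit_ball_measure = uniform_measure lborel (cball 0 1)"

lemma sets_unit_ball_measure [simp, measurable_cong]: "sets unit_ball_measure = sets borel"
  by (simp add: unit_ball_measure_def)

lemma space_unit_ball_measure [simp]: "space unit_ball_measure = UNIV"
  by (simp add: unit_ball_measure_def)

lemma emeasure_unit_cball: 
  "emeasure lborel (cball 0 1 :: 'a::euclidean_space set) = ennreal (unit_ball_vol (real DIM('a)))"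
  by (subst emeasure_cball) auto

lemma emeasure_space_unit_ball_measure [simp]: "emeasure unit_ball_measure (UNIV :: 'a::euclidean_space set) = 1"
proof -
  have "unit_ball_vol (real DIM('a)) > 0"
    by (rule unit_ball_vol_pos) simp
  then have "unit_ball_vol (real DIM('a)) \<noteq> 0" "unit_ball_vol (real DIM('a)) \<ge> 0"
    by linarith+
  then show ?thesis
    by (simp add: unit_ball_measure_def emeasure_unit_cball divide_eq_1_ennreal)
qed

interpretation unit_ball_measure: finite_measure "unit_ball_measure :: 'a::euclidean_space measure"
  by (rule finite_measureI) simp

lemma measure_space_unit_ball_measure [simp]: "measure unit_ball_measure (UNIV :: 'a::euclidean_space set) = 1"
  by (simp add: measure_def)

section \<open>Normalized surface measure as an image of the uniform measure on the ball\<close>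

lemma emeasure_lborel_affine_vimage:
  fixes x :: "'a::euclidean_space"
  assumes r: "r > 0" and [measurable]: "C \<in> sets borel"
  shows "emeasure lborel C = ennreal (r ^ DIM('a)) * emeasure lborel {z. x + r *\<^sub>R z \<in> C}"
proof -
  have [measurable]: "{z. x + r *\<^sub>R z \<in> C} \<in> sets borel"
    by measurable
  have "emeasure lborel C = emeasure (density (distr lborel borel (\<lambda>z. x + r *\<^sub>R z)) (\<lambda>_. \<bar>r\<bar> ^ DIM('a))) C"
    by (subst lborel_affine[of r x]) (use r in auto)
  also have "\<dots> = ennreal (r ^ DIM('a)) * emeasure (distr lborel borel (\<lambda>z. x + r *\<^sub>R z)) C"
    using r by (subst emeasure_density) (auto simp: nn_integral_cmult_indicator)
  also have "emeasure (distr lborel borel (\<lambda>z. x + r *\<^sub>R z)) C = emeasure lborel {z. x + r *\<^sub>R z \<in> C}"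
    by (subst emeasure_distr) (auto simp: vimage_def)
  finally show ?thesis .
qed

text \<open>The cone over \<open>E\<close> is the image, under \<open>z \<mapsto> x + r z\<close>,
  of the part of the unit ball whose directions point into \<open>E\<close>; the dilation
  contributes \<open>r ^ DIM('a)\<close>.\<close>

lemma emeasure_surface_measure_unit_ball:
  fixes x :: "'a::euclidean_space"
  assumes r: "r > 0" and E[measurable]: "E \<in> sets borel" and E': "E \<subseteq> sphere x r"
  shows "emeasure (surface_measure x r) E =
    ennreal (real DIM('a) / r * r ^ DIM('a)) * emeasure lborel (cball 0 1 \<inter> {z. x + r *\<^sub>R dir z \<in> E})"
proof -
  define C where "C = {y. y \<noteq> x \<and> norm (y - x) \<le> r \<and> x + r *\<^sub>R dir (y - x) \<in> E}"
  have C[measurable]: "C \<in> sets borel"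
    unfolding C_def by measurable
  have "{x + t *\<^sub>R (y - x) | t y. 0 < t \<and> t \<le> 1 \<and> y \<in> E} = C"
  proof (intro equalityI subsetI)
    fix z assume "z \<in> {x + t *\<^sub>R (y - x) | t y. 0 < t \<and> t \<le> 1 \<and> y \<in> E}"
    then obtain t y where z: "z = x + t *\<^sub>R (y - x)" and t: "0 < t" "t \<le> 1" and y: "y \<in> E"
      by blast
    have n: "norm (y - x) = r"
      using y E' by (auto simp: dist_norm norm_minus_commute)
    have "r *\<^sub>R dir (z - x) = y - x"
      using t n r norm_scaleR_dir[of "y - x"] by (auto simp: z dir_scaleR)
    then show "z \<in> C"
      using t n r y by (auto simp: C_def z mult_le_cancel_right1)
  next
    fix z assume z: "z \<in> C"
    then have "z = x + (norm (z - x) / r) *\<^sub>R ((x + r *\<^sub>R dir (z - x)) - x)"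
      using r norm_scaleR_dir[of "z - x"] by (simp add: C_def)
    moreover have "0 < norm (z - x) / r" "norm (z - x) / r \<le> 1"
      using z r by (auto simp: C_def)
    moreover have "x + r *\<^sub>R dir (z - x) \<in> E"
      using z by (simp add: C_def)
    ultimately show "z \<in> {x + t *\<^sub>R (y - x) | t y. 0 < t \<and> t \<le> 1 \<and> y \<in> E}"
      by blast
  qed
  then have "emeasure (surface_measure x r) E = ennreal (real DIM('a) / r) * emeasure lborel C"
    using emeasure_surface_measure[OF r E E'] by simp
  also have "emeasure lborel C = ennreal (r ^ DIM('a)) * emeasure lborel {z. x + r *\<^sub>R z \<in> C}"
    by (rule emeasure_lborel_affine_vimage[OF r C])
  \<comment> \<open>The cone lacks its apex and \<open>dir 0\<close> is an arbitrary unit vector, so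
    the two sets may differ at the origin, a null set.\<close>
  also have "{z. x + r *\<^sub>R z \<in> C} = (cball 0 1 \<inter> {z. x + r *\<^sub>R dir z \<in> E}) - {0}"
    using r by (auto simp: C_def dir_scaleR mult_le_cancel_left1)
  also have "emeasure lborel \<dots> = emeasure lborel (cball 0 1 \<inter> {z. x + r *\<^sub>R dir z \<in> E})"
    by (rule emeasure_Diff_null_set) auto
  finally show ?thesis
    using r by (simp only: ennreal_mult' mult.assoc divide_nonneg_pos of_nat_0_le_iff)
qed

text \<open>Normalization cancels the factor \<open>K\<close> of the previous lemma, which depends
  on the radius and not on \<open>E\<close>.\<close>

lemma normalized_surface_measure_eq:
  fixes x :: "'a::euclidean_space"
  assumes r: "r > 0"
  shows "normalized_surface_measure x r =
    completion (distr unit_ball_measure (restrict_space borel (sphere x r)) (\<lambda>z. x + r *\<^sub>R dir z))"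
    (is "_ = completion ?D")
proof -
  have "uniform_measure (surface_measure x r) (sphere x r) = ?D"
  proof (rule measure_eqI)
    fix E assume E0: "E \<in> sets (uniform_measure (surface_measure x r) (sphere x r))"
    then have E[measurable]: "E \<in> sets borel" and E': "E \<subseteq> sphere x r"
      by (auto simp: sets_restrict_space)
    have S: "sphere x r \<in> sets (surface_measure x r)"
      by (metis sets.top space_surface_measure)
    define K where "K = real DIM('a) / r * r ^ DIM('a)"
    have K: "K > 0" using r by (auto simp: K_def)
    have m: "(\<lambda>z. x + r *\<^sub>R dir z) \<in> measurable unit_ball_measure (restrict_space borel (sphere x r))"
      by (rule measurable_restrict_space2) (use r in \<open>auto simp: dist_norm\<close>)
    have sph: "{z::'a. x + r *\<^sub>R dir z \<in> sphere x r} = UNIV"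
      using r by (auto simp: dist_norm)
    have "emeasure (uniform_measure (surface_measure x r) (sphere x r)) E =
        emeasure (surface_measure x r) E / emeasure (surface_measure x r) (sphere x r)"
      using E0 S E' by (simp add: Int_absorb1)
    also have "\<dots> = ennreal K * emeasure lborel (cball 0 1 \<inter> {z. x + r *\<^sub>R dir z \<in> E}) /
        (ennreal K * emeasure lborel (cball 0 1 :: 'a set))"
      using emeasure_surface_measure_unit_ball[OF r, of "sphere x r" x]
      by (simp only: K_def emeasure_surface_measure_unit_ball[OF r E E'] sph order_refl borel_closed closed_sphere Int_UNIV_right)
    also have "\<dots> = emeasure lborel (cball 0 1 \<inter> {z. x + r *\<^sub>R dir z \<in> E}) / emeasure lborel (cball 0 1 :: 'a set)"
      using K by (simp only: mult.commute[of "ennreal K"]) (intro divide_mult_eq, auto)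
    also have "\<dots> = emeasure unit_ball_measure {z. x + r *\<^sub>R dir z \<in> E}"
      unfolding unit_ball_measure_def by (subst emeasure_uniform_measure) auto
    also have "\<dots> = emeasure ?D E"
      using E0 m by (subst emeasure_distr) (auto simp: vimage_def)
    finally show "emeasure (uniform_measure (surface_measure x r) (sphere x r)) E = emeasure ?D E" .
  qed simp
  then show ?thesis
    by (simp add: normalized_surface_measure_def)
qed

text \<open>Polar coordinates from Fubini and dilations alone. Rescaling the radius by
  \<open>norm z\<close> replaces \<open>s *\<^sub>R dir z\<close> by \<open>t *\<^sub>R z\<close>;
  rescaling \<open>z\<close> by \<open>t\<close> then makes the argument of \<open>f\<close> a free
  variable \<open>y\<close>, and the weight left over integrates to 1 in \<open>t\<close>.\<close>

lemma nn_integral_polar: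
  fixes f :: "'a::euclidean_space \<Rightarrow> ennreal"
  assumes f[measurable]: "f \<in> borel_measurable borel"
  shows "(\<integral>\<^sup>+y. f y \<partial>lborel) =
    (\<integral>\<^sup>+s. (\<integral>\<^sup>+z. ennreal (indicator {0<..} s * (real DIM('a) * s ^ (DIM('a) - 1)) * indicator {..1} (norm z)) *
      f (s *\<^sub>R dir z) \<partial>lborel) \<partial>lborel)"
proof -
  let ?d = "DIM('a)"
  obtain n where n: "?d = Suc n"
    using DIM_positive[where 'a='a] gr0_implies_Suc by blast
  have "(\<integral>\<^sup>+s. (\<integral>\<^sup>+z. ennreal (indicator {0<..} s * (real ?d * s ^ (?d - 1)) * indicator {..1} (norm z)) *
      f (s *\<^sub>R dir z) \<partial>lborel) \<partial>lborel) =
    (\<integral>\<^sup>+z. (\<integral>\<^sup>+s. ennreal (indicator {0<..} s * (real ?d * s ^ (?d - 1)) * indicator {..1} (norm z)) *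
      f (s *\<^sub>R dir z) \<partial>lborel) \<partial>lborel)"
    by (rule lborel_pair.Fubini') measurable
  \<comment> \<open>Substitution \<open>s = norm z * t\<close> for fixed \<open>z\<close>; the extra
    \<open>norm z\<close> raises the power from \<open>n = d - 1\<close> to \<open>d\<close>. The
    point \<open>z = 0\<close>, where it degenerates, is a null set.\<close>
  also have "\<dots> = (\<integral>\<^sup>+z. (\<integral>\<^sup>+t. ennreal (indicator {0<..} t * (real ?d * t ^ n * norm z ^ ?d) * indicator {..1} (norm z)) *
      f (t *\<^sub>R z) \<partial>lborel) \<partial>lborel)"
  proof (rule nn_integral_cong_AE)
    have "AE z in lborel. z \<noteq> (0::'a)"
      by (rule AE_lborel_singleton)
    then show "AE z in lborel. (\<integral>\<^sup>+s. ennreal (indicator {0<..} s * (real ?d * s ^ (?d - 1)) * indicator {..1} (norm z)) *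
      f (s *\<^sub>R dir z) \<partial>lborel) = (\<integral>\<^sup>+t. ennreal (indicator {0<..} t * (real ?d * t ^ n * norm z ^ ?d) * indicator {..1} (norm z)) *
      f (t *\<^sub>R z) \<partial>lborel)"
    proof eventually_elim
      fix z :: 'a assume z: "z \<noteq> 0"
      have "(\<integral>\<^sup>+s. ennreal (indicator {0<..} s * (real ?d * s ^ (?d - 1)) * indicator {..1} (norm z)) *
          f (s *\<^sub>R dir z) \<partial>lborel) =
        ennreal \<bar>norm z\<bar> * (\<integral>\<^sup>+t. ennreal (indicator {0<..} (0 + norm z * t) * (real ?d * (0 + norm z * t) ^ (?d - 1)) * indicator {..1} (norm z)) *
          f ((0 + norm z * t) *\<^sub>R dir z) \<partial>lborel)"
        by (rule nn_integral_real_affine) (use z in auto)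
      also have "\<dots> = (\<integral>\<^sup>+t. ennreal \<bar>norm z\<bar> * (ennreal (indicator {0<..} (0 + norm z * t) * (real ?d * (0 + norm z * t) ^ (?d - 1)) * indicator {..1} (norm z)) *
          f ((0 + norm z * t) *\<^sub>R dir z)) \<partial>lborel)"
        by (rule nn_integral_cmult[symmetric]) measurable
      also have "\<dots> = (\<integral>\<^sup>+t. ennreal (indicator {0<..} t * (real ?d * t ^ n * norm z ^ ?d) * indicator {..1} (norm z)) *
          f (t *\<^sub>R z) \<partial>lborel)"
      proof (rule nn_integral_cong)
        fix t :: real
        have 1: "(0 + norm z * t) *\<^sub>R dir z = t *\<^sub>R z"
          using norm_scaleR_dir[OF z] by (metis add_0 mult.commute scaleR_scaleR)
        have 2: "indicator {0<..} (0 + norm z * t) = (indicator {0<..} t :: real)"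
          using z by (auto simp: indicator_def zero_less_mult_iff)
        have "\<bar>norm z\<bar> * (indicator {0<..} (0 + norm z * t) * (real ?d * (0 + norm z * t) ^ (?d - 1)) * indicator {..1} (norm z))
          = indicator {0<..} t * (real ?d * t ^ n * norm z ^ ?d) * indicator {..1} (norm z)"
          unfolding 2 n by (simp add: power_mult_distrib mult_ac)
        then show "ennreal \<bar>norm z\<bar> * (ennreal (indicator {0<..} (0 + norm z * t) * (real ?d * (0 + norm z * t) ^ (?d - 1)) * indicator {..1} (norm z)) *
          f ((0 + norm z * t) *\<^sub>R dir z)) = ennreal (indicator {0<..} t * (real ?d * t ^ n * norm z ^ ?d) * indicator {..1} (norm z)) *
          f (t *\<^sub>R z)"
          unfolding 1 by (simp only: ennreal_mult'[symmetric] abs_ge_zero mult.assoc[symmetric])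
      qed
      finally show "(\<integral>\<^sup>+s. ennreal (indicator {0<..} s * (real ?d * s ^ (?d - 1)) * indicator {..1} (norm z)) *
          f (s *\<^sub>R dir z) \<partial>lborel) = (\<integral>\<^sup>+t. ennreal (indicator {0<..} t * (real ?d * t ^ n * norm z ^ ?d) * indicator {..1} (norm z)) *
          f (t *\<^sub>R z) \<partial>lborel)" .
    qed
  qed
  also have "\<dots> = (\<integral>\<^sup>+t. (\<integral>\<^sup>+z. ennreal (indicator {0<..} t * (real ?d * t ^ n * norm z ^ ?d) * indicator {..1} (norm z)) *
      f (t *\<^sub>R z) \<partial>lborel) \<partial>lborel)"
    by (rule lborel_pair.Fubini') measurable
  \<comment> \<open>Substitution \<open>y = t z\<close> for fixed \<open>t\<close>: the condition
    \<open>norm z \<le> 1\<close> becomes \<open>norm y \<le> t\<close>, and the Jacobian together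
    with \<open>norm z ^ d\<close> leaves \<open>t ^ (d + 1)\<close> in the denominator.\<close>
  also have "\<dots> = (\<integral>\<^sup>+t. (\<integral>\<^sup>+y. ennreal (real ?d * norm y ^ ?d / t ^ Suc ?d * indicator {0<..} t * indicator {0..} (t - norm y)) * f y \<partial>lborel) \<partial>lborel)"
  proof (rule nn_integral_cong)
    fix t :: real
    show "(\<integral>\<^sup>+z. ennreal (indicator {0<..} t * (real ?d * t ^ n * norm z ^ ?d) * indicator {..1} (norm z)) *
      f (t *\<^sub>R z) \<partial>lborel) = (\<integral>\<^sup>+y. ennreal (real ?d * norm y ^ ?d / t ^ Suc ?d * indicator {0<..} t * indicator {0..} (t - norm y)) * f y \<partial>lborel)"
      (is "_ = integral\<^sup>N _ ?g")
    proof (cases "t > 0")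
      case t: True
      have "integral\<^sup>N lborel ?g = integral\<^sup>N (density (distr lborel borel (\<lambda>z. 0 + t *\<^sub>R z)) (\<lambda>_. \<bar>t\<bar> ^ ?d)) ?g"
        by (subst lborel_affine[of t 0]) (use t in auto)
      also have "\<dots> = (\<integral>\<^sup>+z. ennreal (t ^ ?d) * ?g (t *\<^sub>R z) \<partial>lborel)"
        using t by (subst nn_integral_density, measurable, subst nn_integral_distr) simp_all
      also have "\<dots> = (\<integral>\<^sup>+z. ennreal (indicator {0<..} t * (real ?d * t ^ n * norm z ^ ?d) * indicator {..1} (norm z)) *
          f (t *\<^sub>R z) \<partial>lborel)"
      proof (rule nn_integral_cong)
        fix z :: 'a
        have "t ^ ?d * (real ?d * norm (t *\<^sub>R z) ^ ?d / t ^ Suc ?d * indicator {0<..} t * indicator {0..} (t - norm (t *\<^sub>R z)))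
          = indicator {0<..} t * (real ?d * t ^ n * norm z ^ ?d) * indicator {..1} (norm z)"
          using t by (simp add: n power_mult_distrib indicator_def field_simps mult_le_cancel_left1)
        then show "ennreal (t ^ ?d) * ?g (t *\<^sub>R z) = ennreal (indicator {0<..} t * (real ?d * t ^ n * norm z ^ ?d) * indicator {..1} (norm z)) *
          f (t *\<^sub>R z)"
          using t by (simp only: ennreal_mult'[symmetric] zero_le_power less_imp_le mult.assoc[symmetric])
      qed
      finally show ?thesis by simp
    qed simp
  qed
  also have "\<dots> = (\<integral>\<^sup>+y. (\<integral>\<^sup>+t. ennreal (real ?d * norm y ^ ?d / t ^ Suc ?d * indicator {0<..} t * indicator {0..} (t - norm y)) * f y \<partial>lborel) \<partial>lborel)"
    by (rule lborel_pair.Fubini') measurable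
  also have "\<dots> = (\<integral>\<^sup>+y. f y \<partial>lborel)"
  proof (rule nn_integral_cong_AE)
    have "AE z in lborel. z \<noteq> (0::'a)"
      by (rule AE_lborel_singleton)
    then show "AE y in lborel. (\<integral>\<^sup>+t. ennreal (real ?d * norm y ^ ?d / t ^ Suc ?d * indicator {0<..} t * indicator {0..} (t - norm y)) * f y \<partial>lborel) = f y"
    proof eventually_elim
      fix y :: 'a assume y: "y \<noteq> 0"
      have "(\<integral>\<^sup>+t. ennreal (real ?d * norm y ^ ?d / t ^ Suc ?d * indicator {0<..} t * indicator {0..} (t - norm y)) * f y \<partial>lborel)
        = (\<integral>\<^sup>+t. ennreal (real ?d * norm y ^ ?d / t ^ Suc ?d * indicator {0<..} t * indicator {0..} (t - norm y)) \<partial>lborel) * f y"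
        by (rule nn_integral_multc) measurable
      also have "(\<integral>\<^sup>+t. ennreal (real ?d * norm y ^ ?d / t ^ Suc ?d * indicator {0<..} t * indicator {0..} (t - norm y)) \<partial>lborel)
        = (\<integral>\<^sup>+t. ennreal (real ?d * norm y ^ ?d / t ^ Suc ?d) * indicator {norm y..} t \<partial>lborel)"
        using y by (intro nn_integral_cong) (auto simp: indicator_def not_less dest: order_trans)
      \<comment> \<open>The primitive \<open>- (norm y / t) ^ d\<close> runs from -1 at
        \<open>t = norm y\<close> to 0 at infinity.\<close>
      also have "\<dots> = ennreal (0 - (- (norm y ^ ?d / norm y ^ ?d)))"
      proof (rule nn_integral_FTC_atLeast[where F = "\<lambda>t. - (norm y ^ ?d / t ^ ?d)"])
        fix t assume t: "norm y \<le> t"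
        then have "t > 0" using y by (meson le_less_trans not_le zero_less_norm_iff)
        then have "((\<lambda>t. - (norm y ^ ?d / t ^ ?d)) has_real_derivative
            norm y ^ ?d * (real ?d * t ^ n) / (t ^ ?d * t ^ ?d)) (at t)"
          using DERIV_minus[OF DERIV_divide[OF DERIV_const[of "norm y ^ ?d"] DERIV_pow[of ?d t UNIV]]] n \<open>t > 0\<close>
          by (simp add: mult_ac)
        moreover have "norm y ^ ?d * (real ?d * t ^ n) / (t ^ ?d * t ^ ?d) = real ?d * norm y ^ ?d / t ^ Suc ?d"
          using \<open>t > 0\<close> by (simp add: n field_simps)
        ultimately show "((\<lambda>t. - (norm y ^ ?d / t ^ ?d)) has_real_derivative real ?d * norm y ^ ?d / t ^ Suc ?d) (at t)"
          by (simp only:)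
        show "0 \<le> real ?d * norm y ^ ?d / t ^ Suc ?d"
          using \<open>t > 0\<close> by auto
      next
        have "((\<lambda>t. - (norm y ^ ?d / t ^ ?d)) \<longlongrightarrow> - 0) at_top"
          by (intro tendsto_minus tendsto_divide_0[OF tendsto_const] filterlim_at_top_imp_at_infinity filterlim_pow_at_top filterlim_ident)
             simp
        then show "((\<lambda>t. - (norm y ^ ?d / t ^ ?d)) \<longlongrightarrow> 0) at_top"
          by simp
      qed measurable
      finally show "(\<integral>\<^sup>+t. ennreal (real ?d * norm y ^ ?d / t ^ Suc ?d * indicator {0<..} t * indicator {0..} (t - norm y)) * f y \<partial>lborel) = f y"
        using y by simp
    qed
  qed
  finally show ?thesis ..
qed

text \<open>The radial factor of Lebesgue measure; \<open>c\<close> is the area of the unit sphere and \<open>n = d - 1\<close>.\<close>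

definition radial_measure :: "real \<Rightarrow> nat \<Rightarrow> real measure" where
  "radial_measure c n = density lborel (\<lambda>s. ennreal (indicator {0<..} s * (c * s ^ n)))"

lemma sets_radial_measure [simp, measurable_cong]: "sets (radial_measure c n) = sets borel"
  by (simp add: radial_measure_def)

lemma space_radial_measure [simp]: "space (radial_measure c n) = UNIV"
  by (simp add: radial_measure_def)

lemma sigma_finite_radial_measure: "sigma_finite_measure (radial_measure c n)"
  unfolding radial_measure_def
  by (subst sigma_finite_measure.sigma_finite_iff_density_finite[OF sigma_finite_lborel]) auto

text \<open>The area of the unit sphere, equal to 2 for \<open>d = 1\<close>. The argument is a type
  token because the value depends on the dimension only.\<close>

definition radial_const :: "'a::euclidean_space itself \<Rightarrow> real" where
  "radial_const _ = real DIM('a) * unit_ball_vol (real DIM('a))"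

lemma radial_const_pos: "radial_const TYPE('a::euclidean_space) > 0"
  by (simp add: radial_const_def unit_ball_vol_pos)

text \<open>\<open>nn_integral_polar\<close> for indicators. As an equality of measures it transfers
  both real-valued integrals and almost-everywhere statements.\<close>

lemma lborel_polar:
  "(lborel :: 'a::euclidean_space measure) =
    distr (radial_measure (radial_const TYPE('a)) (DIM('a) - 1) \<Otimes>\<^sub>M unit_ball_measure) borel (\<lambda>(s, z). s *\<^sub>R dir z)"
    (is "_ = distr (?T \<Otimes>\<^sub>M ?S) borel ?p")
proof (rule measure_eqI)
  interpret T: sigma_finite_measure ?T by (rule sigma_finite_radial_measure)
  fix A :: "'a set" assume "A \<in> sets lborel"
  then have A[measurable]: "A \<in> sets borel" by simp
  let ?v = "unit_ball_vol (real DIM('a))"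
  have v: "?v > 0" by (simp add: unit_ball_vol_pos)
  have [measurable]: "cball 0 1 \<in> sets (borel :: 'a measure)"
    by simp
  have [measurable]: "?p \<in> borel_measurable (?T \<Otimes>\<^sub>M ?S)"
    by measurable
  have "emeasure (distr (?T \<Otimes>\<^sub>M ?S) borel ?p) A = (\<integral>\<^sup>+y. indicator A y \<partial>distr (?T \<Otimes>\<^sub>M ?S) borel ?p)"
    by simp
  also have "\<dots> = (\<integral>\<^sup>+q. indicator A (?p q) \<partial>(?T \<Otimes>\<^sub>M ?S))"
    by (rule nn_integral_distr) measurable
  also have "\<dots> = (\<integral>\<^sup>+s. (\<integral>\<^sup>+z. indicator A (s *\<^sub>R dir z) \<partial>?S) \<partial>?T)"
    by (subst unit_ball_measure.nn_integral_fst[symmetric]) auto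
  also have "\<dots> = (\<integral>\<^sup>+s. ennreal (indicator {0<..} s * (radial_const TYPE('a) * s ^ (DIM('a) - 1))) *
      (\<integral>\<^sup>+z. indicator A (s *\<^sub>R dir z) \<partial>?S) \<partial>lborel)"
    unfolding radial_measure_def
    by (rule nn_integral_density) measurable
  also have "\<dots> = (\<integral>\<^sup>+s. (\<integral>\<^sup>+z. ennreal (indicator {0<..} s * (real DIM('a) * s ^ (DIM('a) - 1)) * indicator {..1} (norm z)) *
      indicator A (s *\<^sub>R dir z) \<partial>lborel) \<partial>lborel)"
  proof (rule nn_integral_cong)
    fix s :: real
    let ?k = "indicator {0<..} s * (real DIM('a) * s ^ (DIM('a) - 1)) :: real"
    have k: "?k \<ge> 0" by (auto simp: indicator_def)
    have "(\<integral>\<^sup>+z. indicator A (s *\<^sub>R dir z) \<partial>?S) =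
       (\<integral>\<^sup>+z. indicator A (s *\<^sub>R dir z) * indicator (cball 0 1) z \<partial>lborel) / ennreal ?v"
      unfolding unit_ball_measure_def emeasure_unit_cball[symmetric]
      by (rule nn_integral_uniform_measure) auto
    then have "ennreal (indicator {0<..} s * (radial_const TYPE('a) * s ^ (DIM('a) - 1))) * (\<integral>\<^sup>+z. indicator A (s *\<^sub>R dir z) \<partial>?S)
      = ennreal (?k * ?v) * ((\<integral>\<^sup>+z. indicator A (s *\<^sub>R dir z) * indicator (cball 0 1) z \<partial>lborel) / ennreal ?v)"
      by (simp add: radial_const_def mult_ac)
    also have "\<dots> = ennreal ?k * (\<integral>\<^sup>+z. indicator A (s *\<^sub>R dir z) * indicator (cball 0 1) z \<partial>lborel)"
    proof -
      have "ennreal (x * ?v) * (J / ennreal ?v) = ennreal x * J" if "x \<ge> 0" for x J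
      proof -
        have "ennreal (x * ?v) = ennreal x * ennreal ?v"
          using v that by (intro ennreal_mult) auto
        then have "ennreal (x * ?v) * (J / ennreal ?v) = (ennreal x * J) * ennreal ?v / ennreal ?v"
          by (simp add: ennreal_times_divide mult_ac)
        also have "\<dots> = ennreal x * J"
          by (rule mult_divide_eq_ennreal) (use unit_ball_vol_pos[of "real DIM('a)"] in \<open>auto simp: ennreal_eq_0_iff simp del: unit_ball_vol_pos\<close>)
        finally show ?thesis .
      qed
      from this[OF k] show ?thesis .
    qed
    also have "\<dots> = (\<integral>\<^sup>+z. ennreal ?k * (indicator A (s *\<^sub>R dir z) * indicator (cball 0 1) z) \<partial>lborel)"
      by (rule nn_integral_cmult[symmetric]) measurable
    also have "\<dots> = (\<integral>\<^sup>+z. ennreal (?k * indicator {..1} (norm z)) * indicator A (s *\<^sub>R dir z) \<partial>lborel)"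
      by (intro nn_integral_cong) (auto simp: indicator_def)
    finally show "ennreal (indicator {0<..} s * (radial_const TYPE('a) * s ^ (DIM('a) - 1))) * (\<integral>\<^sup>+z. indicator A (s *\<^sub>R dir z) \<partial>?S)
      = (\<integral>\<^sup>+z. ennreal (?k * indicator {..1} (norm z)) * indicator A (s *\<^sub>R dir z) \<partial>lborel)" .
  qed
  also have "\<dots> = (\<integral>\<^sup>+y. indicator A y \<partial>lborel)"
    by (rule nn_integral_polar[symmetric]) measurable
  finally show "emeasure lborel A = emeasure (distr (?T \<Otimes>\<^sub>M ?S) borel ?p) A"
    by simp
qed simp

lemma integral_polar:
  fixes f :: "'a::euclidean_space \<Rightarrow> real"
  assumes f: "integrable lborel f"
  shows "integrable lborel (\<lambda>s. indicator {0<..} s * s ^ (DIM('a) - 1) * (LINT z|unit_ball_measure. f (s *\<^sub>R dir (z :: 'a))))"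
      (is ?I)
    and "integral\<^sup>L lborel f = radial_const TYPE('a) *
      (LINT s|lborel. indicator {0<..} s * s ^ (DIM('a) - 1) * (LINT z|unit_ball_measure. f (s *\<^sub>R dir (z :: 'a))))"
      (is ?E)
proof -
  let ?c = "radial_const TYPE('a)"
  let ?T = "radial_measure ?c (DIM('a) - 1)"
  let ?S = "unit_ball_measure :: 'a measure"
  let ?p = "\<lambda>(s, z). s *\<^sub>R dir (z :: 'a)"
  interpret T: sigma_finite_measure ?T by (rule sigma_finite_radial_measure)
  interpret TS: pair_sigma_finite ?T ?S ..
  have [measurable]: "f \<in> borel_measurable borel" using f by auto
  have [measurable]: "?p \<in> borel_measurable (?T \<Otimes>\<^sub>M ?S)"
    by measurable
  have i: "integrable (?T \<Otimes>\<^sub>M ?S) (\<lambda>q. f (?p q))"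
    using f by (subst (asm) lborel_polar) (simp add: integrable_distr_eq)
  have c: "?c > 0" by (rule radial_const_pos)
  have g[measurable]: "(\<lambda>s. LINT z|?S. f (s *\<^sub>R dir z)) \<in> borel_measurable borel"
    by measurable
  have "integrable ?T (\<lambda>s. LINT z|?S. f (s *\<^sub>R dir z))"
    using TS.integrable_fst'[OF i] by simp
  then have "integrable lborel (\<lambda>s. (indicator {0<..} s * (?c * s ^ (DIM('a) - 1))) *\<^sub>R (LINT z|?S. f (s *\<^sub>R dir z)))"
    unfolding radial_measure_def using c
    by (subst (asm) integrable_density) (auto simp: indicator_def)
  then have "integrable lborel (\<lambda>s. ?c * (indicator {0<..} s * s ^ (DIM('a) - 1) * (LINT z|?S. f (s *\<^sub>R dir z))))"
    by (simp add: mult_ac)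
  then show ?I
    using c by simp
  have "integral\<^sup>L lborel f = (LINT q|(?T \<Otimes>\<^sub>M ?S). f (?p q))"
    by (subst lborel_polar) (rule integral_distr; measurable)
  also have "\<dots> = (LINT s|?T. LINT z|?S. f (s *\<^sub>R dir z))"
    using TS.integral_fst'[OF i] by simp
  also have "\<dots> = (LINT s|lborel. (indicator {0<..} s * (?c * s ^ (DIM('a) - 1))) *\<^sub>R (LINT z|?S. f (s *\<^sub>R dir z)))"
    unfolding radial_measure_def using c
    by (intro integral_density) (auto simp: indicator_def)
  also have "\<dots> = (LINT s|lborel. ?c * (indicator {0<..} s * s ^ (DIM('a) - 1) * (LINT z|?S. f (s *\<^sub>R dir z))))"
    by (simp add: mult_ac)
  finally show ?E by simp
qed

text \<open>A null set meets almost every sphere around the origin in a null set of directions. This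
  lets a Borel representative be used on spheres. \<open>P\<close> need not define a measurable set,
  hence the passage to a null set \<open>N\<close>.\<close>

lemma AE_polar:
  fixes P :: "'a::euclidean_space \<Rightarrow> bool"
  assumes P: "AE y in lborel. P y"
  shows "AE s in lborel. s > 0 \<longrightarrow> (AE z in unit_ball_measure. P (s *\<^sub>R dir (z :: 'a)))"
proof -
  let ?c = "radial_const TYPE('a)"
  let ?T = "radial_measure ?c (DIM('a) - 1)"
  let ?S = "unit_ball_measure :: 'a measure"
  interpret T: sigma_finite_measure ?T by (rule sigma_finite_radial_measure)
  interpret TS: pair_sigma_finite ?T ?S ..
  obtain N :: "'a set" where N: "N \<in> null_sets lborel" "{y. \<not> P y} \<subseteq> N"
    using P by (auto simp: eventually_ae_filter)
  have [measurable]: "N \<in> sets borel" using N by auto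
  have "AE y in (lborel :: 'a measure). y \<notin> N"
    by (rule AE_not_in[OF N(1)])
  then have "AE q in ?T \<Otimes>\<^sub>M ?S. (case q of (s, z) \<Rightarrow> s *\<^sub>R dir z) \<notin> N"
    by (subst (asm) lborel_polar, subst (asm) AE_distr_iff) (auto simp: split_beta')
  then have "AE s in ?T. AE z in ?S. (case (s, z) of (s, z) \<Rightarrow> s *\<^sub>R dir z) \<notin> N"
    by (rule TS.AE_pair)
  then have "AE s in lborel. 0 < ennreal (indicator {0<..} s * (?c * s ^ (DIM('a) - 1))) \<longrightarrow> (AE z in ?S. s *\<^sub>R dir z \<notin> N)"
    unfolding radial_measure_def by (subst (asm) AE_density) auto
  then show ?thesis
  proof (rule AE_mp[OF _ AE_I2], intro impI)
    fix s :: real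
    assume "0 < ennreal (indicator {0<..} s * (?c * s ^ (DIM('a) - 1))) \<longrightarrow> (AE z in ?S. s *\<^sub>R dir z \<notin> N)" "0 < s"
    then have "AE z in ?S. s *\<^sub>R dir z \<notin> N"
      using radial_const_pos[where 'a='a] by simp
    then show "AE z in ?S. P (s *\<^sub>R dir z)"
      by eventually_elim (use N in auto)
  qed
qed

subsection \<open>The radial solution and \<open>\<kappa>\<close>\<close>

text \<open>The confluent hypergeometric limit function \<open>\<^sub>0F\<^sub>1(;v;t)\<close>.\<close>

definition hyp01 :: "real \<Rightarrow> real \<Rightarrow> real" where
  "hyp01 v t = (\<Sum>k. inverse (fact k * pochhammer v k) * t ^ k)"

lemma pochhammer_pos_real: "v > 0 \<Longrightarrow> pochhammer (v :: real) k > 0"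
  by (simp add: pochhammer_pos)

lemma summable_hyp01:
  assumes v: "v > 0"
  shows "summable (\<lambda>k. inverse (fact k * pochhammer v k) * (t :: real) ^ k)"
\<comment> \<open>The ratio of consecutive terms is
  \<open>\<bar>t\<bar> / ((k + 1) * (v + k))\<close>. From \<open>k \<ge> 2 * \<bar>t\<bar>\<close>
  and \<open>v + k \<ge> 1\<close> it is at most 1/2; the \<open>+ 1\<close> in the threshold
  secures the second bound.\<close>
proof (rule summable_ratio_test[where c = "1/2" and N = "nat \<lceil>2 * \<bar>t\<bar>\<rceil> + 1"])
  fix k assume k: "nat \<lceil>2 * \<bar>t\<bar>\<rceil> + 1 \<le> k"
  have k1: "real k \<ge> 1" "real k \<ge> 2 * \<bar>t\<bar>"
    using k by linarith+
  have "2 * \<bar>t\<bar> * 1 \<le> (real k + 1) * (v + real k)"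
    using k1 v by (intro mult_mono) auto
  then have le: "\<bar>t\<bar> / ((real k + 1) * (v + real k)) \<le> 1 / 2"
    using v k1 by (simp add: divide_simps)
  have "norm (inverse (fact (Suc k) * pochhammer v (Suc k)) * t ^ Suc k) =
    \<bar>t\<bar> / ((real k + 1) * (v + real k)) * norm (inverse (fact k * pochhammer v k) * t ^ k)"
    using v pochhammer_pos_real[OF v, of k]
    by (simp add: pochhammer_Suc abs_mult power_abs field_simps)
  also have "\<dots> \<le> 1 / 2 * norm (inverse (fact k * pochhammer v k) * t ^ k)"
    using le by (intro mult_right_mono) auto
  finally show "norm (inverse (fact (Suc k) * pochhammer v (Suc k)) * t ^ Suc k)
    \<le> 1 / 2 * norm (inverse (fact k * pochhammer v k) * t ^ k)" .
qed simp

lemma hyp01_deriv: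
  assumes v: "v > 0"
  shows "(hyp01 v has_real_derivative hyp01 (v + 1) t / v) (at t)"
proof -
  let ?c = "\<lambda>k. inverse (fact k * pochhammer v k)"
  have "((\<lambda>t. \<Sum>k. ?c k * t ^ k) has_real_derivative (\<Sum>k. diffs ?c k * t ^ k)) (at t)"
    by (rule termdiffs_strong_converges_everywhere) (rule summable_hyp01[OF v])
  moreover have "diffs ?c k * t ^ k = inverse (fact k * pochhammer (v + 1) k) * t ^ k / v" for k
    using v pochhammer_pos_real[of "v + 1" k]
    by (simp add: diffs_def pochhammer_rec field_simps del: of_nat_Suc)
  moreover have "(\<Sum>k. inverse (fact k * pochhammer (v + 1) k) * t ^ k / v) = hyp01 (v + 1) t / v"
    unfolding hyp01_def using v by (intro suminf_divide summable_hyp01) auto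
  moreover have "(\<lambda>t. \<Sum>k. ?c k * t ^ k) = hyp01 v"
    by (simp add: hyp01_def fun_eq_iff)
  ultimately show ?thesis
    by simp
qed

text \<open>By \<open>hyp01_deriv\<close> this is the differential equation
  \<open>t F'' + v F' = F\<close> of \<open>F = hyp01 v\<close>. The constant terms on both sides
  are 1; for the higher ones, the coefficient of \<open>t ^ Suc k\<close> is compared with the
  \<open>k\<close>-th coefficient of \<open>hyp01 (v + 2)\<close>, the factor \<open>t\<close>
  causing the shift.\<close>

lemma hyp01_contiguous:
  assumes v: "v > 0"
  shows "t * hyp01 (v + 2) t / (v * (v + 1)) + hyp01 (v + 1) t = hyp01 v t"
proof -
  have split: "hyp01 w t = 1 + (\<Sum>k. inverse (fact (Suc k) * pochhammer w (Suc k)) * t ^ Suc k)" if "w > 0" for w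
    unfolding hyp01_def using suminf_split_head[OF summable_hyp01[OF that, of t]] by simp
  have S: "summable (\<lambda>k. inverse (fact (Suc k) * pochhammer w (Suc k)) * t ^ Suc k)" if "w > 0" for w
    using summable_hyp01[OF that, of t] by (subst summable_Suc_iff)
  have "inverse (fact (Suc k) * pochhammer v (Suc k)) * t ^ Suc k =
    inverse (fact (Suc k) * pochhammer (v + 1) (Suc k)) * t ^ Suc k +
    t / (v * (v + 1)) * (inverse (fact k * pochhammer (v + 2) k) * t ^ k)" for k
  proof -
    define A where "A = pochhammer (v + 1) k"
    define B where "B = (fact k :: real)"
    have AB: "A > 0" "B > 0"
      using v by (auto simp: A_def B_def pochhammer_pos_real)
    have 1: "pochhammer v (Suc k) = v * A"
      by (simp add: A_def pochhammer_rec)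
    have 2: "pochhammer (v + 1) (Suc k) = A * (v + 1 + real k)"
      by (simp add: A_def pochhammer_Suc)
    have 3: "pochhammer (v + 2) k = A * (v + 1 + real k) / (v + 1)"
      using 2 v by (simp add: pochhammer_rec field_simps)
    have 4: "fact (Suc k) = (1 + real k) * B"
      by (simp add: B_def)
    show ?thesis
      unfolding 1 2 3 4 B_def[symmetric] using v AB by (simp add: divide_simps) (simp add: algebra_simps)
  qed
  then have "(\<Sum>k. inverse (fact (Suc k) * pochhammer v (Suc k)) * t ^ Suc k) =
    (\<Sum>k. inverse (fact (Suc k) * pochhammer (v + 1) (Suc k)) * t ^ Suc k) +
    (\<Sum>k. t / (v * (v + 1)) * (inverse (fact k * pochhammer (v + 2) k) * t ^ k))"
    using v S[of "v + 1"] summable_hyp01[of "v + 2" t]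
    by (subst suminf_add) (auto intro: summable_mult)
  also have "(\<Sum>k. t / (v * (v + 1)) * (inverse (fact k * pochhammer (v + 2) k) * t ^ k)) = t / (v * (v + 1)) * hyp01 (v + 2) t"
    unfolding hyp01_def using v by (intro suminf_mult summable_hyp01) auto
  finally show ?thesis
    using split[of v] split[of "v + 1"] v by simp
qed

lemma hyp01_0 [simp]: "hyp01 v 0 = 1"
  using powser_zero[of "\<lambda>k. inverse (fact k * pochhammer v k)"] by (simp add: hyp01_def)

lemma hyp01_pos:
  assumes "v > 0" "t \<ge> 0"
  shows "hyp01 v t > 0"
  unfolding hyp01_def
proof (rule suminf_pos2[OF summable_hyp01, where i = 0])
  show "0 \<le> inverse (fact n * pochhammer v n) * t ^ n" for n
    using assms pochhammer_pos_real[of v n] by simp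
qed (use assms in auto)

text \<open>Pulling \<open>(z / 2) powr (d / 2 - 1) / Gamma (d / 2)\<close> out of the Bessel series
  leaves the series of \<open>hyp01\<close>, and exactly this prefactor cancels in
  \<open>kappa\<close>. The separate value of \<open>kappa\<close> at 0 agrees with
  \<open>hyp01 v 0 = 1\<close>.\<close>

lemma kappa_eq_hyp01:
  assumes d: "d \<ge> 1" and z: "z \<ge> 0"
  shows "kappa d z = 1 / hyp01 (real d / 2) (z\<^sup>2 / 4)"
proof (cases "z = 0")
  case True
  then show ?thesis by (simp add: kappa_def)
next
  case False
  let ?v = "real d / 2"
  have z: "z > 0" using z False by simp
  have v: "?v > 0" using d by simp
  have G: "Gamma ?v > 0" by (rule Gamma_real_pos[OF v])
  have "(z / 2) powr (2 * real k + (?v - 1)) / (fact k * Gamma (real k + (?v - 1) + 1)) =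
    (z / 2) powr (?v - 1) / Gamma ?v * (inverse (fact k * pochhammer ?v k) * (z\<^sup>2 / 4) ^ k)" for k
  proof -
    have "(z / 2) powr (2 * real k) = (z / 2) powr real (2 * k)"
      by simp
    also have "\<dots> = (z / 2) ^ (2 * k)"
      using z by (subst powr_realpow) auto
    also have "\<dots> = (z\<^sup>2 / 4) ^ k"
      by (simp add: power_mult power_divide)
    finally have 1: "(z / 2) powr (2 * real k + (?v - 1)) = (z / 2) powr (?v - 1) * (z\<^sup>2 / 4) ^ k"
      using z by (simp only: powr_add mult.commute)
    have "Gamma (?v + of_nat k) = pochhammer ?v k * Gamma ?v"
      using v less_imp_neq[OF G, symmetric]
      by (subst pochhammer_Gamma) (auto elim!: nonpos_Ints_cases simp del: Gamma_eq_zero_iff)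
    then have 2: "Gamma (real k + (?v - 1) + 1) = pochhammer ?v k * Gamma ?v"
      by (simp add: add.commute)
    show ?thesis
      unfolding 1 2 by (simp add: divide_simps)
  qed
  then have "bessel_I (?v - 1) z = (z / 2) powr (?v - 1) / Gamma ?v * hyp01 ?v (z\<^sup>2 / 4)"
    unfolding bessel_I_def hyp01_def by (simp only: suminf_mult[OF summable_hyp01[OF v]])
  then show ?thesis
    using G z by (simp add: kappa_def)
qed

subsection \<open>Functions of class \<open>C\<^sup>2\<close>\<close>

lemma partial_deriv_eqI:
  "((\<lambda>t. f (x + t *\<^sub>R i)) has_real_derivative D) (at 0) \<Longrightarrow> partial_deriv i f x = D"
  by (simp add: partial_deriv_def DERIV_imp_deriv)

lemma has_partial_derivD:
  "(\<lambda>t. f (x + t *\<^sub>R i)) differentiable (at 0) \<Longrightarrow>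
    ((\<lambda>t. f (x + t *\<^sub>R i)) has_real_derivative partial_deriv i f x) (at 0)"
  by (simp add: partial_deriv_def DERIV_deriv_iff_real_differentiable)

lemma Ck_on_2D:
  assumes "Ck_on 2 S f"
  shows "continuous_on S f"
    and "i \<in> Basis \<Longrightarrow> continuous_on S (partial_deriv i f)"
    and "i \<in> Basis \<Longrightarrow> j \<in> Basis \<Longrightarrow> continuous_on S (partial_deriv j (partial_deriv i f))"
    and "i \<in> Basis \<Longrightarrow> x \<in> S \<Longrightarrow> ((\<lambda>t. f (x + t *\<^sub>R i)) has_real_derivative partial_deriv i f x) (at 0)"
    and "i \<in> Basis \<Longrightarrow> j \<in> Basis \<Longrightarrow> x \<in> S \<Longrightarrow>
      ((\<lambda>t. partial_deriv i f (x + t *\<^sub>R j)) has_real_derivative partial_deriv j (partial_deriv i f) x) (at 0)"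
  using assms by (auto simp: numeral_2_eq_2 intro!: has_partial_derivD)

lemma has_real_derivative_line_cong:
  assumes S: "open S" "x \<in> S" and eq: "\<And>y. y \<in> S \<Longrightarrow> f y = g y"
    and g: "((\<lambda>t. g (x + t *\<^sub>R i)) has_real_derivative D) (at 0)"
  shows "((\<lambda>t. f (x + t *\<^sub>R (i :: 'a::real_normed_vector))) has_real_derivative D) (at 0)"
proof (rule has_field_derivative_transform_within_open[OF g, where S = "(\<lambda>t. x + t *\<^sub>R i) -` S"])
  show "open ((\<lambda>t. x + t *\<^sub>R i) -` S)"
    using S by (intro open_vimage continuous_intros)
qed (use S eq in auto)

text \<open>Candidates \<open>f1\<close>, \<open>f2\<close> agree with the iterated
  \<open>partial_deriv\<close> only on \<open>S\<close>. Openness of \<open>S\<close> makes short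
  coordinate segments stay inside, so the second derivative does not see the difference.\<close>

lemma Ck_on_2I:
  fixes f :: "'a::euclidean_space \<Rightarrow> real"
  assumes S: "open S" and f: "continuous_on S f"
    and f1: "\<And>i. i \<in> Basis \<Longrightarrow> continuous_on S (f1 i)"
    and f2: "\<And>i j. i \<in> Basis \<Longrightarrow> j \<in> Basis \<Longrightarrow> continuous_on S (f2 i j)"
    and d1: "\<And>i x. i \<in> Basis \<Longrightarrow> x \<in> S \<Longrightarrow> ((\<lambda>t. f (x + t *\<^sub>R i)) has_real_derivative f1 i x) (at 0)"
    and d2: "\<And>i j x. i \<in> Basis \<Longrightarrow> j \<in> Basis \<Longrightarrow> x \<in> S \<Longrightarrow>
      ((\<lambda>t. f1 i (x + t *\<^sub>R j)) has_real_derivative f2 i j x) (at 0)"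
  shows "Ck_on 2 S f"
    and "\<And>i x. i \<in> Basis \<Longrightarrow> x \<in> S \<Longrightarrow> partial_deriv i f x = f1 i x"
    and "\<And>i j x. i \<in> Basis \<Longrightarrow> j \<in> Basis \<Longrightarrow> x \<in> S \<Longrightarrow> partial_deriv j (partial_deriv i f) x = f2 i j x"
proof -
  show e1: "partial_deriv i f x = f1 i x" if "i \<in> Basis" "x \<in> S" for i x
    using partial_deriv_eqI[of f x i, OF d1] that by simp
  have d2': "((\<lambda>t. partial_deriv i f (x + t *\<^sub>R j)) has_real_derivative f2 i j x) (at 0)"
    if "i \<in> Basis" "j \<in> Basis" "x \<in> S" for i j x
    by (rule has_real_derivative_line_cong[OF S that(3) _ d2]) (use that e1 in auto)
  show e2: "partial_deriv j (partial_deriv i f) x = f2 i j x" if "i \<in> Basis" "j \<in> Basis" "x \<in> S" for i j x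
    using partial_deriv_eqI[of "partial_deriv i f" x j, OF d2'] that by simp
  have c1: "continuous_on S (partial_deriv i f)" if "i \<in> Basis" for i
    using continuous_on_eq[OF f1[OF that]] e1 that by metis
  have c2: "continuous_on S (partial_deriv j (partial_deriv i f))" if "i \<in> Basis" "j \<in> Basis" for i j
    using continuous_on_eq[OF f2[OF that]] e2 that by metis
  show "Ck_on 2 S f"
    unfolding numeral_2_eq_2 Ck_on.simps using f c1 c2 d1 d2'
    by (meson real_differentiable_def)
qed

lemma Ck_on_2_locally:
  fixes f :: "'a::euclidean_space \<Rightarrow> real"
  assumes "\<And>x. x \<in> S \<Longrightarrow> \<exists>T. open T \<and> x \<in> T \<and> T \<subseteq> S \<and> Ck_on 2 T f"
  shows "Ck_on 2 S f"
proof -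
  \<comment> \<open>The induction has to quantify over \<open>f\<close>, because its step passes
    from \<open>f\<close> to \<open>partial_deriv i f\<close>.\<close>
  have "Ck_on k S f" if "\<And>x. x \<in> S \<Longrightarrow> \<exists>T. open T \<and> x \<in> T \<and> T \<subseteq> S \<and> Ck_on k T f" for k and f :: "'a \<Rightarrow> real"
    using that
  proof (induction k arbitrary: f)
    case 0
    have "isCont f x" if x: "x \<in> S" for x
      using 0[OF x] continuous_on_eq_continuous_at by auto
    then show ?case
      by (simp add: continuous_at_imp_continuous_on)
  next
    case (Suc k)
    have "isCont f x" if x: "x \<in> S" for x
      using Suc.prems[OF x] continuous_on_eq_continuous_at by auto
    then have "continuous_on S f"
      by (simp add: continuous_at_imp_continuous_on)
    moreover have "Ck_on k S (partial_deriv i f)" if "i \<in> Basis" for i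
      by (rule Suc.IH) (use Suc.prems that in force)
    moreover have "(\<lambda>t. f (x + t *\<^sub>R i)) differentiable (at 0)" if "i \<in> Basis" "x \<in> S" for i x
      using Suc.prems[OF that(2)] that(1) by auto
    ultimately show ?case by simp
  qed
  then show ?thesis using assms by blast
qed

text \<open>Differentiating the product in direction \<open>i\<close> acts on \<open>u\<close> as
  the derivative plus \<open>c \<bullet> i\<close>; applying this twice and summing over
  \<open>i\<close> produces the cross term that will become the drift.\<close>

lemma Ck_on_2_mult_exp:
  fixes u :: "'a::euclidean_space \<Rightarrow> real"
  assumes D: "open D" and u: "Ck_on 2 D u"
  shows "Ck_on 2 D (\<lambda>y. u y * exp (c \<bullet> y))"
    and "x \<in> D \<Longrightarrow> laplacian (\<lambda>y. u y * exp (c \<bullet> y)) x =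
      (laplacian u x + 2 * (c \<bullet> gradient u x) + (c \<bullet> c) * u x) * exp (c \<bullet> x)"
proof -
  let ?w = "\<lambda>y. u y * exp (c \<bullet> y)"
  let ?w1 = "\<lambda>i y. (partial_deriv i u y + (c \<bullet> i) * u y) * exp (c \<bullet> y)"
  let ?w2 = "\<lambda>i j y. (partial_deriv j (partial_deriv i u) y + (c \<bullet> j) * partial_deriv i u y +
    (c \<bullet> i) * partial_deriv j u y + (c \<bullet> i) * (c \<bullet> j) * u y) * exp (c \<bullet> y)"
  note C = Ck_on_2D[OF u]
  have e: "((\<lambda>t. exp (c \<bullet> (x + t *\<^sub>R i))) has_real_derivative (c \<bullet> i) * exp (c \<bullet> x)) (at 0)" for x i
    by (auto intro!: derivative_eq_intros simp: inner_add_right)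
  have d1: "((\<lambda>t. ?w (x + t *\<^sub>R i)) has_real_derivative ?w1 i x) (at 0)" if "i \<in> Basis" "x \<in> D" for i x
    by (rule derivative_eq_intros C(4)[OF that] e refl)+ (simp add: algebra_simps)
  have d2: "((\<lambda>t. ?w1 i (x + t *\<^sub>R j)) has_real_derivative ?w2 i j x) (at 0)"
    if "i \<in> Basis" "j \<in> Basis" "x \<in> D" for i j x
    by (rule derivative_eq_intros C(4)[OF that(2,3)] C(5)[OF that] e refl)+ (simp add: algebra_simps)
  have cont: "continuous_on D ?w" "\<And>i. i \<in> Basis \<Longrightarrow> continuous_on D (?w1 i)"
    "\<And>i j. i \<in> Basis \<Longrightarrow> j \<in> Basis \<Longrightarrow> continuous_on D (?w2 i j)"
    using C(1-3) by (auto intro!: continuous_intros)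
  note R = Ck_on_2I[where f = ?w and ?f1.0 = ?w1 and ?f2.0 = ?w2, OF D cont d1 d2]
  show "Ck_on 2 D ?w"
    by (rule R(1))
  show "laplacian ?w x = (laplacian u x + 2 * (c \<bullet> gradient u x) + (c \<bullet> c) * u x) * exp (c \<bullet> x)" if x: "x \<in> D"
  proof -
    have "laplacian ?w x = (\<Sum>i\<in>Basis. ?w2 i i x)"
      unfolding laplacian_def by (intro sum.cong refl R(3)) (use x in auto)
    also have "\<dots> = (laplacian u x + 2 * (\<Sum>i\<in>Basis. (c \<bullet> i) * partial_deriv i u x) + (\<Sum>i\<in>Basis. (c \<bullet> i) * (c \<bullet> i)) * u x) * exp (c \<bullet> x)"
      unfolding laplacian_def
      by (simp add: sum.distrib sum_distrib_left sum_distrib_right algebra_simps)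
    also have "(\<Sum>i\<in>Basis. (c \<bullet> i) * partial_deriv i u x) = c \<bullet> gradient u x"
      by (simp add: gradient_def inner_sum_right mult.commute)
    also have "(\<Sum>i\<in>Basis. (c \<bullet> i) * (c \<bullet> i)) = c \<bullet> c"
      by (rule euclidean_inner[symmetric])
    finally show ?thesis .
  qed
qed

subsection \<open>Comparison of spherical means with a radial solution\<close>

lemma has_real_derivative_inner_self_line:
  fixes y i :: "'a::real_inner"
  shows "((\<lambda>t. (y + t *\<^sub>R i) \<bullet> (y + t *\<^sub>R i)) has_real_derivative 2 * (y \<bullet> i)) (at 0)"
proof -
  have "(y + t *\<^sub>R i) \<bullet> (y + t *\<^sub>R i) = y \<bullet> y + t * (2 * (y \<bullet> i)) + t * t * (i \<bullet> i)" for t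
    by (simp add: inner_add_left inner_add_right inner_commute[of i y] algebra_simps)
  then show ?thesis
    by (auto intro!: derivative_eq_intros)
qed

text \<open>\<open>V\<close> is a function recentred at the origin, and \<open>P\<close> is a radial
  profile in the variable \<open>t = |y|^2\<close>. The Laplacian of
  \<open>P (y \<bullet> y)\<close> is \<open>4 t P'' + 2 d P'\<close>, so \<open>P_ode\<close> says
  that this radial function solves the Helmholtz equation with coefficient \<open>q\<close>.\<close>

locale radial_comparison =
  fixes V :: "'a::euclidean_space \<Rightarrow> real" and V1 V2 :: "'a \<Rightarrow> 'a \<Rightarrow> real" and R :: real
    and P P1 P2 :: "real \<Rightarrow> real" and q :: real
  assumes R: "R > 0"
    and V1: "\<And>i y. i \<in> Basis \<Longrightarrow> y \<in> ball 0 R \<Longrightarrow> ((\<lambda>t. V (y + t *\<^sub>R i)) has_real_derivative V1 i y) (at 0)"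
    and V2: "\<And>i y. i \<in> Basis \<Longrightarrow> y \<in> ball 0 R \<Longrightarrow> ((\<lambda>t. V1 i (y + t *\<^sub>R i)) has_real_derivative V2 i y) (at 0)"
    and cont_V: "continuous_on (ball 0 R) V"
    and cont_V1: "\<And>i. i \<in> Basis \<Longrightarrow> continuous_on (ball 0 R) (V1 i)"
    and cont_V2: "\<And>i. i \<in> Basis \<Longrightarrow> continuous_on (ball 0 R) (V2 i)"
    and P1: "\<And>t. (P has_real_derivative P1 t) (at t)"
    and P2: "\<And>t. (P1 has_real_derivative P2 t) (at t)"
    and cont_P2: "continuous_on UNIV P2"
    and P_ode: "\<And>t. 4 * t * P2 t + 2 * real DIM('a) * P1 t = q * P t"
    and P_pos: "\<And>t. t \<ge> 0 \<Longrightarrow> P t > 0"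
    and P_0: "P 0 = 1"
begin

definition smean :: "real \<Rightarrow> real" where
  "smean s = (LINT z|unit_ball_measure. V (s *\<^sub>R dir z))"

definition smean1 :: "real \<Rightarrow> real" where
  "smean1 s = (LINT z|unit_ball_measure. (\<Sum>i\<in>Basis. (dir z \<bullet> i) * V1 i (s *\<^sub>R dir z)))"

text \<open>With \<open>\<phi>(s) = P (s^2)\<close> this is \<open>\<phi> f' - f \<phi>'\<close> for
  the mean \<open>f\<close>; the factor \<open>2 * s\<close> comes from the chain rule.\<close>

definition wronskian :: "real \<Rightarrow> real" where
  "wronskian s = P (s\<^sup>2) * smean1 s - 2 * s * P1 (s\<^sup>2) * smean s"

lemma cont_P: "continuous_on S (\<lambda>x. P (f x))" "continuous_on S (\<lambda>x. P1 (f x))" "continuous_on S (\<lambda>x. P2 (f x))"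
  if "continuous_on S f" for f :: "'b::topological_space \<Rightarrow> real"
proof -
  have "continuous_on UNIV P" "continuous_on UNIV P1"
    using P1 P2 DERIV_isCont by (blast intro: continuous_at_imp_continuous_on)+
  then show "continuous_on S (\<lambda>x. P (f x))" "continuous_on S (\<lambda>x. P1 (f x))" "continuous_on S (\<lambda>x. P2 (f x))"
    using cont_P2 that by (blast intro: continuous_on_compose2)+
qed

lemma measurable_on_sphere:
  fixes A :: "'a \<Rightarrow> real"
  assumes A: "continuous_on (ball 0 R) A" and s: "\<bar>s\<bar> < R"
  shows "(\<lambda>z. A (s *\<^sub>R dir z)) \<in> borel_measurable unit_ball_measure"
proof -
  have [measurable]: "(\<lambda>y. indicator (ball 0 R) y *\<^sub>R A y) \<in> borel_measurable borel"
    using A by (intro borel_measurable_continuous_on_indicator) auto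
  have "(\<lambda>z. A (s *\<^sub>R dir z)) = (\<lambda>z. (\<lambda>y. indicator (ball 0 R) y *\<^sub>R A y) (s *\<^sub>R dir z))"
    using s by (simp add: fun_eq_iff)
  also have "\<dots> \<in> borel_measurable unit_ball_measure"
    by measurable
  finally show ?thesis .
qed

lemma bounded_on_spheres:
  fixes A :: "'a \<Rightarrow> real"
  assumes A: "continuous_on (ball 0 R) A" and r: "r < R"
  obtains C where "\<And>s z. \<bar>s\<bar> \<le> r \<Longrightarrow> \<bar>A (s *\<^sub>R dir z)\<bar> \<le> C"
proof -
  have "compact (A ` cball 0 r)"
    using A r by (intro compact_continuous_image) (auto intro: continuous_on_subset)
  then have "bounded (A ` cball 0 r)"
    by (rule compact_imp_bounded)
  then obtain C where "\<And>y. y \<in> cball 0 r \<Longrightarrow> \<bar>A y\<bar> \<le> C"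
    unfolding bounded_iff by (metis imageI real_norm_def)
  then have "\<bar>A (s *\<^sub>R dir z)\<bar> \<le> C" if "\<bar>s\<bar> \<le> r" for s z
    using that by simp
  then show thesis by (rule that)
qed

lemma integrable_on_sphere:
  fixes A :: "'a \<Rightarrow> real"
  assumes A: "continuous_on (ball 0 R) A" and s: "\<bar>s\<bar> < R"
  shows "integrable unit_ball_measure (\<lambda>z. A (s *\<^sub>R dir z))"
proof -
  obtain C where C: "\<And>t z. \<bar>t\<bar> \<le> \<bar>s\<bar> \<Longrightarrow> \<bar>A (t *\<^sub>R dir z)\<bar> \<le> C"
    using bounded_on_spheres[OF A s] by blast
  show ?thesis
    by (rule unit_ball_measure.integrable_const_bound[where B = C]) 
      (use C measurable_on_sphere[OF A s] in auto)
qed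

lemma radial_V_deriv:
  fixes z :: 'a
  assumes s: "\<bar>s\<bar> < R"
  shows "((\<lambda>t. V (t *\<^sub>R dir z)) has_real_derivative (\<Sum>i\<in>Basis. (dir z \<bullet> i) * V1 i (s *\<^sub>R dir z))) (at s)"
proof -
  have "(V has_derivative (\<lambda>h. \<Sum>i\<in>Basis. (h \<bullet> i) * V1 i (s *\<^sub>R dir z))) (at (s *\<^sub>R dir z))"
    by (rule has_derivative_if_continuous_partials[where S = "ball 0 R"])
      (use s V1 cont_V1 in auto)
  then have "((\<lambda>t. V (t *\<^sub>R dir z)) has_derivative (\<lambda>t. \<Sum>i\<in>Basis. ((t *\<^sub>R dir z) \<bullet> i) * V1 i (s *\<^sub>R dir z))) (at s)"
    by (rule has_derivative_compose[rotated]) (auto intro!: derivative_eq_intros)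
  then show ?thesis
    by (simp add: has_field_derivative_def sum_distrib_left[symmetric] mult.assoc mult_commute_abs)
qed

lemma radial_V_deriv_integrable:
  assumes s: "\<bar>s\<bar> < R"
  shows "integrable unit_ball_measure (\<lambda>z. \<Sum>i\<in>Basis. (dir z \<bullet> i) * V1 i (s *\<^sub>R dir z))"
proof (intro Bochner_Integration.integrable_sum)
  fix i :: 'a assume i: "i \<in> Basis"
  show "integrable unit_ball_measure (\<lambda>z. (dir z \<bullet> i) * V1 i (s *\<^sub>R dir z))"
  proof (rule Bochner_Integration.integrable_bound[OF integrable_on_sphere[OF cont_V1[OF i] s]])
    have [measurable]: "(\<lambda>z. V1 i (s *\<^sub>R dir z)) \<in> borel_measurable unit_ball_measure"
      by (rule measurable_on_sphere[OF cont_V1[OF i] s])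
    show "(\<lambda>z. (dir z \<bullet> i) * V1 i (s *\<^sub>R dir z)) \<in> borel_measurable unit_ball_measure"
      by measurable
    have "\<bar>dir z \<bullet> i\<bar> \<le> 1" for z :: 'a
      using Basis_le_norm[OF i, of "dir z"] by simp
    then show "AE z in unit_ball_measure. norm ((dir z \<bullet> i) * V1 i (s *\<^sub>R dir z)) \<le> norm (V1 i (s *\<^sub>R dir z))"
      by (intro AE_I2) (simp add: abs_mult mult_left_le_one_le)
  qed
qed

lemma radial_V_deriv_bounded:
  assumes r: "r < R"
  obtains B where "\<And>s z. \<bar>s\<bar> \<le> r \<Longrightarrow> \<bar>\<Sum>i\<in>Basis. (dir z \<bullet> i) * V1 i (s *\<^sub>R dir z)\<bar> \<le> B"
proof -
  have "\<forall>i\<in>Basis. \<exists>C. \<forall>s z. \<bar>s\<bar> \<le> r \<longrightarrow> \<bar>V1 i (s *\<^sub>R dir z)\<bar> \<le> C"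
    using bounded_on_spheres[OF cont_V1 r] by metis
  then obtain C where C: "\<And>i s z. i \<in> Basis \<Longrightarrow> \<bar>s\<bar> \<le> r \<Longrightarrow> \<bar>V1 i (s *\<^sub>R dir z)\<bar> \<le> C i"
    by metis
  have "\<bar>\<Sum>i\<in>Basis. (dir z \<bullet> i) * V1 i (s *\<^sub>R dir z)\<bar> \<le> (\<Sum>i\<in>Basis. C i)" if s: "\<bar>s\<bar> \<le> r" for s z
  proof -
    have "\<bar>\<Sum>i\<in>Basis. (dir z \<bullet> i) * V1 i (s *\<^sub>R dir z)\<bar> \<le> (\<Sum>i\<in>Basis. \<bar>(dir z \<bullet> i) * V1 i (s *\<^sub>R dir z)\<bar>)"
      by (rule sum_abs)
    also have "\<dots> \<le> (\<Sum>i\<in>Basis. C i)"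
    proof (rule sum_mono)
      fix i :: 'a assume i: "i \<in> Basis"
      have "\<bar>dir z \<bullet> i\<bar> \<le> 1"
        using Basis_le_norm[OF i, of "dir z"] by simp
      then have "\<bar>(dir z \<bullet> i) * V1 i (s *\<^sub>R dir z)\<bar> \<le> 1 * C i"
        unfolding abs_mult using C[OF i s] by (intro mult_mono) auto
      then show "\<bar>(dir z \<bullet> i) * V1 i (s *\<^sub>R dir z)\<bar> \<le> C i" by simp
    qed
    finally show ?thesis .
  qed
  then show thesis by (rule that)
qed

text \<open>\<open>smean\<close> makes sense for negative \<open>s\<close> too, so 0 is an interior
  point and continuity at the centre comes from differentiability.\<close>

lemma smean_deriv:
  assumes s: "\<bar>s\<bar> < R"
  shows "(smean has_real_derivative smean1 s) (at s)"
proof -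
  obtain r where r: "\<bar>s\<bar> < r" "r < R"
    using s dense by blast
  obtain B where B: "\<And>t z. \<bar>t\<bar> \<le> r \<Longrightarrow> \<bar>\<Sum>i\<in>Basis. (dir z \<bullet> i) * V1 i (t *\<^sub>R dir z)\<bar> \<le> B"
    using radial_V_deriv_bounded[OF r(2)] by blast
  have "((\<lambda>s. LINT z|unit_ball_measure. V (s *\<^sub>R dir z)) has_real_derivative
      (LINT z|unit_ball_measure. (\<Sum>i\<in>Basis. (dir z \<bullet> i) * V1 i (s *\<^sub>R dir z)))) (at s)"
  proof (rule has_real_derivative_integral(2)[where U = "{-r<..<r}" and B = "\<lambda>_. B"])
    show "s \<in> {-r<..<r}"
      using r by auto
    fix t assume "t \<in> {-r<..<r}"
    then have t: "\<bar>t\<bar> < R" "\<bar>t\<bar> \<le> r" using r by auto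
    show "integrable unit_ball_measure (\<lambda>z. V (t *\<^sub>R dir z))"
      by (rule integrable_on_sphere[OF cont_V t(1)])
    fix z :: 'a
    show "((\<lambda>t. V (t *\<^sub>R dir z)) has_real_derivative (\<Sum>i\<in>Basis. (dir z \<bullet> i) * V1 i (t *\<^sub>R dir z))) (at t)"
      by (rule radial_V_deriv[OF t(1)])
    show "\<bar>\<Sum>i\<in>Basis. (dir z \<bullet> i) * V1 i (t *\<^sub>R dir z)\<bar> \<le> B"
      by (rule B[OF t(2)])
  qed auto
  then show ?thesis
    unfolding smean_def[abs_def] smean1_def .
qed

lemma cont_smean: "continuous_on {-R<..<R} smean"
  by (intro continuous_at_imp_continuous_on ballI DERIV_isCont[OF smean_deriv]) auto

lemma cont_smean1: "continuous_on {-R<..<R} smean1"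
proof (intro continuous_at_imp_continuous_on ballI)
  fix s assume "s \<in> {-R<..<R}"
  then have "\<bar>s\<bar> < R" by auto
  then obtain r where r: "\<bar>s\<bar> < r" "r < R"
    using dense by blast
  obtain B where B: "\<And>t z. \<bar>t\<bar> \<le> r \<Longrightarrow> \<bar>\<Sum>i\<in>Basis. (dir z \<bullet> i) * V1 i (t *\<^sub>R dir z)\<bar> \<le> B"
    using radial_V_deriv_bounded[OF r(2)] by blast
  have "continuous_on {-r<..<r} (\<lambda>s. LINT z|unit_ball_measure. (\<Sum>i\<in>Basis. (dir z \<bullet> i) * V1 i (s *\<^sub>R dir z)))"
  proof (rule continuous_on_integral_param[where B = "\<lambda>_. B"])
    fix t assume "t \<in> {-r<..<r}"
    then have t: "\<bar>t\<bar> < R" "\<bar>t\<bar> \<le> r" using r by auto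
    show "(\<lambda>z. \<Sum>i\<in>Basis. (dir z \<bullet> i) * V1 i (t *\<^sub>R dir z)) \<in> borel_measurable unit_ball_measure"
      using radial_V_deriv_integrable[OF t(1)] by auto
    show "\<bar>\<Sum>i\<in>Basis. (dir z \<bullet> i) * V1 i (t *\<^sub>R dir z)\<bar> \<le> B" for z
      by (rule B[OF t(2)])
  next
    fix z :: 'a
    show "continuous_on {-r<..<r} (\<lambda>t. \<Sum>i\<in>Basis. (dir z \<bullet> i) * V1 i (t *\<^sub>R dir z))"
      by (intro continuous_intros continuous_on_compose2[OF cont_V1]) (use r in auto)
  qed auto
  then show "isCont smean1 s"
    unfolding smean1_def[abs_def] using r
    by (subst (asm) continuous_on_eq_continuous_at) (auto simp: abs_less_iff)
qed

lemma cont_wronskian: "continuous_on {-R<..<R} wronskian"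
  unfolding wronskian_def by (intro continuous_intros cont_P cont_smean cont_smean1)

text \<open>
  With \<open>\<Phi>(y) = P(|y|\<^sup>2)\<close>, a solution of \<open>\<Delta>\<Phi> = q \<Phi>\<close>, and \<open>\<eta>(y) = H(|y|\<^sup>2)\<close>, this is
  \<open>\<integral> div (\<eta> (\<Phi> \<nabla>V - V \<nabla>\<Phi>)) = 0\<close> in polar coordinates.
\<close>

lemma wronskian_identity:
  assumes \<rho>: "0 < \<rho>" "\<rho> < R"
    and H1: "\<And>t. (H has_real_derivative H1 t) (at t)" and cont_H1: "continuous_on UNIV H1"
    and H0: "\<And>t. t \<ge> \<rho>\<^sup>2 \<Longrightarrow> H t = 0" and H10: "\<And>t. t \<ge> \<rho>\<^sup>2 \<Longrightarrow> H1 t = 0"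
  shows "integrable lborel (\<lambda>s. indicator {0<..} s * s ^ (DIM('a) - 1) * (2 * s * H1 (s\<^sup>2) * wronskian s))"
    and "integrable lborel (\<lambda>y. H (y \<bullet> y) * P (y \<bullet> y) * ((\<Sum>i\<in>Basis. V2 i y) - q * V y))"
    and "radial_const TYPE('a) * (LINT s|lborel. indicator {0<..} s * s ^ (DIM('a) - 1) * (2 * s * H1 (s\<^sup>2) * wronskian s))
      = - (LINT y|lborel. H (y \<bullet> y) * P (y \<bullet> y) * ((\<Sum>i\<in>Basis. V2 i y) - q * V y))"
proof -
  have cont_H: "continuous_on UNIV H"
    using H1 DERIV_isCont by (blast intro: continuous_at_imp_continuous_on)
  have cH: "continuous_on UNIV (\<lambda>y::'a. H (y \<bullet> y))" "continuous_on UNIV (\<lambda>y::'a. H1 (y \<bullet> y))"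
    by (rule continuous_on_compose2[OF cont_H] continuous_on_compose2[OF cont_H1];
        intro continuous_intros subset_UNIV)+
  have sq: "y \<bullet> y \<ge> \<rho>\<^sup>2" if "norm y \<ge> \<rho>" for y :: 'a
    using that \<rho> by (simp add: dot_square_norm power_mono)
  have H0': "H (y \<bullet> y) = 0" "H1 (y \<bullet> y) = 0" if "norm y \<ge> \<rho>" for y :: 'a
    using H0 H10 sq[OF that] by auto
  \<comment> \<open>The \<open>i\<close>-th component of the vector field
    \<open>\<Phi> \<nabla>V - V \<nabla>\<Phi>\<close>.\<close>
  define F where "F i y = P (y \<bullet> y) * V1 i y - V y * (2 * P1 (y \<bullet> y) * (y \<bullet> i))" for i y
  \<comment> \<open>The derivative of \<open>F i\<close> in direction \<open>i\<close>: the two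
    products of first derivatives in the product rule cancel.\<close>
  define F' where "F' i y = P (y \<bullet> y) * V2 i y - V y * (4 * P2 (y \<bullet> y) * (y \<bullet> i)\<^sup>2 + 2 * P1 (y \<bullet> y))" for i y
  \<comment> \<open>\<open>H1 (y \<bullet> y) * A y\<close> is the gradient of \<open>\<eta>\<close>
    applied to the field, and \<open>B\<close> is the divergence of the field.\<close>
  define A where "A y = (\<Sum>i\<in>Basis. 2 * (y \<bullet> i) * F i y)" for y
  define B where "B y = P (y \<bullet> y) * ((\<Sum>i\<in>Basis. V2 i y) - q * V y)" for y
  note cPy = cont_P[of "ball 0 R" "\<lambda>y::'a. y \<bullet> y", OF continuous_on_inner[OF continuous_on_id continuous_on_id]]
  have cF: "continuous_on (ball 0 R) (F i)" "continuous_on (ball 0 R) (F' i)" if "i \<in> Basis" for i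
  proof -
    have "continuous_on (ball 0 R) (\<lambda>y. y \<bullet> i)"
      by (intro continuous_intros)
    note c = this cPy cont_V cont_V1[OF that] cont_V2[OF that]
    show "continuous_on (ball 0 R) (F i)"
      unfolding F_def[abs_def] using c
      by (intro continuous_on_diff continuous_on_mult continuous_on_const)
    show "continuous_on (ball 0 R) (F' i)"
      unfolding F'_def[abs_def] using c
      by (intro continuous_on_diff continuous_on_add continuous_on_mult continuous_on_power continuous_on_const)
  qed
  have cA: "continuous_on (ball 0 R) A"
    unfolding A_def by (intro continuous_intros cF)
  have cB: "continuous_on (ball 0 R) B"
    unfolding B_def by (intro continuous_intros cont_P cont_V cont_V2)
  have dF: "((\<lambda>t. F i (y + t *\<^sub>R i)) has_real_derivative F' i y) (at 0)" if i: "i \<in> Basis" and y: "y \<in> ball 0 R" for i y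
  proof -
    have n: "((\<lambda>t. (y + t *\<^sub>R i) \<bullet> (y + t *\<^sub>R i)) has_real_derivative 2 * (y \<bullet> i)) (at 0)"
      by (rule has_real_derivative_inner_self_line)
    have Pn: "((\<lambda>t. P ((y + t *\<^sub>R i) \<bullet> (y + t *\<^sub>R i))) has_real_derivative P1 (y \<bullet> y) * (2 * (y \<bullet> i))) (at 0)"
      using DERIV_chain2[OF P1 n] by simp
    have P1n: "((\<lambda>t. P1 ((y + t *\<^sub>R i) \<bullet> (y + t *\<^sub>R i))) has_real_derivative P2 (y \<bullet> y) * (2 * (y \<bullet> i))) (at 0)"
      using DERIV_chain2[OF P2 n] by simp
    have l: "((\<lambda>t. (y + t *\<^sub>R i) \<bullet> i) has_real_derivative 1) (at 0)"
    proof -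
      have "(y + t *\<^sub>R i) \<bullet> i = y \<bullet> i + t" for t
        using i by (simp add: inner_add_left)
      then show ?thesis
        by (auto intro!: derivative_eq_intros)
    qed
    show ?thesis
      unfolding F_def
      by (rule derivative_eq_intros Pn P1n l V1[OF i y] V2[OF i y] refl)+
        (simp add: F'_def power2_eq_square algebra_simps)
  qed
  define G where "G i y = H (y \<bullet> y) * F i y" for i y
  define G' where "G' i y = H1 (y \<bullet> y) * (2 * (y \<bullet> i) * F i y) + H (y \<bullet> y) * F' i y" for i y
  have dG: "((\<lambda>t. G i (y + t *\<^sub>R i)) has_real_derivative G' i y) (at 0)" if i: "i \<in> Basis" for i y
  proof (cases "norm y < R")
    case True
    have n: "((\<lambda>t. (y + t *\<^sub>R i) \<bullet> (y + t *\<^sub>R i)) has_real_derivative 2 * (y \<bullet> i)) (at 0)"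
      by (rule has_real_derivative_inner_self_line)
    have Hn: "((\<lambda>t. H ((y + t *\<^sub>R i) \<bullet> (y + t *\<^sub>R i))) has_real_derivative H1 (y \<bullet> y) * (2 * (y \<bullet> i))) (at 0)"
      using DERIV_chain2[OF H1 n] by simp
    have y: "y \<in> ball 0 R" using True by simp
    show ?thesis
      unfolding G_def
      by (rule derivative_eq_intros Hn dF[OF i y] refl)+ (simp add: G'_def algebra_simps)
  next
    case False
    \<comment> \<open>\<open>V\<close> is uncontrolled here, but \<open>H\<close> makes
      \<open>G i\<close> vanish on the open set outside \<open>cball 0 \<rho>\<close>, which
      contains \<open>y\<close>.\<close>
    have "((\<lambda>t. G i (y + t *\<^sub>R i)) has_real_derivative 0) (at 0)"
    proof (rule has_field_derivative_transform_within_open[where f = "\<lambda>_. 0" and S = "(\<lambda>t. y + t *\<^sub>R i) -` (- cball 0 \<rho>)"])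
      show "open ((\<lambda>t. y + t *\<^sub>R i) -` (- cball 0 \<rho>))"
        by (intro open_vimage continuous_intros) auto
      show "0 = G i (y + t *\<^sub>R i)" if "t \<in> (\<lambda>t. y + t *\<^sub>R i) -` (- cball 0 \<rho>)" for t
        using that H0'[of "y + t *\<^sub>R i"] by (simp add: G_def)
    qed (use False \<rho> in auto)
    moreover have "G' i y = 0"
      using False \<rho> H0'[of y] by (simp add: G'_def)
    ultimately show ?thesis by simp
  qed
  have cG: "continuous_on UNIV (G i)" if "i \<in> Basis" for i
    unfolding G_def by (rule continuous_on_bounded_support[OF \<rho>(2) cF(1)[OF that] cH(1) H0'(1)])
  have cG': "continuous_on UNIV (G' i)" if "i \<in> Basis" for i
    unfolding G'_def
    by (intro continuous_on_add continuous_on_bounded_support[OF \<rho>(2) _ cH(1) H0'(1)]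
        continuous_on_bounded_support[OF \<rho>(2) _ cH(2) H0'(2)] cF[OF that] continuous_intros)
  have G'0: "G' i y = 0" if "norm y \<ge> \<rho>" for i y
    using H0'[OF that] by (simp add: G'_def)
  have intG': "integrable lborel (G' i)" if "i \<in> Basis" for i
    by (rule integrable_bounded_support[OF cG'[OF that] G'0])
  have zero: "integral\<^sup>L lborel (G' i) = 0" if "i \<in> Basis" for i
    by (rule integral_partial_derivative_eq_0[OF dG that cG _ cG' G'0]) (use that H0' in \<open>auto simp: G_def\<close>)
  have sumF': "(\<Sum>i\<in>Basis. F' i y) = B y" for y
  proof -
    have "(\<Sum>i\<in>Basis. F' i y) = P (y \<bullet> y) * (\<Sum>i\<in>Basis. V2 i y) -
        V y * (4 * P2 (y \<bullet> y) * (\<Sum>i\<in>Basis. (y \<bullet> i) * (y \<bullet> i)) + 2 * real DIM('a) * P1 (y \<bullet> y))"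
      unfolding F'_def
      by (simp add: sum_subtractf sum.distrib sum_distrib_left power2_eq_square algebra_simps)
    also have "(\<Sum>i\<in>Basis. (y \<bullet> i) * (y \<bullet> i)) = y \<bullet> y"
      by (rule euclidean_inner[symmetric])
    also have "4 * P2 (y \<bullet> y) * (y \<bullet> y) + 2 * real DIM('a) * P1 (y \<bullet> y) = q * P (y \<bullet> y)"
      using P_ode[of "y \<bullet> y"] by (simp add: mult_ac)
    finally show ?thesis
      by (simp add: B_def algebra_simps)
  qed
  have sumG': "(\<Sum>i\<in>Basis. G' i y) = H1 (y \<bullet> y) * A y + H (y \<bullet> y) * B y" for y
    unfolding G'_def sum.distrib sumF'[symmetric] A_def by (simp add: sum_distrib_left)
  have intA: "integrable lborel (\<lambda>y. H1 (y \<bullet> y) * A y)"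
    by (rule integrable_bounded_support[where r = \<rho>, OF continuous_on_bounded_support[OF \<rho>(2) cA cH(2) H0'(2)]]) (use H0' in auto)
  have intB: "integrable lborel (\<lambda>y. H (y \<bullet> y) * B y)"
    by (rule integrable_bounded_support[where r = \<rho>, OF continuous_on_bounded_support[OF \<rho>(2) cB cH(1) H0'(1)]]) (use H0' in auto)
  then show "integrable lborel (\<lambda>y. H (y \<bullet> y) * P (y \<bullet> y) * ((\<Sum>i\<in>Basis. V2 i y) - q * V y))"
    by (simp add: B_def mult.assoc)
  have "0 = (LINT y|lborel. (\<Sum>i\<in>Basis. G' i y))"
    using zero intG' by (subst Bochner_Integration.integral_sum) auto
  also have "\<dots> = (LINT y|lborel. H1 (y \<bullet> y) * A y) + (LINT y|lborel. H (y \<bullet> y) * B y)"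
    unfolding sumG' by (rule Bochner_Integration.integral_add[OF intA intB])
  finally have eq: "(LINT y|lborel. H1 (y \<bullet> y) * A y) = - (LINT y|lborel. H (y \<bullet> y) * P (y \<bullet> y) * ((\<Sum>i\<in>Basis. V2 i y) - q * V y))"
    by (simp add: B_def mult.assoc)
  \<comment> \<open>On a sphere of radius \<open>s\<close> the factors \<open>H1\<close> and
    \<open>P\<close> are constant and the sum of the squared coordinates of \<open>dir z\<close> is
    1, so the mean of \<open>A\<close> is \<open>2 * s\<close> times the Wronskian. Beyond
    \<open>R\<close> the factor \<open>H1\<close> is 0.\<close>
  have polar: "indicator {0<..} s * s ^ (DIM('a) - 1) * (LINT z|unit_ball_measure. H1 ((s *\<^sub>R dir z) \<bullet> (s *\<^sub>R dir (z::'a))) * A (s *\<^sub>R dir z))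
    = indicator {0<..} s * s ^ (DIM('a) - 1) * (2 * s * H1 (s\<^sup>2) * wronskian s)" for s
  proof (cases "0 < s")
    case s: True
    have dd: "(s *\<^sub>R dir z) \<bullet> (s *\<^sub>R dir (z::'a)) = s\<^sup>2" for z
      by (simp add: dot_square_norm power2_eq_square norm_eq_1[symmetric])
    have "(LINT z|unit_ball_measure. H1 (s\<^sup>2) * A (s *\<^sub>R dir z)) = 2 * s * H1 (s\<^sup>2) * wronskian s"
    proof (cases "s < R")
      case True
      have sR: "\<bar>s\<bar> < R" using True s by simp
      have "A (s *\<^sub>R dir z) = 2 * s * (P (s\<^sup>2) * (\<Sum>i\<in>Basis. (dir z \<bullet> i) * V1 i (s *\<^sub>R dir z)) - 2 * s * P1 (s\<^sup>2) * V (s *\<^sub>R dir z))" for z :: 'a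
      proof -
        have 1: "(\<Sum>i\<in>Basis. (dir z \<bullet> i) * (dir z \<bullet> i)) = 1"
          using euclidean_inner[of "dir z" "dir z"] dot_square_norm[of "dir z"] by simp
        have "A (s *\<^sub>R dir z) = (\<Sum>i\<in>Basis. 2 * s * P (s\<^sup>2) * ((dir z \<bullet> i) * V1 i (s *\<^sub>R dir z)) - 2 * s * (2 * s * P1 (s\<^sup>2) * V (s *\<^sub>R dir z)) * ((dir z \<bullet> i) * (dir z \<bullet> i)))"
          unfolding A_def F_def dd by (intro sum.cong) (simp_all add: algebra_simps)
        then show ?thesis
          by (simp add: sum_subtractf sum_distrib_left[symmetric] right_diff_distrib mult.assoc 1)
      qed
      moreover have "(LINT z|unit_ball_measure. P (s\<^sup>2) * (\<Sum>i\<in>Basis. (dir z \<bullet> i) * V1 i (s *\<^sub>R dir z)) - 2 * s * P1 (s\<^sup>2) * V (s *\<^sub>R dir z)) = wronskian s"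
        unfolding wronskian_def smean1_def smean_def
        using radial_V_deriv_integrable[OF sR] integrable_on_sphere[OF cont_V sR]
        by (subst Bochner_Integration.integral_diff) auto
      ultimately show ?thesis by simp
    next
      case False
      then have "H1 (s\<^sup>2) = 0"
        using \<rho> s by (intro H10 power_mono) auto
      then show ?thesis by simp
    qed
    then show ?thesis unfolding dd by simp
  qed simp
  show "integrable lborel (\<lambda>s. indicator {0<..} s * s ^ (DIM('a) - 1) * (2 * s * H1 (s\<^sup>2) * wronskian s))"
    using integral_polar(1)[OF intA] unfolding polar .
  show "radial_const TYPE('a) * (LINT s|lborel. indicator {0<..} s * s ^ (DIM('a) - 1) * (2 * s * H1 (s\<^sup>2) * wronskian s))
      = - (LINT y|lborel. H (y \<bullet> y) * P (y \<bullet> y) * ((\<Sum>i\<in>Basis. V2 i y) - q * V y))"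
    using integral_polar(2)[OF intA] unfolding polar eq by simp
qed

end

section \<open>Truncated powers as test functions\<close>

lemma has_real_derivative_max_0_power:
  "((\<lambda>x. max 0 x ^ Suc (Suc n)) has_real_derivative real (Suc (Suc n)) * max 0 x ^ Suc n) (at (x :: real))"
proof -
  consider "x > 0" | "x < 0" | "x = 0" by linarith
  then show ?thesis
  proof cases
    case 1
    have "((\<lambda>x. x ^ Suc (Suc n)) has_real_derivative real (Suc (Suc n)) * x ^ Suc n) (at x)"
      using DERIV_pow[of "Suc (Suc n)" x UNIV] by simp
    then have "((\<lambda>x. max 0 x ^ Suc (Suc n)) has_real_derivative real (Suc (Suc n)) * x ^ Suc n) (at x)"
      by (rule has_field_derivative_transform_within_open[where S = "{0<..}"]) (use 1 in auto)
    then show ?thesis using 1 by (simp add: max_def)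
  next
    case 2
    have "((\<lambda>x. 0) has_real_derivative 0) (at x)"
      by simp
    then have "((\<lambda>x. max 0 x ^ Suc (Suc n)) has_real_derivative 0) (at x)"
      by (rule has_field_derivative_transform_within_open[where S = "{..<0}"]) (use 2 in auto)
    then show ?thesis using 2 by (simp add: max_def)
  next
    case 3
    \<comment> \<open>At the kink the difference quotient is \<open>max 0 h ^ Suc n\<close>, which
      tends to 0 because the original exponent is at least 2.\<close>
    have "((\<lambda>h::real. max 0 h ^ Suc n) \<longlongrightarrow> max 0 0 ^ Suc n) (at 0)"
      by (intro tendsto_intros)
    then have "((\<lambda>h::real. max 0 h ^ Suc n) \<longlongrightarrow> 0) (at 0)"
      by simp
    then have "((\<lambda>h::real. (max 0 (0 + h) ^ Suc (Suc n) - max 0 0 ^ Suc (Suc n)) / h) \<longlongrightarrow> 0) (at 0)"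
      by (rule Lim_transform_within_open[where s = UNIV]) (auto simp: max_def)
    then show ?thesis
      using 3 by (simp add: DERIV_def)
  qed
qed

lemma has_real_derivative_max_diff_power:
  "((\<lambda>t. max 0 (c - t) ^ Suc (Suc n)) has_real_derivative - (real (Suc (Suc n)) * max 0 (c - t) ^ Suc n)) (at (t :: real))"
proof -
  have "((\<lambda>t. c - t) has_real_derivative -1) (at t)"
    by (auto intro!: derivative_eq_intros)
  from DERIV_chain2[where f = "\<lambda>x. max 0 x ^ Suc (Suc n)", OF has_real_derivative_max_0_power this] show ?thesis
    by (simp only: mult_minus1_right)
qed

section \<open>From the equation to the means and back\<close>

context radial_comparison
begin

lemma smean_0: "smean 0 = V 0"
  by (simp add: smean_def)

text \<open>The identity is tested with the Wronskian itself: \<open>H1 (s\<^sup>2)\<close> is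
  chosen as \<open>wronskian s\<close> times a nonnegative cutoff. The equation kills the right-hand
  side, so a continuous nonnegative function containing the square of the Wronskian has integral
  0.\<close>

lemma wronskian_eq_0_if_pde:
  assumes pde: "\<And>y. y \<in> ball 0 R \<Longrightarrow> (\<Sum>i\<in>Basis. V2 i y) = q * V y" and s0: "0 < s0" "s0 < R"
  shows "wronskian s0 = 0"
proof (rule ccontr)
  assume w: "wronskian s0 \<noteq> 0"
  \<comment> \<open>\<open>s0 < \<rho>\<close> keeps the cutoff positive at \<open>s0\<close>;
    \<open>\<rho> < R\<close> keeps its support inside the ball.\<close>
  obtain \<rho> where \<rho>: "s0 < \<rho>" "\<rho> < R" using s0 dense by blast
  then have \<rho>0: "\<rho> > 0" using s0 by simp
  \<comment> \<open>A clamped square root: \<open>H1\<close> must be continuous on the whole line,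
    while \<open>wronskian\<close> is known to be continuous only on
    \<open>{-R<..<R}\<close>.\<close>
  define cl where "cl t = sqrt (max 0 (min t (\<rho>\<^sup>2)))" for t
  define H1 where "H1 t = wronskian (cl t) * max 0 (\<rho>\<^sup>2 - t)" for t
  have cl: "cl t \<in> {-R<..<R}" for t
  proof -
    have "cl t \<le> sqrt (\<rho>\<^sup>2)"
      unfolding cl_def by (rule real_sqrt_le_mono) auto
    moreover have "cl t \<ge> 0"
      unfolding cl_def by simp
    ultimately show ?thesis using \<rho> \<rho>0 by simp
  qed
  have "continuous_on UNIV cl"
    unfolding cl_def by (intro continuous_intros)
  then have "continuous_on UNIV (\<lambda>t. wronskian (cl t))"
    using cl by (intro continuous_on_compose2[OF cont_wronskian]) auto
  then have cH1: "continuous_on UNIV H1"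
    unfolding H1_def by (intro continuous_intros)
  have H10: "H1 t = 0" if "t \<ge> \<rho>\<^sup>2" for t
    using that by (simp add: H1_def)
  obtain F where F: "\<And>t. (F has_real_derivative H1 t) (at t)"
  proof -
    have "\<exists>F. \<forall>x. -\<infinity> < ereal x \<longrightarrow> ereal x < \<infinity> \<longrightarrow> (F has_vector_derivative H1 x) (at x)"
      by (rule einterval_antiderivative) (use cH1 continuous_on_eq_continuous_at in auto)
    then show thesis
      using that by (auto simp: has_real_derivative_iff_has_vector_derivative)
  qed
  \<comment> \<open>Beyond \<open>\<rho>\<^sup>2\<close> the antiderivative \<open>F\<close> is
    constant, so this normalization makes \<open>H\<close> vanish there.\<close>
  define H where "H t = F t - F (\<rho>\<^sup>2)" for t
  have H: "(H has_real_derivative H1 t) (at t)" for t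
    unfolding H_def by (auto intro!: derivative_eq_intros F)
  have H0: "H t = 0" if "t \<ge> \<rho>\<^sup>2" for t
  proof (cases "t = \<rho>\<^sup>2")
    case True
    then show ?thesis by (simp add: H_def)
  next
    case False
    have "F t = F (\<rho>\<^sup>2)"
    proof (rule DERIV_isconst_end[where f = F])
      show "\<rho>\<^sup>2 < t" using False that by simp
      show "continuous_on {\<rho>\<^sup>2..t} F"
        using F DERIV_isCont by (blast intro: continuous_at_imp_continuous_on)
      show "(F has_real_derivative 0) (at x)" if "\<rho>\<^sup>2 < x" "x < t" for x
        using F[of x] H10[of x] that by simp
    qed
    then show ?thesis by (simp add: H_def)
  qed
  let ?g = "\<lambda>s. indicator {0<..} s * s ^ (DIM('a) - 1) * (2 * s * H1 (s\<^sup>2) * wronskian s)"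
  note I = wronskian_identity[OF \<rho>0 \<rho>(2) H cH1 H0 H10]
  have "H (y \<bullet> y) * P (y \<bullet> y) * ((\<Sum>i\<in>Basis. V2 i y) - q * V y) = 0" for y
  proof (cases "norm y < R")
    case True
    then show ?thesis using pde by simp
  next
    case False
    then have "\<rho>\<^sup>2 \<le> y \<bullet> y"
      using \<rho> \<rho>0 by (simp add: dot_square_norm power_mono)
    then show ?thesis using H0 by simp
  qed
  then have "(LINT y|lborel. H (y \<bullet> y) * P (y \<bullet> y) * ((\<Sum>i\<in>Basis. V2 i y) - q * V y)) = 0"
    by (simp only: Bochner_Integration.integral_zero)
  then have zero: "integral\<^sup>L lborel ?g = 0"
    using I(3) radial_const_pos[where 'a='a] by simp
  have H1s: "H1 (s\<^sup>2) * wronskian s = (wronskian s)\<^sup>2 * max 0 (\<rho>\<^sup>2 - s\<^sup>2)" if "s > 0" for s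
  proof (cases "s \<le> \<rho>")
    case True
    then have "cl (s\<^sup>2) = s"
      using that \<rho>0 by (simp add: cl_def min_absorb1 power_mono)
    then show ?thesis by (simp add: H1_def power2_eq_square)
  next
    case False
    then have "\<rho>\<^sup>2 \<le> s\<^sup>2" using \<rho>0 by (intro power_mono) auto
    then show ?thesis using H10 by simp
  qed
  have eq: "?g s = indicator {0<..} s * s ^ (DIM('a) - 1) * (2 * s * ((wronskian s)\<^sup>2 * max 0 (\<rho>\<^sup>2 - s\<^sup>2)))" for s
    using H1s[of s] by (cases "s > 0") (simp_all add: mult.assoc)
  have "integral\<^sup>L lborel ?g > 0"
  proof (rule integral_pos_if_isCont[OF I(1)])
    show "?g s \<ge> 0" for s
      unfolding eq by (cases "s > 0") auto
    have "continuous_on {0<..<R} (\<lambda>s. s ^ (DIM('a) - 1) * (2 * s * H1 (s\<^sup>2) * wronskian s))"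
      by (intro continuous_intros continuous_on_compose2[OF cH1] continuous_on_subset[OF cont_wronskian]) auto
    then have "continuous_on {0<..<R} ?g"
      by (rule continuous_on_eq) auto
    then show "isCont ?g s0"
      using s0 by (subst (asm) continuous_on_eq_continuous_at) auto
    have "s0\<^sup>2 < \<rho>\<^sup>2"
      using \<rho> s0 by (intro power_strict_mono) auto
    then show "?g s0 > 0"
      unfolding eq using w s0 by (auto intro!: mult_pos_pos)
  qed
  then show False using zero by simp
qed

text \<open>The derivative of \<open>f / \<phi>\<close> is the Wronskian divided by
  \<open>\<phi>^2\<close>, hence 0; at the centre the quotient is \<open>V 0\<close> because
  \<open>P 0 = 1\<close>.\<close>

lemma smean_eq_if_pde:
  assumes pde: "\<And>y. y \<in> ball 0 R \<Longrightarrow> (\<Sum>i\<in>Basis. V2 i y) = q * V y" and s: "0 < s" "s < R"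
  shows "smean s = P (s\<^sup>2) * V 0"
proof -
  have pos: "P (t\<^sup>2) > 0" for t by (rule P_pos) simp
  have "smean s / P (s\<^sup>2) = smean 0 / P (0\<^sup>2)"
  proof (rule DERIV_isconst_end[where f = "\<lambda>s. smean s / P (s\<^sup>2)"])
    show "continuous_on {0..s} (\<lambda>s. smean s / P (s\<^sup>2))"
      using pos s
      by (intro continuous_on_divide cont_P continuous_intros continuous_on_subset[OF cont_smean])
        (auto simp: less_imp_neq[OF pos, symmetric])
    fix t assume t: "0 < t" "t < s"
    have d: "((\<lambda>t. P (t\<^sup>2)) has_real_derivative P1 (t\<^sup>2) * (2 * t)) (at t)"
      by (rule DERIV_chain2[OF P1]) (auto intro!: derivative_eq_intros)
    have "((\<lambda>s. smean s / P (s\<^sup>2)) has_real_derivative (smean1 t * P (t\<^sup>2) - smean t * (P1 (t\<^sup>2) * (2 * t))) / (P (t\<^sup>2) * P (t\<^sup>2))) (at t)"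
      by (rule DERIV_divide[OF smean_deriv d]) (use t s pos[of t] in auto)
    moreover have "smean1 t * P (t\<^sup>2) - smean t * (P1 (t\<^sup>2) * (2 * t)) = 0"
      using wronskian_eq_0_if_pde[OF pde, of t] t s by (simp add: wronskian_def mult_ac)
    ultimately show "((\<lambda>s. smean s / P (s\<^sup>2)) has_real_derivative 0) (at t)"
      by simp
  qed (use s in auto)
  then show ?thesis
    using pos[of s] by (simp add: smean_0 P_0 field_simps)
qed

text \<open>A nonzero defect \<open>e 0\<close> would give \<open>e\<close> the same sign near 0,
  and a bump supported there would see a nonzero integral, while the identity makes it 0.\<close>

lemma pde_if_smean_eq:
  assumes mean: "\<And>s. 0 < s \<Longrightarrow> s < R \<Longrightarrow> smean s = P (s\<^sup>2) * V 0"
  shows "(\<Sum>i\<in>Basis. V2 i 0) = q * V 0"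
proof (rule ccontr)
  assume ne: "(\<Sum>i\<in>Basis. V2 i 0) \<noteq> q * V 0"
  define e where "e y = (\<Sum>i\<in>Basis. V2 i y) - q * V y" for y
  have e0: "e 0 \<noteq> 0" using ne by (simp add: e_def)
  have ce: "continuous_on (ball 0 R) e"
    unfolding e_def by (intro continuous_intros cont_V cont_V2)
  then have ic: "isCont e 0"
    using R by (subst (asm) continuous_on_eq_continuous_at) auto
  \<comment> \<open>Multiplying by \<open>e 0\<close> replaces a case distinction on its
    sign.\<close>
  then have "((\<lambda>y. e 0 * e y) \<longlongrightarrow> e 0 * e 0) (at 0)"
    by (intro tendsto_intros) (simp add: isCont_def)
  moreover have "e 0 * e 0 > 0"
    using e0 not_real_square_gt_zero by blast
  ultimately have "\<forall>\<^sub>F y in at 0. 0 < e 0 * e y"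
    by (rule order_tendstoD)
  then obtain d where d: "d > 0" "\<And>y. y \<noteq> 0 \<Longrightarrow> norm y < d \<Longrightarrow> 0 < e 0 * e y"
    unfolding eventually_at by auto
  define \<rho> where "\<rho> = min d R / 2"
  have \<rho>: "0 < \<rho>" "\<rho> < R" "\<rho> < d"
    using d R by (auto simp: \<rho>_def)
  have pos: "0 \<le> e 0 * e y" if "norm y \<le> \<rho>" for y
    using that d(2)[of y] \<rho> by (cases "y = 0") (auto simp: less_imp_le)
  \<comment> \<open>The square is the smallest power for which the truncated function has a
    continuous derivative.\<close>
  define H where "H t = max 0 (\<rho>\<^sup>2 - t) ^ Suc (Suc 0)" for t
  define H1 where "H1 t = - (real (Suc (Suc 0)) * max 0 (\<rho>\<^sup>2 - t) ^ Suc 0)" for t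
  have H: "(H has_real_derivative H1 t) (at t)" for t
    unfolding H_def[abs_def] H1_def by (rule has_real_derivative_max_diff_power)
  have cH1: "continuous_on UNIV H1"
    unfolding H1_def by (intro continuous_intros)
  have H0: "H t = 0" "H1 t = 0" if "t \<ge> \<rho>\<^sup>2" for t
    using that by (auto simp: H_def H1_def)
  note I = wronskian_identity[OF \<rho>(1,2) H cH1 H0]
  have "indicator {0<..} s * s ^ (DIM('a) - 1) * (2 * s * H1 (s\<^sup>2) * wronskian s) = 0" for s
  proof -
    consider "s \<le> 0" | "0 < s" "s < R" | "R \<le> s" by linarith
    then show ?thesis
    proof cases
      case 2
      \<comment> \<open>Differentiating the mean identity shows that \<open>smean\<close> is
        proportional to \<open>P (s\<^sup>2)\<close> together with its derivative, so the Wronskian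
        vanishes.\<close>
      have "((\<lambda>s. P (s\<^sup>2) * V 0) has_real_derivative P1 (s\<^sup>2) * (2 * s) * V 0) (at s)"
        by (rule DERIV_cmult_right, rule DERIV_chain2[OF P1]) (auto intro!: derivative_eq_intros)
      then have "(smean has_real_derivative P1 (s\<^sup>2) * (2 * s) * V 0) (at s)"
        by (rule has_field_derivative_transform_within_open[where S = "{0<..<R}"]) (use 2 mean in auto)
      moreover have "(smean has_real_derivative smean1 s) (at s)"
        by (rule smean_deriv) (use 2 in auto)
      ultimately have "smean1 s = P1 (s\<^sup>2) * (2 * s) * V 0"
        by (blast intro: DERIV_unique)
      then have "wronskian s = 0"
        using mean 2 by (simp add: wronskian_def)
      then show ?thesis by simp
    next
      case 3
      then have "\<rho>\<^sup>2 \<le> s\<^sup>2"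
        using \<rho> by (intro power_mono) auto
      then show ?thesis using H0 by simp
    qed simp
  qed
  then have "(LINT s|lborel. indicator {0<..} s * s ^ (DIM('a) - 1) * (2 * s * H1 (s\<^sup>2) * wronskian s)) = 0"
    by (simp only: Bochner_Integration.integral_zero)
  then have zero: "(LINT y|lborel. H (y \<bullet> y) * P (y \<bullet> y) * e y) = 0"
    using I(3) by (simp add: e_def)
  have "0 < (LINT y|lborel. e 0 * (H (y \<bullet> y) * P (y \<bullet> y) * e y))"
  proof (rule integral_pos_if_isCont)
    show "integrable lborel (\<lambda>y. e 0 * (H (y \<bullet> y) * P (y \<bullet> y) * e y))"
      using I(2) by (intro integrable_mult_right) (simp add: e_def)
    show "0 \<le> e 0 * (H (y \<bullet> y) * P (y \<bullet> y) * e y)" for y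
    proof (cases "norm y \<le> \<rho>")
      case True
      have "0 \<le> H (y \<bullet> y) * P (y \<bullet> y) * (e 0 * e y)"
        using P_pos[of "y \<bullet> y"]
        by (intro mult_nonneg_nonneg[OF mult_nonneg_nonneg pos[OF True]]) (auto simp: H_def less_imp_le)
      then show ?thesis by (simp add: mult_ac)
    next
      case False
      then have "\<rho>\<^sup>2 \<le> y \<bullet> y"
        using \<rho> by (simp add: dot_square_norm power_mono)
      then show ?thesis using H0 by simp
    qed
    have "isCont H 0" "isCont P 0"
      using H P1 DERIV_isCont by blast+
    then show "isCont (\<lambda>y. e 0 * (H (y \<bullet> y) * P (y \<bullet> y) * e y)) 0"
      using ic by (intro continuous_intros isCont_o2[where f = "\<lambda>y::'a. y \<bullet> y"]) auto
    have "0 < H 0 * P 0 * (e 0 * e 0)"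
      using \<rho> P_0 \<open>e 0 * e 0 > 0\<close> by (simp add: H_def del: zero_less_mult_iff)
    then show "0 < e 0 * (H (0 \<bullet> 0) * P (0 \<bullet> 0) * e 0)"
      by (simp add: mult_ac)
  qed
  then show False
    using zero by simp
qed

end

subsection \<open>The mean value property on spheres and mollification\<close>

text \<open>A ball is connected, so if it meets both \<open>D\<close> and its complement it meets
  the frontier. With an empty frontier the distance is infinite and every ball qualifies.\<close>

lemma ball_subset_if_dist_frontier:
  fixes x :: "'a::euclidean_space"
  assumes D: "x \<in> D" and R: "R > 0" "ereal R \<le> dist_to x (frontier D)"
  shows "ball x R \<subseteq> D"
proof (rule ccontr)
  assume "\<not> ball x R \<subseteq> D"
  moreover have "x \<in> ball x R \<inter> D"
    using D R(1) by simp
  ultimately have "ball x R \<inter> frontier D \<noteq> {}"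
    by (intro connected_Int_frontier) (blast intro: connected_ball)+
  then obtain y where y: "dist x y < R" "y \<in> frontier D" by auto
  have "dist_to x (frontier D) \<le> ereal (norm (x - y))"
    unfolding dist_to_def by (rule INF_lower[OF y(2)])
  then have "R \<le> norm (x - y)"
    using R(2) order_trans by fastforce
  then show False using y by (simp add: dist_norm)
qed

lemma dist_frontier_ge_if_ball_subset:
  fixes x :: "'a::euclidean_space"
  assumes "open D" "ball x R \<subseteq> D"
  shows "ereal R \<le> dist_to x (frontier D)"
  unfolding dist_to_def
proof (rule INF_greatest)
  fix y assume "y \<in> frontier D"
  then have "y \<notin> ball x R"
    using assms by (auto simp: frontier_def interior_open)
  then show "ereal R \<le> ereal (norm (x - y))"
    by (simp add: dist_norm)
qed

section \<open>Integration over a single sphere\<close>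

lemma measurable_sphere_map:
  fixes x :: "'a::euclidean_space"
  assumes "r > 0"
  shows "(\<lambda>z. x + r *\<^sub>R dir z) \<in> measurable unit_ball_measure (restrict_space borel (sphere x r))"
  by (rule measurable_restrict_space2) (use assms in \<open>auto simp: dist_norm\<close>)

lemma integral_sphere_continuous:
  fixes x :: "'a::euclidean_space" and g :: "'a \<Rightarrow> real"
  assumes r: "r > 0" and g: "continuous_on (sphere x r) g"
    and i: "integrable unit_ball_measure (\<lambda>z. g (x + r *\<^sub>R dir z))"
  shows "integrable (normalized_surface_measure x r) g"
    and "integral\<^sup>L (normalized_surface_measure x r) g = (LINT z|unit_ball_measure. g (x + r *\<^sub>R dir z))"
proof -
  let ?D = "distr unit_ball_measure (restrict_space borel (sphere x r)) (\<lambda>z. x + r *\<^sub>R dir z)"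
  have g[measurable]: "g \<in> borel_measurable (restrict_space borel (sphere x r))"
    by (rule borel_measurable_continuous_on_restrict[OF g])
  note m = measurable_sphere_map[OF r, of x]
  have "g \<in> borel_measurable ?D" by simp
  then show "integrable (normalized_surface_measure x r) g"
    and "integral\<^sup>L (normalized_surface_measure x r) g = (LINT z|unit_ball_measure. g (x + r *\<^sub>R dir z))"
    using i by (simp_all add: normalized_surface_measure_eq[OF r] integrable_completion integral_completion
        integrable_distr_eq[OF m g] integral_distr[OF m g])
qed

text \<open>\<open>g\<close> is measurable only for the completed sphere measure and may be composed
  with the sphere map only after it is replaced by the Borel function \<open>g'\<close>; the
  exceptional set costs nothing on spheres that meet \<open>N\<close> in a null set.\<close>

lemma integral_sphere_AE:
  fixes x :: "'a::euclidean_space" and g g' :: "'a \<Rightarrow> real"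
  assumes r: "r > 0" and g: "g \<in> borel_measurable (normalized_surface_measure x r)"
    and g'[measurable]: "g' \<in> borel_measurable borel"
    and N[measurable]: "N \<in> sets borel" and AE: "AE z in unit_ball_measure. x + r *\<^sub>R dir z \<notin> N"
    and eq: "\<And>y. y \<in> sphere x r \<Longrightarrow> y \<notin> N \<Longrightarrow> g y = g' y"
  shows "integral\<^sup>L (normalized_surface_measure x r) g = (LINT z|unit_ball_measure. g' (x + r *\<^sub>R dir z))"
proof -
  let ?D = "distr unit_ball_measure (restrict_space borel (sphere x r)) (\<lambda>z. x + r *\<^sub>R dir z)"
  note m = measurable_sphere_map[OF r, of x]
  have g'r: "g' \<in> borel_measurable (restrict_space borel (sphere x r))"
    by (rule measurable_restrict_space1) measurable
  have "AE y in ?D. y \<notin> N"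
    using AE by (subst AE_distr_iff[OF m]) (auto simp: sets_restrict_space)
  then have "AE y in completion ?D. y \<notin> N"
    by (rule AE_completion)
  then have "AE y in completion ?D. g y = g' y"
    by (rule AE_mp) (intro AE_I2 impI eq, auto simp: space_restrict_space)
  then have "integral\<^sup>L (completion ?D) g = integral\<^sup>L (completion ?D) g'"
    using g g'r by (intro integral_cong_AE) (auto simp: normalized_surface_measure_eq[OF r] intro!: measurable_completion)
  also have "\<dots> = (LINT z|unit_ball_measure. g' (x + r *\<^sub>R dir z))"
    using g'r by (subst integral_completion) (auto simp: integral_distr[OF m g'r])
  finally show ?thesis
    by (simp add: normalized_surface_measure_eq[OF r])
qed

section \<open>Convolution with a compactly supported kernel\<close>

lemma integrable_mult_bounded_continuous:
  fixes w k :: "'a::euclidean_space \<Rightarrow> real"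
  assumes w: "integrable lborel w" and k: "continuous_on UNIV k" and C: "\<And>y. \<bar>k y\<bar> \<le> C"
  shows "integrable lborel (\<lambda>y. w y * k (x - y))"
proof (rule Bochner_Integration.integrable_bound[where f = "\<lambda>y. C * w y"])
  have [measurable]: "w \<in> borel_measurable borel" using w by auto
  have [measurable]: "k \<in> borel_measurable borel"
    using k by (rule borel_measurable_continuous_onI)
  show "(\<lambda>y. w y * k (x - y)) \<in> borel_measurable lborel"
    by measurable
  show "AE y in lborel. norm (w y * k (x - y)) \<le> norm (C * w y)"
  proof (rule AE_I2)
    fix y
    have "\<bar>w y\<bar> * \<bar>k (x - y)\<bar> \<le> \<bar>w y\<bar> * C"
      using C by (intro mult_left_mono) auto
    moreover have "C \<ge> 0" using C[of 0] by linarith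
    ultimately show "norm (w y * k (x - y)) \<le> norm (C * w y)"
      by (simp add: abs_mult mult.commute)
  qed
qed (use w in simp)

lemma convolution_continuous:
  fixes w k :: "'a::euclidean_space \<Rightarrow> real"
  assumes w: "integrable lborel w" and k: "continuous_on UNIV k" and C: "\<And>y. \<bar>k y\<bar> \<le> C"
  shows "continuous_on S (\<lambda>x. LINT y|lborel. w y * k (x - y))"
proof (rule continuous_on_integral_param[where B = "\<lambda>y. C * \<bar>w y\<bar>"])
  show "(\<lambda>y. w y * k (x - y)) \<in> borel_measurable lborel" for x
    using integrable_mult_bounded_continuous[OF w k C, of x] by auto
  show "continuous_on S (\<lambda>x. w y * k (x - y))" for y
    by (intro continuous_intros continuous_on_compose2[OF k]) auto
  show "\<bar>w y * k (x - y)\<bar> \<le> C * \<bar>w y\<bar>" for x y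
  proof -
    have "\<bar>w y\<bar> * \<bar>k (x - y)\<bar> \<le> \<bar>w y\<bar> * C"
      using C by (intro mult_left_mono) auto
    then show ?thesis by (simp add: abs_mult mult.commute)
  qed
qed (use w in auto)

lemma convolution_partial_derivative:
  fixes w k k1 :: "'a::euclidean_space \<Rightarrow> real"
  assumes w: "integrable lborel w" and k: "continuous_on UNIV k" and C: "\<And>y. \<bar>k y\<bar> \<le> C"
    and k1: "\<And>y. ((\<lambda>t. k (y + t *\<^sub>R i)) has_real_derivative k1 y) (at 0)" and C1: "\<And>y. \<bar>k1 y\<bar> \<le> C1"
  shows "((\<lambda>t. LINT y|lborel. w y * k ((x + t *\<^sub>R i) - y)) has_real_derivative (LINT y|lborel. w y * k1 (x - y))) (at 0)"
proof -
  have "((\<lambda>t. LINT y|lborel. w y * k ((x + t *\<^sub>R i) - y)) has_real_derivative (LINT y|lborel. w y * k1 (x + 0 *\<^sub>R i - y))) (at 0)"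
  proof (rule has_real_derivative_integral(2)[where U = UNIV and B = "\<lambda>y. C1 * \<bar>w y\<bar>"
        and G' = "\<lambda>t y. w y * k1 (x + t *\<^sub>R i - y)"])
    show "integrable lborel (\<lambda>y. w y * k ((x + t *\<^sub>R i) - y))" for t
      by (rule integrable_mult_bounded_continuous[OF w k C])
    fix t y
    have e: "(x + t *\<^sub>R i) - y = (x - y) + t *\<^sub>R i" for t
      by simp
    show "((\<lambda>t. w y * k ((x + t *\<^sub>R i) - y)) has_real_derivative w y * k1 (x + t *\<^sub>R i - y)) (at t)"
      unfolding e by (rule DERIV_cmult, rule has_real_derivative_line_shift, rule k1)
    have "\<bar>w y\<bar> * \<bar>k1 (x + t *\<^sub>R i - y)\<bar> \<le> \<bar>w y\<bar> * C1"
      using C1 by (intro mult_left_mono) auto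
    then show "\<bar>w y * k1 (x + t *\<^sub>R i - y)\<bar> \<le> C1 * \<bar>w y\<bar>"
      by (simp add: abs_mult mult.commute)
  qed (use w in auto)
  then show ?thesis by simp
qed

lemma bounded_if_bounded_support:
  fixes g :: "'a::euclidean_space \<Rightarrow> real"
  assumes g: "continuous_on UNIV g" and z: "\<And>y. norm y \<ge> r \<Longrightarrow> g y = 0"
  obtains C where "\<And>y. \<bar>g y\<bar> \<le> C"
proof -
  have "compact (g ` cball 0 r)"
    using g by (intro compact_continuous_image) (auto intro: continuous_on_subset)
  then have "bounded (g ` cball 0 r)"
    by (rule compact_imp_bounded)
  then obtain C where C: "\<And>y. y \<in> cball 0 r \<Longrightarrow> \<bar>g y\<bar> \<le> C"
    unfolding bounded_iff by (metis imageI real_norm_def)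
  have "\<bar>g y\<bar> \<le> max C 0" for y
    using C[of y] z[of y] by (cases "norm y \<ge> r") auto
  then show thesis by (rule that)
qed

text \<open>All derivatives fall on the kernel, so integrability of \<open>w\<close> suffices. The
  third power is the smallest whose truncation is twice continuously differentiable.\<close>

lemma Ck_on_2_convolution:
  fixes w :: "'a::euclidean_space \<Rightarrow> real"
  assumes w: "integrable lborel w" and S: "open S"
  shows "Ck_on 2 S (\<lambda>x. LINT y|lborel. w y * max 0 (e\<^sup>2 - (x - y) \<bullet> (x - y)) ^ 3)"
proof -
  define h where "h t = max 0 (e\<^sup>2 - t) ^ Suc (Suc (Suc 0))" for t
  define h1 where "h1 t = - (real (Suc (Suc (Suc 0))) * max 0 (e\<^sup>2 - t) ^ Suc (Suc 0))" for t
  define h2 where "h2 t = real (Suc (Suc (Suc 0))) * (real (Suc (Suc 0)) * max 0 (e\<^sup>2 - t) ^ Suc 0)" for t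
  have dh: "(h has_real_derivative h1 t) (at t)" for t
    unfolding h_def[abs_def] h1_def by (rule has_real_derivative_max_diff_power)
  have dh1: "(h1 has_real_derivative h2 t) (at t)" for t
    unfolding h1_def[abs_def] h2_def
    using DERIV_minus[OF DERIV_cmult[OF has_real_derivative_max_diff_power[of "e\<^sup>2" 0 t], of "real (Suc (Suc (Suc 0)))"]]
    by (simp only: minus_minus mult_minus_right)
  define k where "k y = h (y \<bullet> y)" for y :: 'a
  define k1 where "k1 i y = h1 (y \<bullet> y) * (2 * (y \<bullet> i))" for i y :: 'a
  define k2 where "k2 i j y = h2 (y \<bullet> y) * (2 * (y \<bullet> j)) * (2 * (y \<bullet> i)) + h1 (y \<bullet> y) * (2 * (j \<bullet> i))" for i j y :: 'a
  have z: "k y = 0" "k1 i y = 0" "k2 i j y = 0" if "norm y \<ge> \<bar>e\<bar>" for i j y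
  proof -
    have "e\<^sup>2 \<le> y \<bullet> y"
      using that power_mono[of "\<bar>e\<bar>" "norm y" 2] by (simp add: dot_square_norm)
    then show "k y = 0" "k1 i y = 0" "k2 i j y = 0"
      by (simp_all add: k_def k1_def k2_def h_def h1_def h2_def)
  qed
  have c: "continuous_on UNIV k" "continuous_on UNIV (k1 i)" "continuous_on UNIV (k2 i j)" for i j
    unfolding k_def k1_def[abs_def] k2_def[abs_def] h_def h1_def h2_def by (intro continuous_intros)+
  obtain C0 where C0: "\<And>y. \<bar>k y\<bar> \<le> C0"
    using bounded_if_bounded_support[OF c(1) z(1)] by blast
  have "\<exists>C. \<forall>y. \<bar>k1 i y\<bar> \<le> C" for i
    using bounded_if_bounded_support[OF c(2) z(2)] by metis
  then obtain C1 where C1: "\<And>i y. \<bar>k1 i y\<bar> \<le> C1 i" by metis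
  have "\<exists>C. \<forall>y. \<bar>k2 i j y\<bar> \<le> C" for i j
    using bounded_if_bounded_support[OF c(3) z(3)] by metis
  then obtain C2 where C2: "\<And>i j y. \<bar>k2 i j y\<bar> \<le> C2 i j" by metis
  have dk: "((\<lambda>t. k (y + t *\<^sub>R i)) has_real_derivative k1 i y) (at 0)" for y i
    unfolding k_def k1_def using DERIV_chain2[OF dh has_real_derivative_inner_self_line[of y i]] by simp
  have dk1: "((\<lambda>t. k1 i (y + t *\<^sub>R j)) has_real_derivative k2 i j y) (at 0)" for y i j
  proof -
    have 1: "((\<lambda>t. h1 ((y + t *\<^sub>R j) \<bullet> (y + t *\<^sub>R j))) has_real_derivative h2 (y \<bullet> y) * (2 * (y \<bullet> j))) (at 0)"
      using DERIV_chain2[OF dh1 has_real_derivative_inner_self_line[of y j]] by simp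
    have "(y + t *\<^sub>R j) \<bullet> i = y \<bullet> i + t * (j \<bullet> i)" for t
      by (simp add: inner_add_left)
    then have 2: "((\<lambda>t. (y + t *\<^sub>R j) \<bullet> i) has_real_derivative j \<bullet> i) (at 0)"
      by (auto intro!: derivative_eq_intros)
    show ?thesis
      unfolding k1_def by (rule derivative_eq_intros 1 2 refl)+ (simp add: k2_def)
  qed
  have eq: "max 0 (e\<^sup>2 - (x - y) \<bullet> (x - y)) ^ 3 = k (x - y)" for x y :: 'a
    by (simp add: k_def h_def numeral_3_eq_3)
  show ?thesis
    unfolding eq
  proof (rule Ck_on_2I(1)[where ?f1.0 = "\<lambda>i x. LINT y|lborel. w y * k1 i (x - y)"
        and ?f2.0 = "\<lambda>i j x. LINT y|lborel. w y * k2 i j (x - y)", OF S])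
    show "continuous_on S (\<lambda>x. LINT y|lborel. w y * k (x - y))"
      by (rule convolution_continuous[OF w c(1) C0])
    show "continuous_on S (\<lambda>x. LINT y|lborel. w y * k1 i (x - y))" for i
      by (rule convolution_continuous[OF w c(2) C1])
    show "continuous_on S (\<lambda>x. LINT y|lborel. w y * k2 i j (x - y))" for i j
      by (rule convolution_continuous[OF w c(3) C2])
    show "((\<lambda>t. LINT y|lborel. w y * k ((x + t *\<^sub>R i) - y)) has_real_derivative (LINT y|lborel. w y * k1 i (x - y))) (at 0)" for i x
      by (rule convolution_partial_derivative[OF w c(1) C0 dk C1])
    show "((\<lambda>t. LINT y|lborel. w y * k1 i ((x + t *\<^sub>R j) - y)) has_real_derivative (LINT y|lborel. w y * k2 i j (x - y))) (at 0)" for i j x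
      by (rule convolution_partial_derivative[OF w c(2) C1 dk1 C2])
  qed
qed

section \<open>Spherical means and the Helmholtz equation\<close>

lemma radial_comparison_hyp01:
  fixes v :: "'a::euclidean_space \<Rightarrow> real"
  assumes v: "Ck_on 2 D v" and R: "R > 0" and sub: "ball x R \<subseteq> D" and L: "L \<ge> 0"
  shows "radial_comparison (\<lambda>y. v (x + y)) (\<lambda>i y. partial_deriv i v (x + y))
    (\<lambda>i y. partial_deriv i (partial_deriv i v) (x + y)) R
    (\<lambda>t. hyp01 (real DIM('a) / 2) (L * t))
    (\<lambda>t. L * (hyp01 (real DIM('a) / 2 + 1) (L * t) / (real DIM('a) / 2)))
    (\<lambda>t. L * (L * (hyp01 (real DIM('a) / 2 + 1 + 1) (L * t) / (real DIM('a) / 2 + 1)) / (real DIM('a) / 2)))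
    (4 * L)"
proof -
  let ?d = "real DIM('a) / 2"
  note C = Ck_on_2D[OF v]
  have d: "?d > 0" by simp
  have inD: "x + y \<in> D" if "y \<in> ball 0 R" for y
  proof -
    have "x + y \<in> ball x R" using that by (simp add: dist_norm)
    then show ?thesis using sub by blast
  qed
  have cc: "continuous_on (ball 0 R) (\<lambda>y. f (x + y))" if "continuous_on D f" for f :: "'a \<Rightarrow> real"
    by (intro continuous_on_compose2[OF that] continuous_intros) (use sub in auto)
  have dh: "((\<lambda>t. hyp01 w (L * t)) has_real_derivative L * (hyp01 (w + 1) (L * t) / w)) (at t)" if "w > 0" for w t
  proof -
    have "((\<lambda>t. L * t) has_real_derivative L) (at t)"
      by (auto intro!: derivative_eq_intros)
    from DERIV_chain2[OF hyp01_deriv[OF that] this] show ?thesis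
      by (simp add: mult.commute)
  qed
  show ?thesis
  proof unfold_locales
    show "((\<lambda>t. v (x + (y + t *\<^sub>R i))) has_real_derivative partial_deriv i v (x + y)) (at 0)"
      if "i \<in> Basis" "y \<in> ball 0 R" for i y
      using C(4)[OF that(1) inD[OF that(2)]] by (simp add: add.assoc)
    show "((\<lambda>t. partial_deriv i v (x + (y + t *\<^sub>R i))) has_real_derivative partial_deriv i (partial_deriv i v) (x + y)) (at 0)"
      if "i \<in> Basis" "y \<in> ball 0 R" for i y
      using C(5)[OF that(1,1) inD[OF that(2)]] by (simp add: add.assoc)
    show "((\<lambda>t. hyp01 ?d (L * t)) has_real_derivative L * (hyp01 (?d + 1) (L * t) / ?d)) (at t)" for t
      by (rule dh[OF d])
    show "((\<lambda>t. L * (hyp01 (?d + 1) (L * t) / ?d)) has_real_derivative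
        L * (L * (hyp01 (?d + 1 + 1) (L * t) / (?d + 1)) / ?d)) (at t)" for t
      by (rule DERIV_cmult, rule DERIV_cdivide, rule dh) (use d in linarith)
    have "continuous_on UNIV (\<lambda>t. hyp01 (?d + 1 + 1) (L * t))"
      using d by (intro continuous_at_imp_continuous_on ballI DERIV_isCont[OF dh]) linarith
    then show "continuous_on UNIV (\<lambda>t. L * (L * (hyp01 (?d + 1 + 1) (L * t) / (?d + 1)) / ?d))"
      using d by (intro continuous_intros) auto
    \<comment> \<open>For \<open>P(t) = F(L t)\<close> the left side is \<open>4 L\<close> times
      \<open>(L t) F'' + (d / 2) F'\<close> at \<open>L t\<close>, hence \<open>4 L F\<close> by the
      equation of \<open>F = hyp01 (d / 2)\<close>. This fixes the coefficient
      \<open>4 * L\<close>.\<close>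
    show "4 * t * (L * (L * (hyp01 (?d + 1 + 1) (L * t) / (?d + 1)) / ?d)) +
        2 * real DIM('a) * (L * (hyp01 (?d + 1) (L * t) / ?d)) = 4 * L * hyp01 ?d (L * t)" for t
    proof -
      have 1: "2 * real DIM('a) * (L * (hyp01 (?d + 1) (L * t) / ?d)) = 4 * L * hyp01 (?d + 1) (L * t)"
        using d by (simp add: field_simps)
      have 2: "4 * t * (L * (L * (hyp01 (?d + 1 + 1) (L * t) / (?d + 1)) / ?d)) =
          4 * L * (L * t * hyp01 (?d + 2) (L * t) / (?d * (?d + 1)))"
        by (simp add: mult_ac add.assoc)
      show ?thesis
        unfolding 1 2 using hyp01_contiguous[OF d, of "L * t"] by (metis distrib_left)
    qed
    show "0 < hyp01 ?d (L * t)" if "0 \<le> t" for t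
      using that L d by (intro hyp01_pos) auto
  qed (use R C cc in auto)
qed

lemma spherical_mean_if_helmholtz:
  fixes v :: "'a::euclidean_space \<Rightarrow> real"
  assumes v: "Ck_on 2 D v" and sub: "ball x R \<subseteq> D" and L: "L \<ge> 0" and s: "0 < s" "s < R"
    and pde: "\<And>y. y \<in> D \<Longrightarrow> laplacian v y = 4 * L * v y"
  shows "integrable unit_ball_measure (\<lambda>z. v (x + s *\<^sub>R dir z))"
    and "(LINT z|unit_ball_measure. v (x + s *\<^sub>R dir z)) = hyp01 (real DIM('a) / 2) (L * s\<^sup>2) * v x"
proof -
  have R: "R > 0" using s by linarith
  interpret radial_comparison "\<lambda>y. v (x + y)" "\<lambda>i y. partial_deriv i v (x + y)"
    "\<lambda>i y. partial_deriv i (partial_deriv i v) (x + y)" R "\<lambda>t. hyp01 (real DIM('a) / 2) (L * t)"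
    "\<lambda>t. L * (hyp01 (real DIM('a) / 2 + 1) (L * t) / (real DIM('a) / 2))"
    "\<lambda>t. L * (L * (hyp01 (real DIM('a) / 2 + 1 + 1) (L * t) / (real DIM('a) / 2 + 1)) / (real DIM('a) / 2))" "4 * L"
    by (rule radial_comparison_hyp01[OF v R sub L])
  show "integrable unit_ball_measure (\<lambda>z. v (x + s *\<^sub>R dir z))"
    using integrable_on_sphere[OF cont_V, of s] s by simp
  have "smean s = hyp01 (real DIM('a) / 2) (L * s\<^sup>2) * v (x + 0)"
  proof (rule smean_eq_if_pde[OF _ s])
    fix y :: 'a assume "y \<in> ball 0 R"
    then have "x + y \<in> ball x R" by (simp add: dist_norm)
    then have "x + y \<in> D" using sub by blast
    from pde[OF this] show "(\<Sum>i\<in>Basis. partial_deriv i (partial_deriv i v) (x + y)) = 4 * L * v (x + y)"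
      by (simp add: laplacian_def)
  qed
  then show "(LINT z|unit_ball_measure. v (x + s *\<^sub>R dir z)) = hyp01 (real DIM('a) / 2) (L * s\<^sup>2) * v x"
    by (simp add: smean_def)
qed

lemma helmholtz_if_spherical_mean:
  fixes v :: "'a::euclidean_space \<Rightarrow> real"
  assumes v: "Ck_on 2 D v" and R: "R > 0" and sub: "ball x R \<subseteq> D" and L: "L \<ge> 0"
    and mean: "\<And>s. 0 < s \<Longrightarrow> s < R \<Longrightarrow>
      (LINT z|unit_ball_measure. v (x + s *\<^sub>R dir z)) = hyp01 (real DIM('a) / 2) (L * s\<^sup>2) * v x"
  shows "laplacian v x = 4 * L * v x"
proof -
  interpret radial_comparison "\<lambda>y. v (x + y)" "\<lambda>i y. partial_deriv i v (x + y)"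
    "\<lambda>i y. partial_deriv i (partial_deriv i v) (x + y)" R "\<lambda>t. hyp01 (real DIM('a) / 2) (L * t)"
    "\<lambda>t. L * (hyp01 (real DIM('a) / 2 + 1) (L * t) / (real DIM('a) / 2))"
    "\<lambda>t. L * (L * (hyp01 (real DIM('a) / 2 + 1 + 1) (L * t) / (real DIM('a) / 2 + 1)) / (real DIM('a) / 2))" "4 * L"
    by (rule radial_comparison_hyp01[OF v R sub L])
  have "(\<Sum>i\<in>Basis. partial_deriv i (partial_deriv i v) (x + 0)) = 4 * L * v (x + 0)"
    by (rule pde_if_smean_eq) (simp add: smean_def mean)
  then show ?thesis
    by (simp add: laplacian_def)
qed

text \<open>
  Averaging the mean value identity over the radii against the bump \<open>(e\<^sup>2 - s\<^sup>2)\<^sub>+\<^sup>3\<close> writes \<open>v\<close>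
  near \<open>x0\<close> as a convolution with a \<open>C\<^sup>2\<close> kernel. The Borel function \<open>w\<close> stands in for \<open>v\<close>, which
  is only known to be Lebesgue measurable.
\<close>

lemma Ck_on_2_if_spherical_mean:
  fixes v w :: "'a::euclidean_space \<Rightarrow> real"
  assumes e: "e > 0" and L: "L \<ge> 0" and w: "integrable lborel w"
    and N: "N \<in> null_sets lborel"
    and mean: "\<And>x s. x \<in> ball x0 e \<Longrightarrow> 0 < s \<Longrightarrow> s < e \<Longrightarrow>
      (AE z in unit_ball_measure. x + s *\<^sub>R dir z \<notin> N) \<Longrightarrow>
      (LINT z|unit_ball_measure. w (x + s *\<^sub>R dir z)) = hyp01 (real DIM('a) / 2) (L * s\<^sup>2) * v x"
  shows "Ck_on 2 (ball x0 e) v"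
proof -
  let ?P = "\<lambda>t. hyp01 (real DIM('a) / 2) (L * t)"
  define h where "h t = max 0 (e\<^sup>2 - t) ^ 3" for t
  \<comment> \<open>The factor by which averaging multiplies \<open>v x\<close>. It does not depend
    on the centre and is positive, so \<open>v\<close> itself can be recovered.\<close>
  define C where "C = (LINT y|lborel. h (y \<bullet> y) * ?P (y \<bullet> (y::'a)))"
  have d: "real DIM('a) / 2 > 0" by simp
  have [measurable]: "w \<in> borel_measurable borel" using w by auto
  have cP: "continuous_on UNIV (\<lambda>y::'a. ?P (y \<bullet> y))"
  proof (rule continuous_on_compose2[where s = UNIV and t = UNIV and g = "hyp01 (real DIM('a) / 2)"])
    show "continuous_on UNIV (hyp01 (real DIM('a) / 2))"
      using DERIV_isCont[OF hyp01_deriv[OF d]] by (simp add: continuous_at_imp_continuous_on)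
  qed (auto intro!: continuous_intros)
  have ch: "continuous_on UNIV (\<lambda>y::'a. h (y \<bullet> y))"
    unfolding h_def by (intro continuous_intros)
  have h0: "h (y \<bullet> y) = 0" if "norm y \<ge> e" for y :: 'a
    using that e power_mono[of e "norm y" 2] by (simp add: h_def dot_square_norm)
  have cont: "continuous_on UNIV (\<lambda>y::'a. h (y \<bullet> y) * ?P (y \<bullet> y))"
    by (intro continuous_intros ch cP)
  have int: "integrable lborel (\<lambda>y::'a. h (y \<bullet> y) * ?P (y \<bullet> y))"
    by (rule integrable_bounded_support[OF cont, of e]) (simp add: h0)
  have C: "C > 0"
    unfolding C_def
  proof (rule integral_pos_if_isCont[OF int, where p = 0])
    show "0 \<le> h (y \<bullet> y) * ?P (y \<bullet> y)" for y :: 'a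
      using hyp01_pos[OF d, of "L * (y \<bullet> y)"] L by (simp add: h_def)
    show "isCont (\<lambda>y::'a. h (y \<bullet> y) * ?P (y \<bullet> y)) 0"
      using cont by (simp add: continuous_on_eq_continuous_at)
  qed (use e in \<open>simp add: h_def\<close>)
  have dd: "(s *\<^sub>R dir z) \<bullet> (s *\<^sub>R dir (z::'a)) = s\<^sup>2" for s z
    using dot_square_norm[of "dir z"] by (simp add: power2_eq_square)
  have rep: "v x = (LINT y|lborel. w y * max 0 (e\<^sup>2 - (x - y) \<bullet> (x - y)) ^ 3) / C" if x: "x \<in> ball x0 e" for x
  proof -
    have l: "lborel = distr lborel borel ((+) x)"
      by (simp add: lborel_distr_plus)
    obtain B where B: "\<And>y::'a. \<bar>h (y \<bullet> y)\<bar> \<le> B"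
      using bounded_if_bounded_support[OF ch h0] by blast
    have i0: "integrable lborel (\<lambda>y. w y * h ((x - y) \<bullet> (x - y)))"
      by (rule integrable_mult_bounded_continuous[OF w ch B])
    have [measurable]: "(\<lambda>y. w y * h ((x - y) \<bullet> (x - y))) \<in> borel_measurable borel"
      using i0 by auto
    have i1: "integrable lborel (\<lambda>y. w (x + y) * h (y \<bullet> y))"
      using i0 by (subst (asm) l) (simp add: integrable_distr_eq)
    have "(LINT y|lborel. w y * h ((x - y) \<bullet> (x - y))) = (LINT y|lborel. w (x + y) * h (y \<bullet> y))"
      by (subst l) (simp add: integral_distr)
    also have "\<dots> = radial_const TYPE('a) * (LINT s|lborel. indicator {0<..} s * s ^ (DIM('a) - 1) *
        (LINT z|unit_ball_measure. w (x + s *\<^sub>R dir z) * h ((s *\<^sub>R dir z) \<bullet> (s *\<^sub>R dir (z::'a)))))"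
      by (rule integral_polar(2)[OF i1])
    \<comment> \<open>The integrand on the right is constant in \<open>z\<close>; it is kept under
      the integral so that the result is literally the polar form of \<open>C\<close>.\<close>
    also have "(LINT s|lborel. indicator {0<..} s * s ^ (DIM('a) - 1) *
        (LINT z|unit_ball_measure. w (x + s *\<^sub>R dir z) * h ((s *\<^sub>R dir z) \<bullet> (s *\<^sub>R dir (z::'a))))) =
      (LINT s|lborel. v x * (indicator {0<..} s * s ^ (DIM('a) - 1) *
        (LINT z|unit_ball_measure. h ((s *\<^sub>R dir z) \<bullet> (s *\<^sub>R dir (z::'a))) * ?P ((s *\<^sub>R dir z) \<bullet> (s *\<^sub>R dir (z::'a))))))"
      unfolding dd
    proof (rule integral_cong_AE)
      have [measurable]: "N \<in> sets borel" using N by auto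
      \<comment> \<open>\<open>AE_polar\<close> concerns spheres around the origin, so
        \<open>N\<close> is translated by the centre \<open>x\<close>. For almost every radius the
        sphere around \<open>x\<close> then avoids \<open>N\<close> almost everywhere, as
        \<open>mean\<close> requires.\<close>
      have "emeasure lborel {y. x + y \<in> N} = emeasure lborel N"
        using emeasure_lborel_affine_vimage[of 1 N x] by simp
      then have "{y. x + y \<in> N} \<in> null_sets lborel"
        using N by (auto simp: null_sets_def)
      then have "AE y in lborel. x + y \<notin> N"
        by (rule AE_I') auto
      from AE_polar[OF this]
      show "AE s in lborel. indicator {0<..} s * s ^ (DIM('a) - 1) * (LINT z|unit_ball_measure. w (x + s *\<^sub>R dir z) * h (s\<^sup>2)) =
        v x * (indicator {0<..} s * s ^ (DIM('a) - 1) * (LINT z|(unit_ball_measure :: 'a measure). h (s\<^sup>2) * ?P (s\<^sup>2)))"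
      proof eventually_elim
        fix s assume AE: "0 < s \<longrightarrow> (AE z in unit_ball_measure. x + s *\<^sub>R dir z \<notin> N)"
        \<comment> \<open>The identity is known only for \<open>s < e\<close>; beyond that the bump
          vanishes.\<close>
        consider "s \<le> 0" | "0 < s" "s < e" | "e \<le> s" by linarith
        then show "indicator {0<..} s * s ^ (DIM('a) - 1) * (LINT z|unit_ball_measure. w (x + s *\<^sub>R dir z) * h (s\<^sup>2)) =
        v x * (indicator {0<..} s * s ^ (DIM('a) - 1) * (LINT z|(unit_ball_measure :: 'a measure). h (s\<^sup>2) * ?P (s\<^sup>2)))"
        proof cases
          case 2
          then show ?thesis
            using mean[OF x 2] AE by (simp add: mult_ac)
        next
          case 3
          then have "h (s\<^sup>2) = 0"
            using e power_mono[of e s 2] by (simp add: h_def)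
          then show ?thesis by simp
        qed simp
      qed
      show "(\<lambda>s. indicator {0<..} s * s ^ (DIM('a) - 1) * (LINT z|unit_ball_measure. w (x + s *\<^sub>R dir z) * h (s\<^sup>2))) \<in> borel_measurable lborel"
        unfolding h_def by measurable
      have [measurable]: "hyp01 (real DIM('a) / 2) \<in> borel_measurable borel"
        using DERIV_isCont[OF hyp01_deriv[OF d]]
        by (intro borel_measurable_continuous_onI) (simp add: continuous_at_imp_continuous_on)
      show "(\<lambda>s. v x * (indicator {0<..} s * s ^ (DIM('a) - 1) * (LINT z|(unit_ball_measure :: 'a measure). h (s\<^sup>2) * ?P (s\<^sup>2)))) \<in> borel_measurable lborel"
        unfolding h_def by measurable
    qed
    also have "radial_const TYPE('a) * \<dots> = v x * C"
      unfolding C_def integral_polar(2)[OF int] by simp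
    finally show ?thesis
      using C by (simp add: h_def)
  qed
  \<comment> \<open>\<open>1 / C\<close> is absorbed into \<open>w\<close>, so that \<open>v\<close>
    equals a convolution on the ball.\<close>
  have conv: "Ck_on 2 (ball x0 e) (\<lambda>x. LINT y|lborel. (w y / C) * max 0 (e\<^sup>2 - (x - y) \<bullet> (x - y)) ^ 3)"
    using w by (intro Ck_on_2_convolution) auto
  have eq: "v x = (LINT y|lborel. (w y / C) * max 0 (e\<^sup>2 - (x - y) \<bullet> (x - y)) ^ 3)" if "x \<in> ball x0 e" for x
    using rep[OF that] by simp
  note D = Ck_on_2D[OF conv]
  let ?J = "\<lambda>x. LINT y|lborel. (w y / C) * max 0 (e\<^sup>2 - (x - y) \<bullet> (x - y)) ^ 3"
  show ?thesis
  proof (rule Ck_on_2I(1)[where ?f1.0 = "\<lambda>i. partial_deriv i ?J" and ?f2.0 = "\<lambda>i j. partial_deriv j (partial_deriv i ?J)"])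
    show "continuous_on (ball x0 e) v"
      by (rule continuous_on_eq[OF D(1)]) (rule eq[symmetric])
    show "((\<lambda>t. v (x + t *\<^sub>R i)) has_real_derivative partial_deriv i ?J x) (at 0)"
      if "i \<in> Basis" "x \<in> ball x0 e" for i x
      by (rule has_real_derivative_line_cong[OF open_ball that(2) eq D(4)[OF that]])
    show "continuous_on (ball x0 e) (partial_deriv i ?J)" if "i \<in> Basis" for i
      by (rule D(2)[OF that])
    show "continuous_on (ball x0 e) (partial_deriv j (partial_deriv i ?J))" if "i \<in> Basis" "j \<in> Basis" for i j
      by (rule D(3)[OF that])
    show "((\<lambda>t. partial_deriv i ?J (x + t *\<^sub>R j)) has_real_derivative partial_deriv j (partial_deriv i ?J) x) (at 0)"
      if "i \<in> Basis" "j \<in> Basis" "x \<in> ball x0 e" for i j x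
      by (rule D(5)[OF that])
  qed simp
qed

section \<open>Removing the drift\<close>

lemma twisted_harmonic_iff:
  fixes u :: "'a::euclidean_space \<Rightarrow> real"
  assumes a: "a > 0" and D: "open D" and u: "Ck_on 2 D u" and x: "x \<in> D"
  shows "drift_laplacian a b u x = 0 \<longleftrightarrow>
    laplacian (\<lambda>y. u y * exp ((b /\<^sub>R (2 * a)) \<bullet> y)) x = (norm b / (2 * a))\<^sup>2 * (u x * exp ((b /\<^sub>R (2 * a)) \<bullet> x))"
proof -
  let ?c = "b /\<^sub>R (2 * a)"
  have "laplacian (\<lambda>y. u y * exp (?c \<bullet> y)) x =
      (laplacian u x + 2 * (?c \<bullet> gradient u x) + (?c \<bullet> ?c) * u x) * exp (?c \<bullet> x)"
    by (rule Ck_on_2_mult_exp(2)[OF D u x])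
  also have "?c \<bullet> ?c = (norm b / (2 * a))\<^sup>2"
    by (simp add: dot_square_norm power_divide field_simps power2_eq_square)
  \<comment> \<open>Here \<open>2 * ?c = b / a\<close> is used: the cross term is the drift divided
    by \<open>a\<close>.\<close>
  also have "laplacian u x + 2 * (?c \<bullet> gradient u x) = drift_laplacian a b u x / a"
    using a by (simp add: drift_laplacian_def field_simps)
  finally have eq: "laplacian (\<lambda>y. u y * exp (?c \<bullet> y)) x =
    drift_laplacian a b u x / a * exp (?c \<bullet> x) + (norm b / (2 * a))\<^sup>2 * (u x * exp (?c \<bullet> x))"
    by (simp only: distrib_right mult.assoc)
  show ?thesis
    unfolding eq using a by simp
qed

lemma Ck_on_2_mult_exp_iff:
  fixes u :: "'a::euclidean_space \<Rightarrow> real"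
  assumes D: "open D"
  shows "Ck_on 2 D (\<lambda>y. u y * exp (c \<bullet> y)) \<longleftrightarrow> Ck_on 2 D u"
proof
  assume "Ck_on 2 D (\<lambda>y. u y * exp (c \<bullet> y))"
  then have "Ck_on 2 D (\<lambda>y. (u y * exp (c \<bullet> y)) * exp ((- c) \<bullet> y))"
    by (rule Ck_on_2_mult_exp(1)[OF D])
  then show "Ck_on 2 D u"
    by (simp add: exp_minus mult.assoc)
qed (rule Ck_on_2_mult_exp(1)[OF D])

lemma locally_integrable_if_continuous:
  fixes u :: "'a::euclidean_space \<Rightarrow> real"
  assumes "continuous_on D u"
  shows "locally_integrable_on D u"
  unfolding locally_integrable_on_def
proof (intro allI impI, elim conjE)
  fix K assume K: "compact K" "K \<subseteq> D"
  have "integrable lborel (\<lambda>y. indicator K y *\<^sub>R u y)"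
    by (rule borel_integrable_compact) (use K assms continuous_on_subset in auto)
  then show "u absolutely_integrable_on K"
    unfolding set_integrable_def by (intro integrable_completion[THEN iffD2]) auto
qed

theorem theorem2p3:
  fixes a :: real and b :: "'a::euclidean_space" and D :: "'a set" and u :: "'a \<Rightarrow> real"
  assumes "a > 0" and "open D"
  shows "mean_value_property a b D u \<longleftrightarrow> harmonic a b D u"
proof -
  define c where "c = b /\<^sub>R (2 * a)"
  \<comment> \<open>A quarter of \<open>|c|^2\<close>: then \<open>4 * L\<close> is the Helmholtz
    coefficient, and \<open>L * r\<^sup>2\<close> is \<open>z\<^sup>2 / 4\<close> for the argument
    \<open>z = r * norm b / (2 * a)\<close> of \<open>kappa\<close>.\<close>
  define L where "L = (norm b / (2 * a))\<^sup>2 / 4"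
  define v where "v y = u y * exp (c \<bullet> y)" for y
  have L: "L \<ge> 0" by (simp add: L_def)
  have kap: "kappa DIM('a) (r * norm b / (2 * a)) = 1 / hyp01 (real DIM('a) / 2) (L * r\<^sup>2)" if "r > 0" for r
    using kappa_eq_hyp01[of "DIM('a)" "r * norm b / (2 * a)"] that \<open>a > 0\<close>
    by (simp add: L_def power_mult_distrib power_divide mult.commute DIM_positive Suc_leI)
  have hpos: "hyp01 (real DIM('a) / 2) (L * r\<^sup>2) > 0" for r
    using L by (intro hyp01_pos) auto
  \<comment> \<open>The exponential centred at \<open>x\<close> differs from the one in
    \<open>v\<close> by a factor constant in \<open>y\<close>, which leaves the integral and turns
    \<open>u x\<close> into \<open>v x\<close>.\<close>
  have integrand: "u y * exp (1 / (2 * a) * (b \<bullet> (y - x))) = v y * exp (- (c \<bullet> x))" for x y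
  proof -
    have "c \<bullet> z = 1 / (2 * a) * (b \<bullet> z)" for z
      unfolding c_def inner_scaleR_left by (simp add: inverse_eq_divide)
    then have "1 / (2 * a) * (b \<bullet> (y - x)) = c \<bullet> y + - (c \<bullet> x)"
      by (simp only: inner_diff_right right_diff_distrib)
    then show ?thesis
      by (simp only: v_def exp_add mult.assoc)
  qed
  have pde: "drift_laplacian a b u x = 0 \<longleftrightarrow> laplacian v x = 4 * L * v x" if "Ck_on 2 D u" "x \<in> D" for x
    using twisted_harmonic_iff[OF assms that, of b] by (simp add: v_def[abs_def] c_def L_def)
  have Ck: "Ck_on 2 D v \<longleftrightarrow> Ck_on 2 D u"
    unfolding v_def[abs_def] by (rule Ck_on_2_mult_exp_iff[OF \<open>open D\<close>])
  show ?thesis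
  proof
    assume "harmonic a b D u"
    then have u: "Ck_on 2 D u" and A: "\<And>x. x \<in> D \<Longrightarrow> drift_laplacian a b u x = 0"
      by (auto simp: harmonic_def)
    have v: "Ck_on 2 D v" using Ck u by simp
    show "mean_value_property a b D u"
      unfolding mean_value_property_def
    proof (intro conjI ballI allI impI)
      show "locally_integrable_on D u"
        by (rule locally_integrable_if_continuous[OF Ck_on_2D(1)[OF u]])
      fix x r assume x: "x \<in> D" and r: "0 < (r::real)" "ereal r < dist_to x (frontier D)"
      \<comment> \<open>Room beyond \<open>r\<close>: the sphere of radius \<open>r\<close> must lie
        inside an open ball contained in \<open>D\<close>.\<close>
      obtain R where R: "r < R" "ereal R \<le> dist_to x (frontier D)"
        using ereal_dense2[OF r(2)] by (auto simp: less_imp_le)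
      have sub: "ball x R \<subseteq> D"
        using R r by (intro ball_subset_if_dist_frontier[OF x]) auto
      note M = spherical_mean_if_helmholtz[OF v sub L r(1) R(1)]
      have i: "integrable unit_ball_measure (\<lambda>z. v (x + r *\<^sub>R dir z))"
        and m: "(LINT z|unit_ball_measure. v (x + r *\<^sub>R dir z)) = hyp01 (real DIM('a) / 2) (L * r\<^sup>2) * v x"
        using M A pde[OF u] by auto
      have "sphere x r \<subseteq> ball x R" using R by auto
      then have "continuous_on (sphere x r) v"
        using Ck_on_2D(1)[OF v] sub continuous_on_subset by blast
      then have "continuous_on (sphere x r) (\<lambda>y. v y * exp (- (c \<bullet> x)))"
        by (intro continuous_intros)
      note S = integral_sphere_continuous[OF r(1) this integrable_mult_left[OF i]]
      show "integrable (normalized_surface_measure x r) (\<lambda>y. u y * exp (1 / (2 * a) * (b \<bullet> (y - x))))"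
        unfolding integrand by (rule S(1))
      have "(LINT y|normalized_surface_measure x r. u y * exp (1 / (2 * a) * (b \<bullet> (y - x)))) =
          hyp01 (real DIM('a) / 2) (L * r\<^sup>2) * u x"
        unfolding integrand S(2) using m by (simp add: v_def exp_minus)
      then show "u x = kappa DIM('a) (r * norm b / (2 * a)) *
          (LINT y|normalized_surface_measure x r. u y * exp (1 / (2 * a) * (b \<bullet> (y - x))))"
        using kap[OF r(1)] hpos[of r] by simp
    qed
  next
    assume mvp: "mean_value_property a b D u"
    have sint: "integrable (normalized_surface_measure x r) v"
      and smean: "integral\<^sup>L (normalized_surface_measure x r) v = hyp01 (real DIM('a) / 2) (L * r\<^sup>2) * v x"
      if x: "x \<in> D" and R: "ball x R \<subseteq> D" "0 < r" "r < R" for x r R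
    proof -
      have "ereal r < ereal R"
        using R(3) by simp
      also have "\<dots> \<le> dist_to x (frontier D)"
        by (rule dist_frontier_ge_if_ball_subset[OF \<open>open D\<close> R(1)])
      finally have "ereal r < dist_to x (frontier D)" .
      note M = mvp[unfolded mean_value_property_def integrand, THEN conjunct2, rule_format, OF x R(2) this]
      have I: "integrable (normalized_surface_measure x r) (\<lambda>y. v y * exp (- (c \<bullet> x)))"
        by (rule M[THEN conjunct1])
      have E: "u x = kappa DIM('a) (r * norm b / (2 * a)) *
          (LINT y|normalized_surface_measure x r. v y * exp (- (c \<bullet> x)))"
        by (rule M[THEN conjunct2])
      show "integrable (normalized_surface_measure x r) v"
        using I by simp
      have "u x * hyp01 (real DIM('a) / 2) (L * r\<^sup>2) = integral\<^sup>L (normalized_surface_measure x r) v * exp (- (c \<bullet> x))"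
        using E kap[OF R(2)] hpos[of r] by (simp add: field_simps)
      then show "integral\<^sup>L (normalized_surface_measure x r) v = hyp01 (real DIM('a) / 2) (L * r\<^sup>2) * v x"
        by (simp add: v_def exp_minus field_simps)
    qed
    have v: "Ck_on 2 D v"
    proof (rule Ck_on_2_locally)
      fix x0 assume "x0 \<in> D"
      then obtain e0 where e0: "e0 > 0" "cball x0 e0 \<subseteq> D"
        using \<open>open D\<close> open_contains_cball by blast
      \<comment> \<open>Half the radius, so that spheres of radius below \<open>e\<close> around
        points of \<open>ball x0 e\<close> stay in \<open>K\<close>.\<close>
      define e where "e = e0 / 2"
      define K where "K = cball x0 e0"
      have e: "e > 0" using e0 by (simp add: e_def)
      have K: "compact K" "K \<subseteq> D" using e0 by (auto simp: K_def)
      have [measurable]: "K \<in> sets borel" by (simp add: K_def)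
      have bK: "ball x e \<subseteq> K" if "x \<in> ball x0 e" for x
      proof
        fix y assume "y \<in> ball x e"
        then have "dist x0 y \<le> dist x0 x + dist x y" "dist x y < e"
          by (auto intro: dist_triangle)
        then show "y \<in> K" using that by (simp add: K_def e_def)
      qed
      have "integrable lebesgue (\<lambda>y. indicator K y *\<^sub>R u y)"
        using mvp K by (simp add: mean_value_property_def locally_integrable_on_def set_integrable_def)
      \<comment> \<open>A Borel representative of \<open>u\<close> on \<open>K\<close>: Lebesgue
        measurability would not survive composition with the sphere map.\<close>
      then obtain f' where f'[measurable]: "f' \<in> borel_measurable lborel" "integrable lborel f'"
        and f'_eq: "AE y in lborel. indicator K y *\<^sub>R u y = f' y"
      proof -
        assume i: "integrable lebesgue (\<lambda>y. indicator K y *\<^sub>R u y)"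
        then obtain g where g: "g \<in> borel_measurable lborel" "AE y in lborel. indicator K y *\<^sub>R u y = g y"
          using completion_ex_borel_measurable_real[OF borel_measurable_integrable[OF i]] by auto
        have "integrable lebesgue g"
          using i by (rule integrable_cong_AE_imp)
            (use g in \<open>auto intro!: measurable_completion AE_completion simp: eq_commute\<close>)
        then have "integrable lborel g"
          using g by (simp add: integrable_completion)
        then show thesis using g that by blast
      qed
      \<comment> \<open>Agrees with \<open>v\<close> on \<open>K\<close> outside the exceptional
        null set; cutting off to the compact set \<open>K\<close> keeps the exponential bounded and
        \<open>w\<close> integrable on the whole space.\<close>
      define w where "w y = f' y * (indicator K y * exp (c \<bullet> y))" for y
      obtain B where B: "\<And>y. y \<in> K \<Longrightarrow> exp (c \<bullet> y) \<le> B"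
      proof -
        have "compact ((\<lambda>y. exp (c \<bullet> y)) ` K)"
          by (intro compact_continuous_image K continuous_intros)
        then have "bounded ((\<lambda>y. exp (c \<bullet> y)) ` K)"
          by (rule compact_imp_bounded)
        then show thesis
          using that by (auto simp: bounded_iff)
      qed
      have w: "integrable lborel w"
      proof (rule Bochner_Integration.integrable_bound[where f = "\<lambda>y. B * f' y"])
        show "w \<in> borel_measurable lborel"
          unfolding w_def by measurable
        show "AE y in lborel. norm (w y) \<le> norm (B * f' y)"
        proof (rule AE_I2)
          fix y
          show "norm (w y) \<le> norm (B * f' y)"
          proof (cases "y \<in> K")
            case True
            have "\<bar>f' y\<bar> * exp (c \<bullet> y) \<le> \<bar>f' y\<bar> * \<bar>B\<bar>"
              using B[OF True] by (intro mult_left_mono) auto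
            then show ?thesis
              using True by (simp add: w_def abs_mult mult.commute)
          qed (simp add: w_def)
        qed
      qed (use f' in simp)
      obtain N where N: "N \<in> null_sets lborel" "{y. indicator K y *\<^sub>R u y \<noteq> f' y} \<subseteq> N"
        using f'_eq by (auto simp: eventually_ae_filter)
      have "Ck_on 2 (ball x0 e) v"
      proof (rule Ck_on_2_if_spherical_mean[OF e L w N(1)])
        fix x s assume x: "x \<in> ball x0 e" and s: "0 < s" "s < e"
          and AE: "AE z in unit_ball_measure. x + s *\<^sub>R dir z \<notin> N"
        have sub: "ball x e \<subseteq> D"
          using bK[OF x] K by blast
        then have xD: "x \<in> D"
          using e by auto
        have "integral\<^sup>L (normalized_surface_measure x s) v = (LINT z|unit_ball_measure. w (x + s *\<^sub>R dir z))"
        proof (rule integral_sphere_AE[OF s(1) _ _ _ AE])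
          show "v \<in> borel_measurable (normalized_surface_measure x s)"
            using sint[OF xD sub s] by auto
          show "w \<in> borel_measurable borel" using w by auto
          show "N \<in> sets borel" using N by auto
          fix y assume y: "y \<in> sphere x s" "y \<notin> N"
          then have "y \<in> ball x e" using s by simp
          then have "y \<in> K" using bK[OF x] by blast
          moreover have "indicator K y *\<^sub>R u y = f' y"
            using y N(2) by blast
          ultimately show "v y = w y"
            by (simp add: v_def w_def)
        qed
        then show "(LINT z|unit_ball_measure. w (x + s *\<^sub>R dir z)) = hyp01 (real DIM('a) / 2) (L * s\<^sup>2) * v x"
          using smean[OF xD sub s] by simp
      qed
      moreover have "ball x0 e \<subseteq> D"
        using e0 by (auto simp: e_def)
      ultimately show "\<exists>T. open T \<and> x0 \<in> T \<and> T \<subseteq> D \<and> Ck_on 2 T v"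
        using e by (intro exI[of _ "ball x0 e"]) auto
    qed
    have u: "Ck_on 2 D u" using Ck v by simp
    have "drift_laplacian a b u x = 0" if x: "x \<in> D" for x
    proof -
      obtain R where R: "R > 0" "ball x R \<subseteq> D"
        using \<open>open D\<close> x openE by blast
      have "laplacian v x = 4 * L * v x"
      proof (rule helmholtz_if_spherical_mean[OF v R L])
        fix s assume s: "0 < s" "s < R"
        have "sphere x s \<subseteq> ball x R" using s by auto
        then have cont: "continuous_on (sphere x s) v"
          using Ck_on_2D(1)[OF v] R continuous_on_subset by blast
        \<comment> \<open>Now that \<open>v\<close> is continuous it is Borel on the sphere, so
          integrability passes from the completed measure to
          \<open>unit_ball_measure\<close>.\<close>
        have "integrable unit_ball_measure (\<lambda>z. v (x + s *\<^sub>R dir z))"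
        proof -
          have m: "v \<in> borel_measurable (restrict_space borel (sphere x s))"
            by (rule borel_measurable_continuous_on_restrict[OF cont])
          have "integrable (distr unit_ball_measure (restrict_space borel (sphere x s)) (\<lambda>z. x + s *\<^sub>R dir z)) v"
            using sint[OF x R(2) s] m by (simp add: normalized_surface_measure_eq[OF s(1)] integrable_completion)
          then show ?thesis
            by (simp add: integrable_distr_eq[OF measurable_sphere_map[OF s(1)] m])
        qed
        then show "(LINT z|unit_ball_measure. v (x + s *\<^sub>R dir z)) = hyp01 (real DIM('a) / 2) (L * s\<^sup>2) * v x"
          using integral_sphere_continuous(2)[OF s(1) cont] smean[OF x R(2) s] by simp
      qed
      then show ?thesis using pde[OF u x] by simp
    qed
    then show "harmonic a b D u"
      using u by (simp add: harmonic_def)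
  qed
qed

end
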